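(* Let $\{\lambda_i : i\geq 1\}$ be a collection of positive real numbers with $\inf_{i\geq 1}\lambda_i=\alpha>0$, and let $\mathbf{P}=\{P_i : i\geq 1\}$ be a collection of independent random variables such that, for every $i\ge 1$, $P_i$ has the law of $(P(\lambda_i)-\lambda_i)/\sqrt{\lambda_i}$, where $P(\lambda_i)$ is a Poisson random variable with parameter $\lambda_i$. Fix an integer $q\geq 1$. Let $\{N^{(n)} : n\geq 1\}$ be a sequence of integers, $N^{(n)}\ge q$, diverging to infinity, and for each $n$ let $f^{(n)}:[N^{(n)}]^q\to\mathbb{R}$ be symmetric and vanishing on diagonals. Set $$F^{(n)}=Q_q(N^{(n)},f^{(n)},\mathbf{P})=\sum_{1\le i_1,\dots,i_q\le N^{(n)}} f^{(n)}(i_1,\dots,i_q)P_{i_1}\cdots P_{i_q}=I_q(g^{(n)}),$$ $$g^{(n)}=\sum_{1\le i_1,\dots,i_q\le N^{(n)}} f^{(n)}(i_1,\dots,i_q)\, g_{i_1}\otimes\cdots\otimes g_{i_q},$$ where the functions $g_i=\mathbf{1}_{A_i}/\sqrt{\lambda_i}$ on $(Z,\mathcal{Z},\mu)$ and the multiple integral $I_q$ are as described in the context. Suppose that $\mathbb{E}[(F^{(n)})^2]\to\sigma^2\in(0,\infty)$ as $n\to\infty$. Then the following two statements are equivalent, as $n\to\infty$: (1) $F^{(n)}$ converges in law to $Y\sim\mathcal{N}(0,\sigma^2)$; (2) $\mathbb{E}[(F^{(n)})^4]\to \mathbb{E}[Y^4]=3\sigma^4$. When $q=1$, either one of conditions (1)--(2)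 is equivalent to (3a) $\displaystyle\sum_{i=1}^{N^{(n)}} f^{(n)}(i)^4\,\frac{1}{\lambda_i}\to 0$. When $q\geq 2$, either one of conditions (1)--(2) is equivalent to either one of the following two equivalent conditions: (3b) $\int_{Z^q}(g^{(n)})^4\,d\mu^q\to 0$ and, for all $r=1,\dots,q$ and all $l=1,\dots,r\wedge(q-1)$, $\|g^{(n)}\star_r^l g^{(n)}\|_{L^2(\mu^{2q-r-l})}\to 0$; (3b') for all $r=1,\dots,q-1$, $\|g^{(n)}\star_r^r g^{(n)}\|_{L^2(\mu^{2q-2r})}\to 0$.
   Context: Notation: $[N]=\{1,\dots,N\}$. A function $f:[N]^q\to\mathbb{R}$ vanishes on diagonals if $f(i_1,\dots,i_q)=0$ whenever $i_k=i_l$ for some $k\neq l$. For integers $1\le q\le N$, a sequence $\mathbf{X}=\{X_i:i\ge1\}$ of independent random variables and $f:[N]^q\to\mathbb{R}$ symmetric and vanishing on diagonals, $Q_q(N,f,\mathbf{X})=\sum_{1\le i_1,\dots,i_q\le N}f(i_1,\dots,i_q)X_{i_1}\cdots X_{i_q}$ is the homogeneous sum of order $q$. Representation: $(Z,\mathcal{Z},\mu)$ is a Borel space with a $\sigma$-finite non-atomic measure $\mu$, $\{A_i:i\ge1\}\subset\mathcal{Z}$ are pairwise disjoint sets with $\mu(A_i)=\lambda_i$, and $g_i=\mathbf{1}_{A_i}/\sqrt{\lambda_i}$. $\hat\eta$ is a compensated Poisson measure on $(Z,\mathcal{Z})$ with control $\mu$ (values on disjoint sets of finite measure are independent and $\hat\eta(B)$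 has the law of a Poisson variable of parameter $\mu(B)$ minus $\mu(B)$), and $I_q$ denotes the multiple Wiener–Itô integral of order $q$ with respect to $\hat\eta$. Without loss of generality $P_i$ is realized as $P_i=I_1(g_i)=\hat\eta(A_i)/\sqrt{\lambda_i}$. The symbol $\otimes$ is the tensor product of functions: $(h_1\otimes\cdots\otimes h_q)(x_1,\dots,x_q)=h_1(x_1)\cdots h_q(x_q)$. Star contractions: for symmetric $f\in L^2(\mu^p)$, $g\in L^2(\mu^q)$, $1\le r\le p\wedge q$, $1\le l\le r$, $$f\star_r^l g(\gamma_1,\dots,\gamma_{r-l},t_1,\dots,t_{p-r},s_1,\dots,s_{q-r})=\int_{Z^l} f(z_1,\dots,z_l,\gamma_1,\dots,\gamma_{r-l},t_1,\dots,t_{p-r})\,g(z_1,\dots,z_l,\gamma_1,\dots,\gamma_{r-l},s_1,\dots,s_{q-r})\,\mu^l(dz_1,\dots,dz_l).$$ *)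

theory Defs
  imports "HOL-Probability.Probability" "HOL-Combinatorics.Permutations"
begin

section \<open>Functions on multi-indices and homogeneous sums\<close>

text \<open>A tuple $(i_1,\dots,i_q) \in [N]^q$ is the extensional function sending \<open>k < q\<close> to the
  entry number \<open>k + 1\<close>. Points of $Z^q$ are represented in the same way, as in \<^const>\<open>PiM\<close>.\<close>

definition multi_index :: "nat \<Rightarrow> nat \<Rightarrow> (nat \<Rightarrow> nat) set" where
  "multi_index q N = PiE {..<q} (\<lambda>_. {1..N})"

definition symmetric_on :: "nat \<Rightarrow> nat \<Rightarrow> ((nat \<Rightarrow> nat) \<Rightarrow> real) \<Rightarrow> bool" where
  "symmetric_on q N f \<longleftrightarrow>
     (\<forall>i\<in>multi_index q N. \<forall>\<pi>. \<pi> permutes {..<q} \<longrightarrow> f (i \<circ> \<pi>) = f i)"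

definition vanishes_on_diagonals :: "nat \<Rightarrow> nat \<Rightarrow> ((nat \<Rightarrow> nat) \<Rightarrow> real) \<Rightarrow> bool" where
  "vanishes_on_diagonals q N f \<longleftrightarrow>
     (\<forall>i\<in>multi_index q N. (\<exists>k<q. \<exists>l<q. k \<noteq> l \<and> i k = i l) \<longrightarrow> f i = 0)"

definition homogeneous_sum ::
  "nat \<Rightarrow> nat \<Rightarrow> ((nat \<Rightarrow> nat) \<Rightarrow> real) \<Rightarrow> (nat \<Rightarrow> 'w \<Rightarrow> real) \<Rightarrow> 'w \<Rightarrow> real" where
  "homogeneous_sum q N f X \<omega> = (\<Sum>i\<in>multi_index q N. f i * (\<Prod>k<q. X (i k) \<omega>))"

definition tensor :: "nat \<Rightarrow> (nat \<Rightarrow> 'z \<Rightarrow> real) \<Rightarrow> (nat \<Rightarrow> 'z) \<Rightarrow> real" where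
  "tensor q h x = (\<Prod>k<q. h k (x k))"

definition tensor_kernel ::
  "nat \<Rightarrow> nat \<Rightarrow> ((nat \<Rightarrow> nat) \<Rightarrow> real) \<Rightarrow> (nat \<Rightarrow> 'z \<Rightarrow> real) \<Rightarrow> (nat \<Rightarrow> 'z) \<Rightarrow> real" where
  "tensor_kernel q N f g x = (\<Sum>i\<in>multi_index q N. f i * tensor q (\<lambda>k. g (i k)) x)"

section \<open>The control space\<close>

text \<open>Borel space in the sense of probability theory: isomorphic, as a measurable space, to a
  Borel subset of the unit interval.\<close>

definition borel_space :: "'z measure \<Rightarrow> bool" where
  "borel_space M \<longleftrightarrow>
     (\<exists>S \<phi> \<psi>. S \<in> sets (borel :: real measure) \<and> S \<subseteq> {0..1} \<and>
        \<phi> \<in> measurable M (restrict_space borel S) \<and>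
        \<psi> \<in> measurable (restrict_space borel S) M \<and>
        (\<forall>z\<in>space M. \<psi> (\<phi> z) = z) \<and> (\<forall>s\<in>S. \<phi> (\<psi> s) = s))"

definition non_atomic :: "'z measure \<Rightarrow> bool" where
  "non_atomic M \<longleftrightarrow>
     (\<forall>A\<in>sets M. 0 < emeasure M A \<longrightarrow>
        (\<exists>B\<in>sets M. B \<subseteq> A \<and> 0 < emeasure M B \<and> emeasure M B < emeasure M A))"

abbreviation power_measure :: "nat \<Rightarrow> 'z measure \<Rightarrow> (nat \<Rightarrow> 'z) measure" where
  "power_measure q \<mu> \<equiv> PiM {..<q} (\<lambda>_. \<mu>)"

definition L2_norm :: "'a measure \<Rightarrow> ('a \<Rightarrow> real) \<Rightarrow> ennreal" where
  "L2_norm M h =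
     (let s = (\<integral>\<^sup>+x. ennreal ((h x)\<^sup>2) \<partial>M) in if s = \<infinity> then \<infinity> else ennreal (sqrt (enn2real s)))"

definition in_L2 :: "'a measure \<Rightarrow> ('a \<Rightarrow> real) \<Rightarrow> bool" where
  "in_L2 M h \<longleftrightarrow> h \<in> borel_measurable M \<and> L2_norm M h < \<infinity>"

section \<open>Star contractions\<close>

text \<open>The argument \<open>x\<close> of the contraction of \<open>f\<close> (\<open>p\<close> variables) and \<open>g\<close> (\<open>q\<close> variables) lists
  $\gamma_1,\dots,\gamma_{r-l},t_1,\dots,t_{p-r},s_1,\dots,s_{q-r}$, so that the $s$-block starts
  at position \<open>p - l\<close>.\<close>

definition star_contraction ::
  "'z measure \<Rightarrow> nat \<Rightarrow> nat \<Rightarrow> nat \<Rightarrow> nat \<Rightarrow> ((nat \<Rightarrow> 'z) \<Rightarrow> real) \<Rightarrow> ((nat \<Rightarrow> 'z) \<Rightarrow> real)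
     \<Rightarrow> (nat \<Rightarrow> 'z) \<Rightarrow> real" where
  "star_contraction \<mu> p q r l f g x =
     (\<integral>z. f (\<lambda>k\<in>{..<p}. if k < l then z k else x (k - l)) *
          g (\<lambda>k\<in>{..<q}. if k < l then z k
                        else if k < r then x (k - l)
                        else x ((p - l) + (k - r))) \<partial>power_measure l \<mu>)"

section \<open>Compensated Poisson measures and multiple Wiener--Ito integrals\<close>

text \<open>Law of a Poisson variable of parameter \<open>a\<close> minus \<open>a\<close>; the library's Poisson distribution
  is only specified for positive parameters.\<close>

definition centred_poisson :: "real \<Rightarrow> real measure" where
  "centred_poisson a =
     distr (measure_pmf (if a = 0 then return_pmf 0 else poisson_pmf a)) borel (\<lambda>k. real k - a)"

text \<open>Only the values of \<open>\<eta>\<close> on sets of finite measure matter. Countable additivity is the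
  requirement that \<open>\<eta>\<close> is a (random) measure, up to null sets depending on the family.\<close>

definition compensated_poisson_measure ::
  "'w measure \<Rightarrow> 'z measure \<Rightarrow> ('z set \<Rightarrow> 'w \<Rightarrow> real) \<Rightarrow> bool" where
  "compensated_poisson_measure M \<mu> \<eta> \<longleftrightarrow>
     (\<forall>B\<in>sets \<mu>. emeasure \<mu> B < \<infinity> \<longrightarrow>
        \<eta> B \<in> borel_measurable M \<and> distr M borel (\<eta> B) = centred_poisson (measure \<mu> B)) \<and>
     (\<forall>(I :: nat set) B. (\<forall>i\<in>I. B i \<in> sets \<mu> \<and> emeasure \<mu> (B i) < \<infinity>) \<and> disjoint_family_on B I \<longrightarrow>
        prob_space.indep_vars M (\<lambda>_. borel) (\<lambda>i. \<eta> (B i)) I) \<and>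
     (\<forall>B :: nat \<Rightarrow> 'z set. range B \<subseteq> sets \<mu> \<and> disjoint_family B \<and> emeasure \<mu> (\<Union>i. B i) < \<infinity> \<longrightarrow>
        (AE \<omega> in M. (\<lambda>i. \<eta> (B i) \<omega>) sums \<eta> (\<Union>i. B i) \<omega>))"

text \<open>\<open>Y\<close> is a version of $I_q(h)$. The integral of an off-diagonal elementary function
  $\sum c(i_1,\dots,i_q)\, 1_{B_{i_1}} \otimes\cdots\otimes 1_{B_{i_q}}$ with pairwise disjoint
  \<open>B\<^sub>j\<close> of finite measure is $\sum c(i_1,\dots,i_q)\, \eta(B_{i_1})\cdots\eta(B_{i_q})$,
  and $I_q$ is its continuous extension to $L^2(\mu^q)$.\<close>

definition is_multiple_integral ::
  "'w measure \<Rightarrow> 'z measure \<Rightarrow> ('z set \<Rightarrow> 'w \<Rightarrow> real) \<Rightarrow> nat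
     \<Rightarrow> ((nat \<Rightarrow> 'z) \<Rightarrow> real) \<Rightarrow> ('w \<Rightarrow> real) \<Rightarrow> bool" where
  "is_multiple_integral M \<mu> \<eta> q h Y \<longleftrightarrow>
     in_L2 (power_measure q \<mu>) h \<and> in_L2 M Y \<and>
     (\<exists>(m :: nat \<Rightarrow> nat) (B :: nat \<Rightarrow> nat \<Rightarrow> 'z set) (c :: nat \<Rightarrow> (nat \<Rightarrow> nat) \<Rightarrow> real).
        (\<forall>j. (\<forall>i\<in>{1..m j}. B j i \<in> sets \<mu> \<and> emeasure \<mu> (B j i) < \<infinity>) \<and>
             disjoint_family_on (B j) {1..m j} \<and>
             vanishes_on_diagonals q (m j) (c j)) \<and>
        (\<lambda>j. L2_norm (power_measure q \<mu>)
               (\<lambda>x. tensor_kernel q (m j) (c j) (\<lambda>i. indicator (B j i)) x - h x)) \<longlonglongrightarrow> 0 \<and>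
        (\<lambda>j. L2_norm M
               (\<lambda>\<omega>. homogeneous_sum q (m j) (c j) (\<lambda>i. \<eta> (B j i)) \<omega> - Y \<omega>)) \<longlonglongrightarrow> 0)"

end

theory Submission
  imports Defs
begin

text \<open>
  Collecting the tuples with the same range, \<open>F\<close> becomes a multilinear polynomial
  \<open>\<Sum>S. a S * (\<Prod>k\<in>S. P k)\<close> over \<open>q\<close>-element sets \<open>S\<close>, and up to factorials the squared norm
  of the contraction with \<open>r = l\<close> becomes the sum of \<open>(\<Sum>y. a (x \<union> y) * a (x' \<union> y))\<^sup>2\<close> over sets
  \<open>x\<close>, \<open>x'\<close> of size \<open>q - r\<close>.

  Fourth moment to contractions: the second Charlier polynomials \<open>C\<close> satisfy \<open>E (C\<^sup>2) = 2\<close>, exactly as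
  Hermite polynomials do, so the projection of \<open>F\<^sup>2\<close> to the top chaos has the same norm as in the
  Gaussian case, namely \<open>2 * (E F\<^sup>2)\<^sup>2\<close> plus the sum of the squared contraction norms. Bessel's inequality
  then bounds that sum by \<open>E F\<^sup>4 - 3 * (E F\<^sup>2)\<^sup>2\<close>.

  Contractions to normality: write \<open>F = A i + P i * B i\<close> with \<open>A i\<close>, \<open>B i\<close> independent of \<open>P i\<close>. The Stein
  identity of the Poisson law shows that the characteristic function nearly solves
  \<open>\<phi>' t = - t * \<sigma>\<^sup>2 * \<phi> t\<close>, with an error governed by the variance of \<open>\<Sum>i. (B i)\<^sup>2\<close> and by
  \<open>\<Sum>i. E (B i)\<^sup>4 / lam i\<close>. Both are controlled by contractions if \<open>q \<ge> 2\<close>; if \<open>q = 1\<close>, the former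
  vanishes and the latter is condition (3a).

  Normality to fourth moment: sixth moments are bounded by hypercontractivity, so the fourth powers are
  uniformly integrable.
\<close>

text \<open>All computations take place on finitely many independent sites, and chaos decompositions
  become bookkeeping of which sets contain a given site. The integral \<open>I_q\<close> enters
  once, for a kernel that is already elementary. Contractions with \<open>l < r\<close> need no
  separate analysis: fixing \<open>r - l\<close> variables common to both factors costs a factor
  \<open>1 / lam \<le> 1 / \<alpha>\<close> for each of them, and what remains is dominated by the
  contraction with both indices equal to \<open>l\<close>. Projecting to the top chaos discards the
  intermediate chaoses of the square, where the Poisson law differs from the Gaussian one. The
  resulting inequality suffices, because the equivalences for \<open>q \<ge> 2\<close> close as a
  cycle: normality, fourth moment, contractions, normality. For \<open>q = 1\<close> there is no
  contraction to bound, and the fourth moment is computed exactly. The obstacle in the Stein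
  argument is that the Poisson law comes with a difference quotient instead of a derivative.
  Replacing one by the other leaves an error of third order in \<open>B i\<close>, which a free
  parameter \<open>\<theta>\<close> distributes over second and fourth moments.\<close>

section \<open>Random variables with all moments\<close>

text \<open>This class is closed under sums and products, so integrability of any polynomial in the
  \<open>P i\<close> follows from its syntactic form, without tracking exponents.\<close>

definition has_moments :: "'w measure \<Rightarrow> ('w \<Rightarrow> real) \<Rightarrow> bool" where
  "has_moments M X \<longleftrightarrow> X \<in> borel_measurable M \<and> (\<forall>n. integrable M (\<lambda>\<omega>. X \<omega> ^ n))"

lemma has_moments_measurable [dest, measurable_dest]: "has_moments M X \<Longrightarrow> X \<in> borel_measurable M"
  by (simp add: has_moments_def)

lemma has_moments_integrable_power: "has_moments M X \<Longrightarrow> integrable M (\<lambda>\<omega>. X \<omega> ^ n)"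
  by (simp add: has_moments_def)

lemma has_moments_integrable: "has_moments M X \<Longrightarrow> integrable M X"
  using has_moments_integrable_power[of M X 1] by simp

lemma has_moments_integrable_abs: "has_moments M X \<Longrightarrow> integrable M (\<lambda>\<omega>. \<bar>X \<omega>\<bar> ^ n)"
  using integrable_abs[OF has_moments_integrable_power[of M X n]] by (simp add: power_abs)

context finite_measure
begin

lemma has_moments_const [intro, simp]: "has_moments M (\<lambda>_. c)"
  by (simp add: has_moments_def)

lemma has_moments_mult [intro]:
  assumes "has_moments M X" "has_moments M Y"
  shows "has_moments M (\<lambda>\<omega>. X \<omega> * Y \<omega>)"
  unfolding has_moments_def
proof (intro conjI allI)
  note [measurable] = has_moments_measurable[OF assms(1)] has_moments_measurable[OF assms(2)]
  show "(\<lambda>\<omega>. X \<omega> * Y \<omega>) \<in> borel_measurable M" by measurable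
  fix n
  have i: "integrable M (\<lambda>\<omega>. X \<omega> ^ (2*n) + Y \<omega> ^ (2*n))"
    using assms by (intro Bochner_Integration.integrable_add has_moments_integrable_power)
  have "\<bar>(x * y) ^ n\<bar> \<le> \<bar>x ^ (2*n) + y ^ (2*n)\<bar>" for x y :: real
  proof -
    have "2 * (\<bar>x^n\<bar> * \<bar>y^n\<bar>) \<le> (x^n)\<^sup>2 + (y^n)\<^sup>2"
      using sum_squares_bound[of "\<bar>x^n\<bar>" "\<bar>y^n\<bar>"] by (simp add: mult.assoc)
    moreover have "0 \<le> \<bar>x^n\<bar> * \<bar>y^n\<bar>" by simp
    ultimately have "\<bar>x^n\<bar> * \<bar>y^n\<bar> \<le> (x^n)\<^sup>2 + (y^n)\<^sup>2" by linarith
    then show ?thesis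
      by (simp add: power_mult_distrib abs_mult mult.commute[of 2] power_mult)
  qed
  then show "integrable M (\<lambda>\<omega>. (X \<omega> * Y \<omega>) ^ n)"
    by (intro Bochner_Integration.integrable_bound[OF i]) auto
qed

lemma has_moments_add [intro]:
  assumes "has_moments M X" "has_moments M Y"
  shows "has_moments M (\<lambda>\<omega>. X \<omega> + Y \<omega>)"
  unfolding has_moments_def
proof (intro conjI allI)
  note [measurable] = has_moments_measurable[OF assms(1)] has_moments_measurable[OF assms(2)]
  show "(\<lambda>\<omega>. X \<omega> + Y \<omega>) \<in> borel_measurable M" by measurable
  fix n
  have "integrable M (\<lambda>\<omega>. \<Sum>k\<le>n. of_nat (n choose k) * X \<omega> ^ k * Y \<omega> ^ (n - k))"
  proof (intro Bochner_Integration.integrable_sum)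
    fix k
    have "integrable M (\<lambda>\<omega>. X \<omega> ^ k * Y \<omega> ^ (n - k))"
    proof (rule has_moments_integrable[OF has_moments_mult])
      show "has_moments M (\<lambda>\<omega>. X \<omega> ^ k)"
        using assms(1) by (auto simp: has_moments_def power_mult[symmetric])
      show "has_moments M (\<lambda>\<omega>. Y \<omega> ^ (n - k))"
        using assms(2) by (auto simp: has_moments_def power_mult[symmetric])
    qed
    then show "integrable M (\<lambda>\<omega>. of_nat (n choose k) * X \<omega> ^ k * Y \<omega> ^ (n - k))"
      by (simp add: mult.assoc)
  qed
  then show "integrable M (\<lambda>\<omega>. (X \<omega> + Y \<omega>) ^ n)"
    by (simp add: binomial_ring)
qed

lemma has_moments_uminus [intro]: "has_moments M X \<Longrightarrow> has_moments M (\<lambda>\<omega>. - X \<omega>)"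
  using has_moments_mult[OF has_moments_const[of "-1"], of X] by simp

lemma has_moments_diff [intro]:
  "has_moments M X \<Longrightarrow> has_moments M Y \<Longrightarrow> has_moments M (\<lambda>\<omega>. X \<omega> - Y \<omega>)"
  using has_moments_add[of X "\<lambda>\<omega>. - Y \<omega>"] by auto

lemma has_moments_divide [intro]: "has_moments M X \<Longrightarrow> has_moments M (\<lambda>\<omega>. X \<omega> / c)"
  using has_moments_mult[OF _ has_moments_const[of "1/c"], of X] by simp

lemma has_moments_power [intro]: "has_moments M X \<Longrightarrow> has_moments M (\<lambda>\<omega>. X \<omega> ^ n)"
  by (auto simp: has_moments_def power_mult[symmetric])

lemma has_moments_sum [intro]:
  "(\<And>i. i \<in> A \<Longrightarrow> has_moments M (X i)) \<Longrightarrow> has_moments M (\<lambda>\<omega>. \<Sum>i\<in>A. X i \<omega>)"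
  by (induction A rule: infinite_finite_induct) auto

lemma has_moments_prod [intro]:
  "(\<And>i. i \<in> A \<Longrightarrow> has_moments M (X i)) \<Longrightarrow> has_moments M (\<lambda>\<omega>. \<Prod>i\<in>A. X i \<omega>)"
  by (induction A rule: infinite_finite_induct) auto

end

section \<open>The Poisson law\<close>

lemma integrable_poisson_iff:
  fixes h :: "nat \<Rightarrow> 'a::{banach, second_countable_topology}"
  assumes "r > 0"
  shows "integrable (measure_pmf (poisson_pmf r)) h \<longleftrightarrow> summable (\<lambda>k. pmf (poisson_pmf r) k * norm (h k))"
  by (simp add: measure_pmf_eq_density integrable_density integrable_count_space_nat_iff)

lemma integral_poisson:
  fixes h :: "nat \<Rightarrow> 'a::{banach, second_countable_topology}"
  assumes "r > 0" "integrable (measure_pmf (poisson_pmf r)) h"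
  shows "(\<lambda>k. pmf (poisson_pmf r) k *\<^sub>R h k) sums (\<integral>k. h k \<partial>measure_pmf (poisson_pmf r))"
proof -
  have "integrable (count_space UNIV) (\<lambda>k. pmf (poisson_pmf r) k *\<^sub>R h k)"
    using assms(2) by (simp add: measure_pmf_eq_density integrable_density)
  from sums_integral_count_space_nat[OF this] show ?thesis
    by (simp add: measure_pmf_eq_density integral_density)
qed

text \<open>The weights satisfy \<open>(k + 1) * pmf (k + 1) = r * pmf k\<close>; shifting the index
  is harmless because the term for \<open>k = 0\<close> vanishes. Integrability is part of the
  conclusion, so that the lemma can drive an induction over moments.\<close>

lemma poisson_stein:
  fixes h :: "nat \<Rightarrow> 'a::{banach, second_countable_topology}"
  assumes r: "r > 0" and h: "integrable (measure_pmf (poisson_pmf r)) (\<lambda>k. h (Suc k))"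
  shows "integrable (measure_pmf (poisson_pmf r)) (\<lambda>k. real k *\<^sub>R h k)"
    and "(\<integral>k. real k *\<^sub>R h k \<partial>measure_pmf (poisson_pmf r))
      = r *\<^sub>R (\<integral>k. h (Suc k) \<partial>measure_pmf (poisson_pmf r))"
proof -
  have eq: "pmf (poisson_pmf r) (Suc k) * real (Suc k) = r * pmf (poisson_pmf r) k" for k
    using r by (simp add: field_simps del: of_nat_Suc)
  have "summable (\<lambda>k. r * (pmf (poisson_pmf r) k * norm (h (Suc k))))"
    using h r by (simp only: integrable_poisson_iff) (rule summable_mult)
  then have "summable (\<lambda>k. pmf (poisson_pmf r) (Suc k) * norm (real (Suc k) *\<^sub>R h (Suc k)))"
    by (simp add: eq mult.assoc[symmetric] del: pmf_poisson of_nat_Suc)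
  then show i: "integrable (measure_pmf (poisson_pmf r)) (\<lambda>k. real k *\<^sub>R h k)"
    using r by (simp only: integrable_poisson_iff) (subst summable_Suc_iff[symmetric])
  have "(\<lambda>k. r *\<^sub>R (pmf (poisson_pmf r) k *\<^sub>R h (Suc k))) sums
      (r *\<^sub>R (\<integral>k. h (Suc k) \<partial>measure_pmf (poisson_pmf r)))"
    by (intro sums_scaleR_right integral_poisson r h)
  then have "(\<lambda>k. pmf (poisson_pmf r) (Suc k) *\<^sub>R (real (Suc k) *\<^sub>R h (Suc k))) sums
      (r *\<^sub>R (\<integral>k. h (Suc k) \<partial>measure_pmf (poisson_pmf r)))"
    by (simp only: scaleR_scaleR eq)
  then have "(\<lambda>k. pmf (poisson_pmf r) k *\<^sub>R (real k *\<^sub>R h k)) sums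
      (r *\<^sub>R (\<integral>k. h (Suc k) \<partial>measure_pmf (poisson_pmf r)))"
    by (subst (asm) sums_Suc_iff) simp
  with integral_poisson[OF r i]
  show "(\<integral>k. real k *\<^sub>R h k \<partial>measure_pmf (poisson_pmf r))
      = r *\<^sub>R (\<integral>k. h (Suc k) \<partial>measure_pmf (poisson_pmf r))"
    by (rule sums_unique2)
qed

text \<open>Write \<open>k ^ n\<close> as \<open>k * k ^ (n - 1)\<close>: the Stein identity reduces
  its integrability to that of \<open>(k + 1) ^ (n - 1)\<close>, which is a combination of lower
  powers.\<close>

lemma has_moments_poisson:
  assumes "r > 0"
  shows "has_moments (measure_pmf (poisson_pmf r)) real"
  unfolding has_moments_def
proof (intro conjI allI)
  fix n show "integrable (measure_pmf (poisson_pmf r)) (\<lambda>k. real k ^ n)"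
  proof (induction n rule: less_induct)
    case (less n)
    show ?case
    proof (cases n)
      case (Suc m)
      have "integrable (measure_pmf (poisson_pmf r)) (\<lambda>k. \<Sum>j\<le>m. of_nat (m choose j) * real k ^ j)"
        using less Suc by (intro Bochner_Integration.integrable_sum integrable_mult_right) auto
      then have "integrable (measure_pmf (poisson_pmf r)) (\<lambda>k. real (Suc k) ^ m)"
        by (simp add: binomial_ring add.commute[of 1])
      from poisson_stein(1)[OF assms this] show ?thesis by (simp add: Suc)
    qed simp
  qed
qed simp

section \<open>Independent normalized Poisson variables and their moments\<close>

locale normalized_poisson = prob_space M for M :: "'w measure" +
  fixes P :: "nat \<Rightarrow> 'w \<Rightarrow> real" and lam :: "nat \<Rightarrow> real" and \<alpha> :: real
  assumes P_indep: "indep_vars (\<lambda>_. borel) P {1..}"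
    and P_law: "\<And>i. i \<ge> 1 \<Longrightarrow>
      distr M borel (P i) =
      distr (measure_pmf (poisson_pmf (lam i))) borel (\<lambda>k. (real k - lam i) / sqrt (lam i))"
    and lam_ge: "\<And>i. i \<ge> 1 \<Longrightarrow> lam i \<ge> \<alpha>" and alpha_pos: "\<alpha> > 0"
begin

text \<open>The spacing of the lattice on which \<open>P i\<close> lives. It is also the third
  moment of \<open>P i\<close> and measures the distance to the Gaussian case.\<close>

definition \<kappa> :: "nat \<Rightarrow> real" where "\<kappa> i = 1 / sqrt (lam i)"

lemma lam_pos: "i \<ge> 1 \<Longrightarrow> lam i > 0"
  using lam_ge[of i] alpha_pos by simp

lemma kappa_pos: "i \<ge> 1 \<Longrightarrow> \<kappa> i > 0"
  using lam_pos by (simp add: \<kappa>_def)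

lemma kappa_sq: "i \<ge> 1 \<Longrightarrow> (\<kappa> i)\<^sup>2 = 1 / lam i"
  using lam_pos[of i] by (simp add: \<kappa>_def power_divide)

lemma P_measurable [measurable]: "i \<ge> 1 \<Longrightarrow> P i \<in> borel_measurable M"
  using P_indep by (auto simp: indep_vars_def)

lemma integrable_P_iff:
  fixes h :: "real \<Rightarrow> 'a::{banach, second_countable_topology}"
  assumes "i \<ge> 1" and [measurable]: "h \<in> borel_measurable borel"
  shows "integrable M (\<lambda>\<omega>. h (P i \<omega>)) \<longleftrightarrow>
    integrable (measure_pmf (poisson_pmf (lam i))) (\<lambda>k. h ((real k - lam i) / sqrt (lam i)))"
proof -
  have "integrable M (\<lambda>\<omega>. h (P i \<omega>)) \<longleftrightarrow> integrable (distr M borel (P i)) h"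
    using assms(1) by (intro integrable_distr_eq[symmetric]) auto
  then show ?thesis unfolding P_law[OF assms(1)] by (simp add: integrable_distr_eq)
qed

lemma expectation_P:
  fixes h :: "real \<Rightarrow> 'a::{banach, second_countable_topology}"
  assumes "i \<ge> 1" and [measurable]: "h \<in> borel_measurable borel"
  shows "(\<integral>\<omega>. h (P i \<omega>) \<partial>M) =
    (\<integral>k. h ((real k - lam i) / sqrt (lam i)) \<partial>measure_pmf (poisson_pmf (lam i)))"
proof -
  have "(\<integral>\<omega>. h (P i \<omega>) \<partial>M) = integral\<^sup>L (distr M borel (P i)) h"
    using assms(1) by (intro integral_distr[symmetric]) auto
  then show ?thesis unfolding P_law[OF assms(1)] by (simp add: integral_distr)
qed

lemma has_moments_P [intro]:
  assumes "i \<ge> 1" shows "has_moments M (P i)"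
proof -
  have "has_moments (measure_pmf (poisson_pmf (lam i))) (\<lambda>k. (real k - lam i) / sqrt (lam i))"
    using has_moments_poisson[OF lam_pos[OF assms]]
    by (intro measure_pmf.has_moments_divide measure_pmf.has_moments_diff) auto
  then show ?thesis
    using assms integrable_P_iff[OF assms, of "\<lambda>x. x ^ _"] by (auto simp: has_moments_def)
qed

text \<open>A unit step of the Poisson variable moves \<open>P i\<close> by
  \<open>\<kappa> i\<close>, so \<open>poisson_stein\<close> becomes integration by parts with a
  difference quotient. Vector values allow complex exponentials as test functions.\<close>

lemma P_stein:
  fixes h :: "real \<Rightarrow> 'a::{banach, second_countable_topology}"
  assumes i: "i \<ge> 1" and [measurable]: "h \<in> borel_measurable borel"
    and h: "integrable M (\<lambda>\<omega>. h (P i \<omega>))" "integrable M (\<lambda>\<omega>. h (P i \<omega> + \<kappa> i))"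
  shows "(\<integral>\<omega>. P i \<omega> *\<^sub>R h (P i \<omega>) \<partial>M) =
    (1 / \<kappa> i) *\<^sub>R ((\<integral>\<omega>. h (P i \<omega> + \<kappa> i) \<partial>M) - (\<integral>\<omega>. h (P i \<omega>) \<partial>M))"
proof -
  let ?\<pi> = "measure_pmf (poisson_pmf (lam i))"
  define s where "s = sqrt (lam i)"
  have s: "s > 0" "lam i = s * s" "\<kappa> i = 1 / s"
    using lam_pos[OF i] by (auto simp: s_def \<kappa>_def)
  let ?x = "\<lambda>k. (real k - lam i) / s"
  have shift: "?x (Suc k) = ?x k + \<kappa> i" for k
    using s by (simp add: field_simps)
  have ih: "integrable ?\<pi> (\<lambda>k. h (?x k))"
    using h(1) integrable_P_iff[OF i, of h] by (simp add: s_def)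
  have iS: "integrable ?\<pi> (\<lambda>k. h (?x (Suc k)))"
    unfolding shift using h(2) integrable_P_iff[OF i, of "\<lambda>x. h (x + \<kappa> i)"] by (simp add: s_def)
  note st = poisson_stein[OF lam_pos[OF i], of "\<lambda>k. h (?x k)", OF iS]
  have "(\<integral>\<omega>. P i \<omega> *\<^sub>R h (P i \<omega>) \<partial>M) = (\<integral>k. ?x k *\<^sub>R h (?x k) \<partial>?\<pi>)"
    using expectation_P[OF i, of "\<lambda>x. x *\<^sub>R h x"] by (simp add: s_def)
  also have "\<dots> = (\<integral>k. (1/s) *\<^sub>R (real k *\<^sub>R h (?x k)) - s *\<^sub>R h (?x k) \<partial>?\<pi>)"
    using s by (intro Bochner_Integration.integral_cong)
      (auto simp: diff_divide_distrib scaleR_diff_left)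
  also have "\<dots> = (1/s) *\<^sub>R (lam i *\<^sub>R (\<integral>k. h (?x (Suc k)) \<partial>?\<pi>)) - s *\<^sub>R (\<integral>k. h (?x k) \<partial>?\<pi>)"
    using st(1) ih
    by (subst Bochner_Integration.integral_diff) (auto simp only: st(2) integrable_scaleR_right
        Bochner_Integration.integral_scaleR_right)
  also have "\<dots> = s *\<^sub>R ((\<integral>k. h (?x k + \<kappa> i) \<partial>?\<pi>) - (\<integral>k. h (?x k) \<partial>?\<pi>))"
    unfolding shift using s by (simp add: scaleR_diff_right)
  also have "\<dots> = (1 / \<kappa> i) *\<^sub>R ((\<integral>\<omega>. h (P i \<omega> + \<kappa> i) \<partial>M) - (\<integral>\<omega>. h (P i \<omega>) \<partial>M))"
    using expectation_P[OF i, of h] expectation_P[OF i, of "\<lambda>x. h (x + \<kappa> i)"] s(1,3)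
    by (simp add: s_def[symmetric])
  finally show ?thesis .
qed

text \<open>Apply \<open>P_stein\<close> to \<open>x ^ n\<close> and expand
  \<open>(x + \<kappa> i) ^ n\<close>; the leading term cancels in the difference.\<close>

lemma P_moment_Suc:
  assumes i: "i \<ge> 1"
  shows "expectation (\<lambda>\<omega>. P i \<omega> ^ Suc n) =
    (\<Sum>j<n. of_nat (n choose j) * \<kappa> i ^ (n - 1 - j) * expectation (\<lambda>\<omega>. P i \<omega> ^ j))"
proof -
  note P = has_moments_P[OF i]
  have k: "\<kappa> i \<noteq> 0" using kappa_pos[OF i] by simp
  have int: "integrable M (\<lambda>\<omega>. P i \<omega> ^ j)" for j
    using P by (intro has_moments_integrable_power)
  have "expectation (\<lambda>\<omega>. P i \<omega> ^ Suc n) = (1 / \<kappa> i) *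
     (expectation (\<lambda>\<omega>. (P i \<omega> + \<kappa> i) ^ n) - expectation (\<lambda>\<omega>. P i \<omega> ^ n))"
    using P_stein[OF i, of "\<lambda>x. x ^ n"] P
      has_moments_integrable_power[OF has_moments_add[OF P has_moments_const[of "\<kappa> i"]], of n]
    by (simp add: has_moments_integrable_power)
  also have "expectation (\<lambda>\<omega>. (P i \<omega> + \<kappa> i) ^ n) =
      (\<Sum>j\<le>n. of_nat (n choose j) * \<kappa> i ^ (n - j) * expectation (\<lambda>\<omega>. P i \<omega> ^ j))"
  proof -
    have "expectation (\<lambda>\<omega>. (P i \<omega> + \<kappa> i) ^ n) =
        expectation (\<lambda>\<omega>. \<Sum>j\<le>n. (of_nat (n choose j) * \<kappa> i ^ (n - j)) * P i \<omega> ^ j)"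
      by (intro Bochner_Integration.integral_cong) (auto simp: binomial_ring mult_ac)
    also have "\<dots> = (\<Sum>j\<le>n. of_nat (n choose j) * \<kappa> i ^ (n - j) * expectation (\<lambda>\<omega>. P i \<omega> ^ j))"
      by (subst Bochner_Integration.integral_sum) (simp_all add: int)
    finally show ?thesis .
  qed
  also have "\<dots> - expectation (\<lambda>\<omega>. P i \<omega> ^ n) =
      (\<Sum>j<n. of_nat (n choose j) * \<kappa> i ^ (n - j) * expectation (\<lambda>\<omega>. P i \<omega> ^ j))"
    by (simp add: lessThan_Suc_atMost[symmetric])
  also have "1 / \<kappa> i * \<dots> =
      (\<Sum>j<n. of_nat (n choose j) * \<kappa> i ^ (n - 1 - j) * expectation (\<lambda>\<omega>. P i \<omega> ^ j))"
    unfolding sum_distrib_left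
  proof (rule sum.cong)
    fix j assume "j \<in> {..<n}"
    then have "n - j = Suc (n - 1 - j)" by auto
    then show "1 / \<kappa> i * (real (n choose j) * \<kappa> i ^ (n - j) * expectation (\<lambda>\<omega>. P i \<omega> ^ j)) =
         real (n choose j) * \<kappa> i ^ (n - 1 - j) * expectation (\<lambda>\<omega>. P i \<omega> ^ j)"
      using k by simp
  qed simp
  finally show ?thesis .
qed

lemma P_moments:
  assumes i: "i \<ge> 1"
  shows "expectation (P i) = 0"
    and "expectation (\<lambda>\<omega>. P i \<omega> ^ 2) = 1"
    and "expectation (\<lambda>\<omega>. P i \<omega> ^ 3) = \<kappa> i"
    and "expectation (\<lambda>\<omega>. P i \<omega> ^ 4) = 3 + \<kappa> i ^ 2"
    and "expectation (\<lambda>\<omega>. P i \<omega> ^ 5) = 10 * \<kappa> i + \<kappa> i ^ 3"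
    and "expectation (\<lambda>\<omega>. P i \<omega> ^ 6) = 15 + 25 * \<kappa> i ^ 2 + \<kappa> i ^ 4"
proof -
  show 1: "expectation (P i) = 0"
    using P_moment_Suc[OF i, of 0] by simp
  show 2: "expectation (\<lambda>\<omega>. P i \<omega> ^ 2) = 1"
    using P_moment_Suc[OF i, of 1] 1 by (simp add: prob_space numeral_2_eq_2)
  show 3: "expectation (\<lambda>\<omega>. P i \<omega> ^ 3) = \<kappa> i"
    using P_moment_Suc[OF i, of 2] 1 by (simp add: prob_space lessThan_Suc eval_nat_numeral)
  show 4: "expectation (\<lambda>\<omega>. P i \<omega> ^ 4) = 3 + \<kappa> i ^ 2"
    using P_moment_Suc[OF i, of 3] 1 2
    by (simp add: prob_space lessThan_Suc eval_nat_numeral)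
  show 5: "expectation (\<lambda>\<omega>. P i \<omega> ^ 5) = 10 * \<kappa> i + \<kappa> i ^ 3"
    using P_moment_Suc[OF i, of 4] 1 2 3
    by (simp add: prob_space lessThan_Suc eval_nat_numeral)
  show "expectation (\<lambda>\<omega>. P i \<omega> ^ 6) = 15 + 25 * \<kappa> i ^ 2 + \<kappa> i ^ 4"
    using P_moment_Suc[OF i, of 5] 1 2 3 4
    by (simp add: prob_space lessThan_Suc eval_nat_numeral algebra_simps)
qed

section \<open>Multilinear polynomials in the \<open>P i\<close>; homogeneity is imposed through the
  coefficients\<close>

definition chaos :: "nat set \<Rightarrow> (nat set \<Rightarrow> real) \<Rightarrow> 'w \<Rightarrow> real" where
  "chaos I a \<omega> = (\<Sum>S\<in>Pow I. a S * (\<Prod>k\<in>S. P k \<omega>))"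

lemma has_moments_chaos [intro]: "I \<subseteq> {1..} \<Longrightarrow> has_moments M (chaos I a)"
  unfolding chaos_def
  by (intro has_moments_sum has_moments_mult has_moments_const has_moments_prod has_moments_P) auto

text \<open>Separate the sets without \<open>i\<close> from those containing it. Both polynomials on
  the right avoid the variable \<open>P i\<close>, so they are jointly independent of it.\<close>

lemma chaos_insert:
  assumes "finite I" "i \<notin> I"
  shows "chaos (insert i I) a \<omega> = chaos I a \<omega> + P i \<omega> * chaos I (\<lambda>S. a (insert i S)) \<omega>"
proof -
  have inj: "inj_on (insert i) (Pow I)"
    using assms(2) by (auto simp: inj_on_def)
  have "(\<Prod>k\<in>insert i S. P k \<omega>) = P i \<omega> * (\<Prod>k\<in>S. P k \<omega>)" if "S \<in> Pow I" for S
    using that assms finite_subset[of S I] by (subst prod.insert) auto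
  then have "(\<Sum>S\<in>insert i ` Pow I. a S * (\<Prod>k\<in>S. P k \<omega>))
      = P i \<omega> * chaos I (\<lambda>S. a (insert i S)) \<omega>"
    unfolding chaos_def sum_distrib_left sum.reindex[OF inj] comp_def
    by (intro sum.cong) (auto simp: mult_ac)
  then show ?thesis
    unfolding chaos_def Pow_insert
    using assms by (subst sum.union_disjoint) (auto simp: chaos_def)
qed

text \<open>In a splitting \<open>A + P i * B\<close> the parts \<open>A\<close> and
  \<open>B\<close> depend on each other, so independence from \<open>P i\<close> has to be stated
  for the pair. The maps \<open>g\<close> and \<open>h\<close> are arbitrary, to cover monomials as
  well as the joint law needed for characteristic functions.\<close>

lemma indep_chaos:
  assumes "finite I" "I \<subseteq> {1..}" "i \<ge> 1" "i \<notin> I"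
    and [measurable]: "g \<in> measurable borel N1" "h \<in> measurable (borel \<Otimes>\<^sub>M borel) N2"
  shows "indep_var N1 (\<lambda>\<omega>. g (P i \<omega>)) N2 (\<lambda>\<omega>. h (chaos I a \<omega>, chaos I b \<omega>))"
proof -
  define G where "G = (\<lambda>c (x :: nat \<Rightarrow> real). \<Sum>S\<in>Pow I. c S * (\<Prod>k\<in>S. x k) :: real)"
  have [measurable]: "G c \<in> borel_measurable (PiM I (\<lambda>_. borel))" for c
    unfolding G_def
    by (intro borel_measurable_sum borel_measurable_times borel_measurable_const
        borel_measurable_prod measurable_component_singleton) auto
  have G: "G c (\<lambda>k\<in>I. P k \<omega>) = chaos I c \<omega>" for c \<omega>
    unfolding G_def chaos_def by (intro sum.cong arg_cong2[where f="(*)"] prod.cong) auto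
  have "indep_var (PiM {i} (\<lambda>_. borel)) (\<lambda>\<omega>. restrict (\<lambda>k. P k \<omega>) {i})
      (PiM I (\<lambda>_. borel)) (\<lambda>\<omega>. restrict (\<lambda>k. P k \<omega>) I)"
    by (rule indep_var_restrict[OF P_indep]) (use assms in auto)
  then have "indep_var N1 ((\<lambda>x. g (x i)) \<circ> (\<lambda>\<omega>. restrict (\<lambda>k. P k \<omega>) {i}))
      N2 ((\<lambda>x. h (G a x, G b x)) \<circ> (\<lambda>\<omega>. restrict (\<lambda>k. P k \<omega>) I))"
    by (rule indep_var_compose) measurable
  then show ?thesis by (simp add: comp_def G)
qed

lemma expectation_P_chaos:
  assumes "finite I" "I \<subseteq> {1..}" "i \<ge> 1" "i \<notin> I"
  shows "expectation (\<lambda>\<omega>. P i \<omega> ^ k * (chaos I a \<omega> ^ m * chaos I b \<omega> ^ n)) =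
    expectation (\<lambda>\<omega>. P i \<omega> ^ k) * expectation (\<lambda>\<omega>. chaos I a \<omega> ^ m * chaos I b \<omega> ^ n)"
proof -
  have "indep_var borel (\<lambda>\<omega>. P i \<omega> ^ k) borel (\<lambda>\<omega>. chaos I a \<omega> ^ m * chaos I b \<omega> ^ n)"
    using indep_chaos[OF assms, of "\<lambda>x. x ^ k" borel "\<lambda>x. fst x ^ m * snd x ^ n" borel a b] by simp
  then show ?thesis
    using assms
    by (intro indep_var_lebesgue_integral has_moments_integrable has_moments_mult has_moments_power
        has_moments_chaos has_moments_P)
qed

lemma expectation_prod_P:
  assumes "finite I" "I \<subseteq> {1..}" "\<And>k. k \<in> I \<Longrightarrow> h k \<in> borel_measurable borel"
    and "\<And>k. k \<in> I \<Longrightarrow> integrable M (\<lambda>\<omega>. h k (P k \<omega>) :: real)"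
  shows "expectation (\<lambda>\<omega>. \<Prod>k\<in>I. h k (P k \<omega>)) = (\<Prod>k\<in>I. expectation (\<lambda>\<omega>. h k (P k \<omega>)))"
proof -
  have "indep_vars (\<lambda>_. borel) (\<lambda>k \<omega>. h k (P k \<omega>)) I"
    using indep_vars_compose2[OF indep_vars_subset[OF P_indep assms(2)], of h "\<lambda>_. borel"] assms(3)
    by auto
  then show ?thesis
    using assms by (intro indep_vars_lebesgue_integral) auto
qed

section \<open>Hypercontractivity\<close>

text \<open>A bound for the sum of the coefficients, other than that of \<open>A\<^sup>6\<close>, in the expansion of \<open>E (A + P i * B)\<^sup>6\<close>.\<close>

definition K\<^sub>6 :: real where
  "K\<^sub>6 = (let k = 1 / sqrt \<alpha> in 75 + 80 * k + 40 * k^2 + 6 * k^3 + k^4)"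

lemma K6_ge: "K\<^sub>6 \<ge> 75"
  using alpha_pos by (simp add: K\<^sub>6_def Let_def)

lemma kappa_le: "i \<ge> 1 \<Longrightarrow> \<kappa> i \<le> 1 / sqrt \<alpha>"
  using lam_ge[of i] alpha_pos by (simp add: \<kappa>_def frac_le)

text \<open>Because \<open>P i\<close> is centred, the term linear in \<open>B\<close> disappears
  from the binomial expansion. Every other term except \<open>A ^ 6\<close> contains at least
  \<open>B\<^sup>2\<close>, and such terms are dominated by
  \<open>A ^ 4 * B\<^sup>2 + B ^ 6\<close>.\<close>

lemma sixth_moment_step:
  fixes a b :: "nat set \<Rightarrow> real"
  assumes I: "finite I" "I \<subseteq> {1..}" "i \<ge> 1" "i \<notin> I"
  defines "A \<equiv> chaos I a" and "B \<equiv> chaos I b"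
  shows "expectation (\<lambda>\<omega>. (A \<omega> + P i \<omega> * B \<omega>) ^ 6) \<le> expectation (\<lambda>\<omega>. A \<omega> ^ 6) +
    K\<^sub>6 * (expectation (\<lambda>\<omega>. A \<omega> ^ 4 * B \<omega> ^ 2) + expectation (\<lambda>\<omega>. B \<omega> ^ 6))"
proof -
  define E where "E = (\<lambda>m n. expectation (\<lambda>\<omega>. A \<omega> ^ m * B \<omega> ^ n))"
  define \<mu> where "\<mu> = (\<lambda>k. expectation (\<lambda>\<omega>. P i \<omega> ^ k))"
  have hm: "has_moments M A" "has_moments M B"
    unfolding A_def B_def by (rule has_moments_chaos[OF I(2)])+
  note int = has_moments_integrable[OF has_moments_mult[OF has_moments_power[OF hm(1)]
        has_moments_power[OF hm(2)]]]
  have k0: "0 < \<kappa> i" "\<kappa> i \<le> 1 / sqrt \<alpha>"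
    using kappa_pos kappa_le I(3) by auto
  have trm: "expectation (\<lambda>\<omega>. P i \<omega> ^ k * (A \<omega> ^ m * B \<omega> ^ n)) = \<mu> k * E m n" for k m n
    unfolding A_def B_def E_def \<mu>_def by (rule expectation_P_chaos[OF I])
  have hP: "has_moments M (P i)" using I(3) by auto
  have "(A \<omega> + P i \<omega> * B \<omega>) ^ 6 =
      (\<Sum>k\<le>6. of_nat (6 choose k) * (P i \<omega> ^ k * (A \<omega> ^ (6 - k) * B \<omega> ^ k)))" for \<omega>
    by (subst add.commute, subst binomial_ring) (simp add: power_mult_distrib mult_ac)
  then have "expectation (\<lambda>\<omega>. (A \<omega> + P i \<omega> * B \<omega>) ^ 6) =
      (\<Sum>k\<le>6. of_nat (6 choose k) * (\<mu> k * E (6 - k) k))"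
    using hm hP
    by (simp add: Bochner_Integration.integral_sum integrable_mult_right has_moments_integrable
        has_moments_mult has_moments_power trm del: sum.atMost_Suc)
  also have "\<dots> = E 6 0 + 15 * E 4 2 + 20 * \<kappa> i * E 3 3 + 15 * (3 + \<kappa> i ^ 2) * E 2 4
      + 6 * (10 * \<kappa> i + \<kappa> i ^ 3) * E 1 5 + (15 + 25 * \<kappa> i ^ 2 + \<kappa> i ^ 4) * E 0 6"
    using P_moments[OF I(3)]
    by (simp add: \<mu>_def eval_nat_numeral prob_space algebra_simps)
  also have "\<dots> \<le> E 6 0 + (75 + 80 * \<kappa> i + 40 * \<kappa> i ^ 2 + 6 * \<kappa> i ^ 3 + \<kappa> i ^ 4) * (E 4 2 + E 0 6)"
  proof -
    have pos: "0 \<le> E 4 2" "0 \<le> E 0 6"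
      unfolding E_def by (auto intro!: integral_nonneg_AE)
    \<comment> \<open>Each comparison required by \<open>le\<close> is obtained by splitting off
      \<open>y\<^sup>2\<close> and bounding the remaining quartic monomial by
      \<open>x ^ 4 + y ^ 4\<close>.\<close>
    have le: "E m n \<le> E 4 2 + E 0 6" if "\<And>x y :: real. x ^ m * y ^ n \<le> x ^ 4 * y ^ 2 + y ^ 6" for m n
    proof -
      have "E m n \<le> expectation (\<lambda>\<omega>. A \<omega> ^ 4 * B \<omega> ^ 2 + A \<omega> ^ 0 * B \<omega> ^ 6)"
        unfolding E_def using that
        by (intro integral_mono Bochner_Integration.integrable_add int) auto
      also have "\<dots> = E 4 2 + E 0 6"
        unfolding E_def by (intro Bochner_Integration.integral_add int)
      finally show ?thesis .
    qed
    have l33: "E 3 3 \<le> E 4 2 + E 0 6"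
    proof (rule le)
      fix x y :: real
      have "x ^ 3 * y \<le> x ^ 4 + y ^ 4"
      proof -
        have "2 * (x^2 * (x * y)) \<le> x^4 + (x * y)^2"
          using sum_squares_bound[of "x^2" "x * y"] by (simp add: mult.assoc power2_eq_square eval_nat_numeral)
        moreover have "2 * (x * y)^2 \<le> x^4 + y^4"
          using sum_squares_bound[of "x^2" "y^2"]
          by (simp add: power_mult_distrib mult.assoc power_mult[symmetric])
        moreover have "x^2 * (x * y) = x^3 * y" by (simp add: eval_nat_numeral)
        ultimately show ?thesis by (smt (verit) zero_le_power2 zero_le_power_eq even_numeral)
      qed
      then have "y^2 * (x ^ 3 * y) \<le> y^2 * (x ^ 4 + y ^ 4)" by (intro mult_left_mono) auto
      then show "x ^ 3 * y ^ 3 \<le> x ^ 4 * y ^ 2 + y ^ 6"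
        by (simp add: eval_nat_numeral algebra_simps)
    qed
    have l24: "E 2 4 \<le> E 4 2 + E 0 6"
    proof (rule le)
      fix x y :: real
      have "2 * (x * y)^2 \<le> x^4 + y^4"
        using sum_squares_bound[of "x^2" "y^2"]
        by (simp add: power_mult_distrib mult.assoc power_mult[symmetric])
      then have "(x * y)^2 \<le> x^4 + y^4" by (smt (verit) zero_le_power2)
      then have "y^2 * (x * y)^2 \<le> y^2 * (x ^ 4 + y ^ 4)" by (intro mult_left_mono) auto
      then show "x ^ 2 * y ^ 4 \<le> x ^ 4 * y ^ 2 + y ^ 6"
        by (simp add: eval_nat_numeral algebra_simps)
    qed
    have l15: "E 1 5 \<le> E 4 2 + E 0 6"
    proof (rule le)
      fix x y :: real
      have "2 * (y^2 * (x * y)) \<le> y^4 + (x * y)^2"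
        using sum_squares_bound[of "y^2" "x * y"] by (simp add: mult.assoc power2_eq_square eval_nat_numeral)
      moreover have "2 * (x * y)^2 \<le> x^4 + y^4"
        using sum_squares_bound[of "x^2" "y^2"]
        by (simp add: power_mult_distrib mult.assoc power_mult[symmetric])
      ultimately have "y^2 * (x * y) \<le> x^4 + y^4"
        by (smt (verit) zero_le_power2 zero_le_power_eq even_numeral)
      then have "y^2 * (y^2 * (x * y)) \<le> y^2 * (x ^ 4 + y ^ 4)" by (intro mult_left_mono) auto
      then show "x ^ 1 * y ^ 5 \<le> x ^ 4 * y ^ 2 + y ^ 6"
        by (simp add: eval_nat_numeral algebra_simps)
    qed
    define W where "W = E 4 2 + E 0 6"
    have "E 6 0 + 15 * E 4 2 + 20 * \<kappa> i * E 3 3 + 15 * (3 + \<kappa> i ^ 2) * E 2 4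
      + 6 * (10 * \<kappa> i + \<kappa> i ^ 3) * E 1 5 + (15 + 25 * \<kappa> i ^ 2 + \<kappa> i ^ 4) * E 0 6
      \<le> E 6 0 + 15 * W + 20 * \<kappa> i * W + 15 * (3 + \<kappa> i ^ 2) * W
      + 6 * (10 * \<kappa> i + \<kappa> i ^ 3) * W + (15 + 25 * \<kappa> i ^ 2 + \<kappa> i ^ 4) * W"
      using k0 l33 l24 l15 pos unfolding W_def
      by (intro add_mono mult_left_mono order_refl) auto
    also have "\<dots> = E 6 0 + (75 + 80 * \<kappa> i + 40 * \<kappa> i ^ 2 + 6 * \<kappa> i ^ 3 + \<kappa> i ^ 4) * W"
      by (simp add: algebra_simps)
    finally show ?thesis unfolding W_def .
  qed
  also have "\<dots> \<le> E 6 0 + K\<^sub>6 * (E 4 2 + E 0 6)"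
    using k0 unfolding K\<^sub>6_def Let_def
    by (intro add_left_mono mult_right_mono add_mono mult_left_mono power_mono)
      (auto simp: E_def intro!: add_nonneg_nonneg integral_nonneg_AE)
  finally show ?thesis by (simp add: E_def)
qed

text \<open>Hypercontractivity, by adding one variable at a time. The weight \<open>K\<^sub>6 ^ card S\<close> lets the induction
  proceed without reference to a degree.\<close>

lemma sixth_moment_chaos:
  assumes "finite I" "I \<subseteq> {1..}"
  shows "expectation (\<lambda>\<omega>. chaos I a \<omega> ^ 6) \<le> (\<Sum>S\<in>Pow I. K\<^sub>6 ^ card S * (a S)\<^sup>2) ^ 3"
  using assms
proof (induction I arbitrary: a rule: finite_induct)
  case empty
  then show ?case by (simp add: chaos_def prob_space power_mult[symmetric])
next
  case (insert i I)
  define b where "b = (\<lambda>S. a (insert i S))"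
  define A where "A = chaos I a"
  define B where "B = chaos I b"
  define s where "s = (\<lambda>a. \<Sum>S\<in>Pow I. K\<^sub>6 ^ card S * (a S)\<^sup>2)"
  have K: "K\<^sub>6 > 0" using K6_ge by simp
  have hm: "has_moments M A" "has_moments M B"
    unfolding A_def B_def by (rule has_moments_chaos, use insert.prems in auto)+
  have IH: "expectation (\<lambda>\<omega>. A \<omega> ^ 6) \<le> s a ^ 3" "expectation (\<lambda>\<omega>. B \<omega> ^ 6) \<le> s b ^ 3"
    using insert unfolding A_def B_def s_def by auto
  have s_nonneg: "s c \<ge> 0" for c
    unfolding s_def using K by (auto intro!: sum_nonneg)
  have s_zero: "chaos I c \<omega> = 0" if "s c = 0" for c \<omega>
  proof -
    have "\<forall>S\<in>Pow I. K\<^sub>6 ^ card S * (c S)\<^sup>2 = 0"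
      using that K insert.hyps unfolding s_def by (subst (asm) sum_nonneg_eq_0_iff) auto
    then show ?thesis using K by (auto simp: chaos_def)
  qed
  \<comment> \<open>This is Hoelder's inequality with exponents 3/2 and 3, combined with the
    induction hypotheses. It is derived from a pointwise Young inequality for the normalized squares
    \<open>u\<close> and \<open>v\<close>, hence the separate treatment of zero scales.\<close>
  have mixed: "expectation (\<lambda>\<omega>. A \<omega> ^ 4 * B \<omega> ^ 2) \<le> (s a)\<^sup>2 * s b"
  proof (cases "s a = 0 \<or> s b = 0")
    case True
    then show ?thesis using s_zero[of a] s_zero[of b] by (auto simp: A_def B_def)
  next
    case False
    then have sp: "s a > 0" "s b > 0" using s_nonneg[of a] s_nonneg[of b] by linarith+
    have "x ^ 4 * y ^ 2 \<le> (s a)\<^sup>2 * s b * (2 / (3 * s a ^ 3)) * x ^ 6 + (s a)\<^sup>2 * s b * (1 / (3 * s b ^ 3)) * y ^ 6"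
      for x y :: real
    proof -
      define u where "u = x^2 / s a"
      define v where "v = y^2 / s b"
      have uv: "u \<ge> 0" "v \<ge> 0" using sp by (auto simp: u_def v_def)
      \<comment> \<open>The factorized form of Young's inequality
        \<open>3 * u^2 * v \<le> 2 * u^3 + v^3\<close>.\<close>
      have "0 \<le> (u - v)^2 * (2 * u + v)" using uv by simp
      also have "\<dots> = 2 * u^3 + v^3 - 3 * u^2 * v"
        by (simp add: eval_nat_numeral algebra_simps)
      finally have "u^2 * v \<le> (2 * u^3 + v^3) / 3" by simp
      then have "((s a)^2 * s b) * (u^2 * v) \<le> ((s a)^2 * s b) * ((2 * u^3 + v^3) / 3)"
        using sp by (intro mult_left_mono) auto
      moreover have "((s a)^2 * s b) * (u^2 * v) = x ^ 4 * y ^ 2"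
        using sp by (simp add: u_def v_def field_simps power_mult[symmetric])
      moreover have "u^3 = x^6 / s a ^ 3" "v^3 = y^6 / s b ^ 3"
        by (simp_all add: u_def v_def power_divide power_mult[symmetric])
      ultimately show ?thesis
        by (simp add: add_divide_distrib distrib_left mult.assoc)
    qed
    then have "expectation (\<lambda>\<omega>. A \<omega> ^ 4 * B \<omega> ^ 2) \<le>
      expectation (\<lambda>\<omega>. (s a)\<^sup>2 * s b * (2 / (3 * s a ^ 3)) * A \<omega> ^ 6 + (s a)\<^sup>2 * s b * (1 / (3 * s b ^ 3)) * B \<omega> ^ 6)"
      using hm by (intro integral_mono has_moments_integrable has_moments_mult has_moments_power
          has_moments_add has_moments_const) auto
    also have "\<dots> = (s a)\<^sup>2 * s b * (2 / (3 * s a ^ 3)) * expectation (\<lambda>\<omega>. A \<omega> ^ 6)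
        + (s a)\<^sup>2 * s b * (1 / (3 * s b ^ 3)) * expectation (\<lambda>\<omega>. B \<omega> ^ 6)"
      using hm
      by (subst Bochner_Integration.integral_add)
        (auto intro!: integrable_mult_right has_moments_integrable_power)
    also have "\<dots> \<le> (s a)\<^sup>2 * s b * (2 / (3 * s a ^ 3)) * s a ^ 3 + (s a)\<^sup>2 * s b * (1 / (3 * s b ^ 3)) * s b ^ 3"
      using sp IH by (intro add_mono mult_left_mono) auto
    also have "\<dots> = (s a)\<^sup>2 * s b" using sp by (simp add: field_simps)
    finally show ?thesis .
  qed
  have "expectation (\<lambda>\<omega>. chaos (insert i I) a \<omega> ^ 6) =
      expectation (\<lambda>\<omega>. (A \<omega> + P i \<omega> * B \<omega>) ^ 6)"
    using insert.hyps by (simp add: chaos_insert A_def B_def b_def)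
  also have "\<dots> \<le> expectation (\<lambda>\<omega>. A \<omega> ^ 6) +
    K\<^sub>6 * (expectation (\<lambda>\<omega>. A \<omega> ^ 4 * B \<omega> ^ 2) + expectation (\<lambda>\<omega>. B \<omega> ^ 6))"
    unfolding A_def B_def by (rule sixth_moment_step) (use insert in auto)
  also have "\<dots> \<le> s a ^ 3 + K\<^sub>6 * ((s a)\<^sup>2 * s b + s b ^ 3)"
    using IH mixed K by (intro add_mono mult_left_mono) auto
  \<comment> \<open>The cube contains three copies of the mixed term and
    \<open>K\<^sub>6 ^ 3 * s b ^ 3\<close>; the latter absorbs \<open>K\<^sub>6 * s b ^ 3\<close>
    since \<open>K\<^sub>6 \<ge> 1\<close>.\<close>
  also have "\<dots> \<le> (s a + K\<^sub>6 * s b) ^ 3"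
  proof -
    have "K\<^sub>6 * 1 \<le> K\<^sub>6 * K\<^sub>6 ^ 2" using K6_ge by (intro mult_left_mono one_le_power) auto
    then have "K\<^sub>6 * s b ^ 3 \<le> K\<^sub>6 ^ 3 * s b ^ 3"
      using s_nonneg by (intro mult_right_mono) (auto simp: eval_nat_numeral)
    moreover have "0 \<le> K\<^sub>6 * ((s a)\<^sup>2 * s b)" "0 \<le> K\<^sub>6 ^ 2 * (s a * s b ^ 2)"
      using s_nonneg K by auto
    ultimately show ?thesis
      by (simp add: eval_nat_numeral algebra_simps)
  qed
  also have "s a + K\<^sub>6 * s b = (\<Sum>S\<in>Pow (insert i I). K\<^sub>6 ^ card S * (a S)\<^sup>2)"
  proof -
    have inj: "inj_on (insert i) (Pow I)"
      using insert.hyps by (auto simp: inj_on_def)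
    have c: "card (insert i S) = Suc (card S)" if "S \<in> Pow I" for S
      using that insert.hyps finite_subset[of S I] by (subst card_insert_disjoint) auto
    have "(\<Sum>S\<in>insert i ` Pow I. K\<^sub>6 ^ card S * (a S)\<^sup>2) = K\<^sub>6 * s b"
      unfolding s_def b_def sum_distrib_left sum.reindex[OF inj] comp_def
      by (intro sum.cong) (auto simp: c)
    then show ?thesis
      unfolding Pow_insert using insert.hyps
      by (subst sum.union_disjoint) (auto simp: s_def)
  qed
  finally show ?case .
qed

end

section \<open>Contractions and the fourth moment\<close>

text \<open>The exponent of the variable at site \<open>k\<close> in the product of the monomials of
  \<open>S\<close> and \<open>T\<close>.\<close>

definition pair_count :: "'i set \<Rightarrow> 'i set \<Rightarrow> 'i \<Rightarrow> nat" where
  "pair_count S T k = of_bool (k \<in> S) + of_bool (k \<in> T)"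

text \<open>For exponents up to 2 this is the inner product of the monic orthogonal polynomials of
  degrees \<open>m\<close> and \<open>n\<close>, in the Gaussian as in the Poisson case:
  \<open>m!\<close> on the diagonal.\<close>

definition wick_weight :: "nat \<Rightarrow> nat \<Rightarrow> real" where
  "wick_weight m n = (if m = n then if m = 2 then 2 else 1 else 0)"

text \<open>The contraction of \<open>a\<close> with itself over the variables \<open>y\<close>; for \<open>a\<close> supported on sets of size \<open>q\<close> it
  corresponds to \<open>r = l = q - card x\<close>.\<close>

definition set_contr :: "'i set \<Rightarrow> ('i set \<Rightarrow> real) \<Rightarrow> 'i set \<Rightarrow> 'i set \<Rightarrow> real" where
  "set_contr I a x x' = (\<Sum>y\<in>Pow I. if y \<inter> (x \<union> x') = {} then a (x \<union> y) * a (x' \<union> y) else 0)"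

lemma sum_Pow_insert:
  fixes h :: "'i set \<Rightarrow> 'a::comm_monoid_add"
  assumes "finite I" "i \<notin> I"
  shows "(\<Sum>S\<in>Pow (insert i I). h S) = (\<Sum>S\<in>Pow I. h S + h (insert i S))"
proof -
  have inj: "inj_on (insert i) (Pow I)" using assms(2) by (auto simp: inj_on_def)
  show ?thesis
    unfolding Pow_insert using assms
    by (subst sum.union_disjoint) (auto simp: sum.reindex[OF inj] sum.distrib)
qed

text \<open>Both sides sum over the choice, for each site of \<open>I\<close>, of its membership pattern in the four sets; the
  weight 2 on the left accounts for the two patterns \<open>x \<inter> x'\<close> and \<open>y \<inter> y'\<close> on the right.\<close>

lemma wick_sum_regroup:
  fixes \<Phi> :: "'i set \<Rightarrow> 'i set \<Rightarrow> 'i set \<Rightarrow> 'i set \<Rightarrow> real"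
  assumes "finite I"
  shows "(\<Sum>S\<in>Pow I. \<Sum>T\<in>Pow I. \<Sum>S'\<in>Pow I. \<Sum>T'\<in>Pow I.
      (\<Prod>k\<in>I. wick_weight (pair_count S T k) (pair_count S' T' k)) * \<Phi> S T S' T') =
    (\<Sum>x\<in>Pow I. \<Sum>x'\<in>Pow I. \<Sum>y\<in>Pow I. \<Sum>y'\<in>Pow I.
      (\<Prod>k\<in>I. if pair_count x x' k = 0 \<or> pair_count y y' k = 0 then 1 else 0) *
      \<Phi> (x \<union> y) (x' \<union> y') (x \<union> y') (x' \<union> y))"
  using assms
proof (induction I arbitrary: \<Phi> rule: finite_induct)
  case empty
  then show ?case by simp
next
  case (insert i I)
  \<comment> \<open>\<open>\<Psi>\<close> sums over the admissible patterns of the new site. In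
    terms of the right side these are: no set; then \<open>x\<close>, \<open>y\<close>,
    \<open>y'\<close>, \<open>x'\<close> alone, in the order of the four single terms; and finally
    \<open>x\<close> with \<open>x'\<close>, or \<open>y\<close> with \<open>y'\<close>, both of
    which put the site into all four arguments.\<close>
  define \<Psi> where "\<Psi> = (\<lambda>S T S' T'. \<Phi> S T S' T'
    + \<Phi> (insert i S) T (insert i S') T' + \<Phi> (insert i S) T S' (insert i T')
    + \<Phi> S (insert i T) (insert i S') T' + \<Phi> S (insert i T) S' (insert i T')
    + 2 * \<Phi> (insert i S) (insert i T) (insert i S') (insert i T'))"
  have c: "pair_count (insert i A) B k = pair_count A B k" "pair_count A (insert i B) k = pair_count A B k"
    if "k \<in> I" for A B k
    using that insert.hyps by (auto simp: pair_count_def)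
  have ci: "pair_count A B i = 0" "pair_count (insert i A) B i = 1" "pair_count A (insert i B) i = 1"
    "pair_count (insert i A) (insert i B) i = 2" if "A \<in> Pow I" "B \<in> Pow I" for A B
    using that insert.hyps by (auto simp: pair_count_def)
  note pi = prod.insert[OF insert.hyps]
  have w: "wick_weight 0 0 = 1" "wick_weight (Suc 0) (Suc 0) = 1" "wick_weight 2 2 = 2" "wick_weight 0 (Suc 0) = 0" "wick_weight 0 2 = 0"
    "wick_weight (Suc 0) 0 = 0" "wick_weight (Suc 0) 2 = 0" "wick_weight 2 0 = 0" "wick_weight 2 (Suc 0) = 0"
    by (auto simp: wick_weight_def)
  have "(\<Sum>S\<in>Pow (insert i I). \<Sum>T\<in>Pow (insert i I). \<Sum>S'\<in>Pow (insert i I). \<Sum>T'\<in>Pow (insert i I).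
      (\<Prod>k\<in>insert i I. wick_weight (pair_count S T k) (pair_count S' T' k)) * \<Phi> S T S' T') =
    (\<Sum>S\<in>Pow I. \<Sum>T\<in>Pow I. \<Sum>S'\<in>Pow I. \<Sum>T'\<in>Pow I.
      (\<Prod>k\<in>I. wick_weight (pair_count S T k) (pair_count S' T' k)) * \<Psi> S T S' T')"
    unfolding sum_Pow_insert[OF insert.hyps] sum.distrib[symmetric]
    by (intro sum.cong refl)
      (simp add: pi ci w c \<Psi>_def algebra_simps del: Pow_iff cong: prod.cong)
  also have "\<dots> = (\<Sum>x\<in>Pow I. \<Sum>x'\<in>Pow I. \<Sum>y\<in>Pow I. \<Sum>y'\<in>Pow I.
      (\<Prod>k\<in>I. if pair_count x x' k = 0 \<or> pair_count y y' k = 0 then 1 else 0) *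
      \<Psi> (x \<union> y) (x' \<union> y') (x \<union> y') (x' \<union> y))"
    by (rule insert.IH)
  also have "\<dots> = (\<Sum>x\<in>Pow (insert i I). \<Sum>x'\<in>Pow (insert i I).
      \<Sum>y\<in>Pow (insert i I). \<Sum>y'\<in>Pow (insert i I).
      (\<Prod>k\<in>insert i I. if pair_count x x' k = 0 \<or> pair_count y y' k = 0 then 1 else 0) *
      \<Phi> (x \<union> y) (x' \<union> y') (x \<union> y') (x' \<union> y))"
    unfolding sum_Pow_insert[OF insert.hyps] sum.distrib[symmetric]
    by (intro sum.cong refl)
      (simp add: pi ci c \<Psi>_def algebra_simps del: Pow_iff cong: prod.cong)
  finally show ?case .
qed

text \<open>For fixed \<open>x\<close> and \<open>x'\<close>, admissible \<open>y\<close> and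
  \<open>y'\<close> range independently over the sets disjoint from both. The product of the four
  coefficients separates into a factor with \<open>y\<close> and the same factor with
  \<open>y'\<close>, so the inner double sum is a square.\<close>

lemma wick_sum_contr:
  assumes "finite I"
  shows "(\<Sum>S\<in>Pow I. \<Sum>T\<in>Pow I. \<Sum>S'\<in>Pow I. \<Sum>T'\<in>Pow I.
      (\<Prod>k\<in>I. wick_weight (pair_count S T k) (pair_count S' T' k)) * (a S * a T * (a S' * a T'))) =
    (\<Sum>x\<in>Pow I. \<Sum>x'\<in>Pow I. (set_contr I a x x')\<^sup>2)"
proof -
  have ind: "(\<Prod>k\<in>I. if pair_count x x' k = 0 \<or> pair_count y y' k = 0 then 1 else 0) =
      (if y \<inter> (x \<union> x') = {} then 1 else 0) * (if y' \<inter> (x \<union> x') = {} then 1 else (0::real))"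
    if "x \<in> Pow I" "x' \<in> Pow I" "y \<in> Pow I" "y' \<in> Pow I" for x x' y y'
  proof (cases "y \<inter> (x \<union> x') = {} \<and> y' \<inter> (x \<union> x') = {}")
    case True
    then have "(\<Prod>k\<in>I. if pair_count x x' k = 0 \<or> pair_count y y' k = 0 then 1 else (0::real)) = 1"
      by (intro prod.neutral) (auto simp: pair_count_def)
    with True show ?thesis by simp
  next
    case False
    then obtain k where "k \<in> x \<union> x'" "k \<in> y \<union> y'" by auto
    with that have "k \<in> I" "\<not> (pair_count x x' k = 0 \<or> pair_count y y' k = 0)" by (auto simp: pair_count_def)
    then have "(\<Prod>k\<in>I. if pair_count x x' k = 0 \<or> pair_count y y' k = 0 then 1 else (0::real)) = 0"
      using assms by (intro prod_zero) auto
    with False show ?thesis by auto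
  qed
  show ?thesis
    unfolding wick_sum_regroup[OF assms, of "\<lambda>S T S' T'. a S * a T * (a S' * a T')"]
      set_contr_def power2_eq_square sum_product
    by (intro sum.cong refl, subst ind) auto
qed

section \<open>Products of two chaoses and the Charlier basis\<close>

context normalized_poisson
begin

text \<open>A product of two multilinear polynomials has exponents up to 2 at each site. The family
  \<open>u\<close> of one-site functions is a parameter because such products are studied in three
  bases: monomials, Charlier polynomials and centred squares.\<close>

definition bichaos ::
  "nat set \<Rightarrow> (nat set \<Rightarrow> nat set \<Rightarrow> real) \<Rightarrow> (nat \<Rightarrow> nat \<Rightarrow> real \<Rightarrow> real) \<Rightarrow> 'w \<Rightarrow> real" where
  "bichaos I c u \<omega> = (\<Sum>S\<in>Pow I. \<Sum>T\<in>Pow I. c S T * (\<Prod>k\<in>I. u k (pair_count S T k) (P k \<omega>)))"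

lemma has_moments_bichaos:
  assumes "\<And>k m. k \<in> I \<Longrightarrow> has_moments M (\<lambda>\<omega>. u k m (P k \<omega>))"
  shows "has_moments M (bichaos I c u)"
  unfolding bichaos_def
  by (intro has_moments_sum has_moments_mult has_moments_const has_moments_prod assms)

lemma expectation_bichaos_mult:
  assumes I: "finite I" "I \<subseteq> {1..}"
    and u: "\<And>k m. u k m \<in> borel_measurable borel" "\<And>k m. k \<in> I \<Longrightarrow> has_moments M (\<lambda>\<omega>. u k m (P k \<omega>))"
    and v: "\<And>k m. v k m \<in> borel_measurable borel" "\<And>k m. k \<in> I \<Longrightarrow> has_moments M (\<lambda>\<omega>. v k m (P k \<omega>))"
  shows "expectation (\<lambda>\<omega>. bichaos I c u \<omega> * bichaos I d v \<omega>) =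
    (\<Sum>S\<in>Pow I. \<Sum>T\<in>Pow I. \<Sum>S'\<in>Pow I. \<Sum>T'\<in>Pow I.
      (\<Prod>k\<in>I. expectation (\<lambda>\<omega>. u k (pair_count S T k) (P k \<omega>) * v k (pair_count S' T' k) (P k \<omega>))) *
      (c S T * d S' T'))"
proof -
  have *: "bichaos I c u \<omega> * bichaos I d v \<omega> =
    (\<Sum>S\<in>Pow I. \<Sum>T\<in>Pow I. \<Sum>S'\<in>Pow I. \<Sum>T'\<in>Pow I. (c S T * d S' T') *
      (\<Prod>k\<in>I. u k (pair_count S T k) (P k \<omega>) * v k (pair_count S' T' k) (P k \<omega>)))" for \<omega>
    unfolding bichaos_def sum_distrib_right
    unfolding sum_distrib_left prod.distrib
    by (intro sum.cong refl) (simp only: mult_ac)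
  have int: "integrable M (\<lambda>\<omega>. \<Prod>k\<in>I. u k (pair_count S T k) (P k \<omega>) * v k (pair_count S' T' k) (P k \<omega>))"
    for S T S' T'
    by (intro has_moments_integrable has_moments_prod has_moments_mult u v)
  have E: "expectation (\<lambda>\<omega>. \<Prod>k\<in>I. u k (pair_count S T k) (P k \<omega>) * v k (pair_count S' T' k) (P k \<omega>)) =
      (\<Prod>k\<in>I. expectation (\<lambda>\<omega>. u k (pair_count S T k) (P k \<omega>) * v k (pair_count S' T' k) (P k \<omega>)))"
    for S T S' T'
    by (rule expectation_prod_P[OF I, of "\<lambda>k x. u k (pair_count S T k) x * v k (pair_count S' T' k) x"])
      (auto intro!: borel_measurable_times u(1) v(1) has_moments_integrable has_moments_mult u(2) v(2))
  show ?thesis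
    unfolding * by (simp add: Bochner_Integration.integral_sum int E mult.commute)
qed

definition power_basis :: "nat \<Rightarrow> nat \<Rightarrow> real \<Rightarrow> real" where "power_basis k m x = x ^ m"

text \<open>The monic orthogonal polynomials of the law of \<open>P k\<close> up to degree 2; the
  linear term in degree 2 compensates the third moment \<open>\<kappa> k\<close>.\<close>

definition charlier :: "nat \<Rightarrow> nat \<Rightarrow> real \<Rightarrow> real" where
  "charlier k m x = (if m = 0 then 1 else if m = 1 then x else x ^ 2 - \<kappa> k * x - 1)"

lemma power_basis_props:
  "power_basis k m \<in> borel_measurable borel" "k \<ge> 1 \<Longrightarrow> has_moments M (\<lambda>\<omega>. power_basis k m (P k \<omega>))"
  unfolding power_basis_def by (simp, intro has_moments_power has_moments_P)

lemma charlier_props: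
  "charlier k m \<in> borel_measurable borel" "k \<ge> 1 \<Longrightarrow> has_moments M (\<lambda>\<omega>. charlier k m (P k \<omega>))"
proof -
  show "charlier k m \<in> borel_measurable borel" unfolding charlier_def by simp
  assume "k \<ge> 1"
  then have "has_moments M (\<lambda>\<omega>. P k \<omega> ^ 2 - \<kappa> k * P k \<omega> - 1)"
    by (intro has_moments_diff has_moments_mult has_moments_power has_moments_P has_moments_const)
  with \<open>k \<ge> 1\<close> show "has_moments M (\<lambda>\<omega>. charlier k m (P k \<omega>))"
    using has_moments_P[of k] by (cases "m = 0"; cases "m = 1") (auto simp: charlier_def)
qed

lemma expectation_poly4:
  assumes "k \<ge> 1" and f: "\<And>x. f x = c0 + c1 * x + c2 * x ^ 2 + c3 * x ^ 3 + c4 * x ^ 4"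
  shows "expectation (\<lambda>\<omega>. f (P k \<omega>)) = c0 + c2 + c3 * \<kappa> k + c4 * (3 + \<kappa> k ^ 2)"
proof -
  have i: "integrable M (\<lambda>\<omega>. P k \<omega> ^ m)" "integrable M (P k)" for m
    using has_moments_P[OF assms(1)] by (auto intro: has_moments_integrable_power has_moments_integrable)
  show ?thesis
    unfolding f using P_moments[OF assms(1)] by (simp add: i prob_space)
qed

lemma charlier_orth:
  assumes k: "k \<ge> 1" and "m \<le> 2" "n \<le> 2"
  shows "expectation (\<lambda>\<omega>. charlier k m (P k \<omega>) * charlier k n (P k \<omega>)) = wick_weight m n"
proof -
  let ?c = "charlier k"
  let ?E = "\<lambda>m n. expectation (\<lambda>\<omega>. ?c m (P k \<omega>) * ?c n (P k \<omega>))"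
  note c = charlier_def power2_eq_square power3_eq_cube power4_eq_xxxx
  have "?E 0 0 = 1"
    using expectation_poly4[OF k, of "\<lambda>x. ?c 0 x * ?c 0 x" 1 0 0 0 0] by (simp add: c)
  moreover have "?E 0 1 = 0"
    using expectation_poly4[OF k, of "\<lambda>x. ?c 0 x * ?c 1 x" 0 1 0 0 0] by (simp add: c)
  moreover have "?E 0 2 = 0"
    using expectation_poly4[OF k, of "\<lambda>x. ?c 0 x * ?c 2 x" "-1" "- \<kappa> k" 1 0 0]
    by (simp add: c)
  moreover have "?E 1 1 = 1"
    using expectation_poly4[OF k, of "\<lambda>x. ?c 1 x * ?c 1 x" 0 0 1 0 0] by (simp add: c)
  moreover have "?E 1 2 = 0"
    using expectation_poly4[OF k, of "\<lambda>x. ?c 1 x * ?c 2 x" 0 "-1" "- \<kappa> k" 1 0]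
    by (simp add: c algebra_simps)
  moreover have "?E 2 2 = 2"
    using expectation_poly4[OF k, of "\<lambda>x. ?c 2 x * ?c 2 x" 1 "2 * \<kappa> k" "\<kappa> k ^ 2 - 2" "- 2 * \<kappa> k" 1]
    by (simp add: c algebra_simps)
  moreover have "?E m n = ?E n m" for m n by (simp add: mult.commute)
  moreover have "m = 0 \<or> m = 1 \<or> m = 2" "n = 0 \<or> n = 1 \<or> n = 2" using assms by auto
  ultimately show ?thesis by (elim disjE) (simp_all add: wick_weight_def)
qed

text \<open>The monomial of degree \<open>m\<close> differs from the Charlier polynomial of the same
  degree by lower-order terms, which are orthogonal to degree \<open>n\<close> as long as
  \<open>m \<le> n\<close>.\<close>

lemma power_basis_charlier:
  assumes k: "k \<ge> 1" and "m \<le> 2" "n \<le> 2" "m \<le> n"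
  shows "expectation (\<lambda>\<omega>. power_basis k m (P k \<omega>) * charlier k n (P k \<omega>)) = wick_weight m n"
proof (cases "m = 2")
  case True
  then have "n = 2" using assms by auto
  have "expectation (\<lambda>\<omega>. power_basis k 2 (P k \<omega>) * charlier k 2 (P k \<omega>)) = 2"
    using expectation_poly4[OF k, of "\<lambda>x. power_basis k 2 x * charlier k 2 x" 0 0 "- 1" "- \<kappa> k" 1]
    by (simp add: charlier_def power_basis_def power2_eq_square power3_eq_cube power4_eq_xxxx algebra_simps)
  then show ?thesis using \<open>m = 2\<close> \<open>n = 2\<close> by (simp add: wick_weight_def)
next
  case False
  then have "m = 0 \<or> m = 1" using assms by auto
  then have "power_basis k m = charlier k m" by (auto simp: power_basis_def charlier_def)
  then show ?thesis using charlier_orth[OF assms(1-3)] by simp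
qed

end

lemma pair_count_le: "pair_count S T k \<le> 2" by (simp add: pair_count_def)

lemma sum_pair_count:
  assumes "finite I" "S \<subseteq> I" "T \<subseteq> I"
  shows "(\<Sum>k\<in>I. pair_count S T k) = card S + card T"
  using assms by (simp add: pair_count_def sum.distrib of_bool_def sum.If_cases Int_absorb1)

context normalized_poisson
begin

lemma prod_P_pair_count:
  assumes "finite I" "S \<subseteq> I" "T \<subseteq> I"
  shows "(\<Prod>k\<in>S. P k \<omega>) * (\<Prod>k\<in>T. P k \<omega>) = (\<Prod>k\<in>I. power_basis k (pair_count S T k) (P k \<omega>))"
proof -
  have *: "(\<Prod>k\<in>S. P k \<omega>) = (\<Prod>k\<in>I. P k \<omega> ^ of_bool (k \<in> S))" if "S \<subseteq> I" for S
    using that assms(1) by (intro prod.mono_neutral_cong_left) auto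
  show ?thesis
    unfolding *[OF assms(2)] *[OF assms(3)] power_basis_def pair_count_def power_add prod.distrib ..
qed

lemma chaos_sq_eq:
  assumes "finite I"
  shows "(chaos I a \<omega>)\<^sup>2 = bichaos I (\<lambda>S T. a S * a T) power_basis \<omega>"
  unfolding power2_eq_square chaos_def bichaos_def sum_product
  by (intro sum.cong refl) (use assms in \<open>simp add: prod_P_pair_count[symmetric] mult_ac\<close>)

lemma expectation_bichaos:
  assumes I: "finite I" "I \<subseteq> {1..}"
    and u: "\<And>k m. u k m \<in> borel_measurable borel" "\<And>k m. k \<in> I \<Longrightarrow> has_moments M (\<lambda>\<omega>. u k m (P k \<omega>))"
  shows "expectation (bichaos I c u) =
    (\<Sum>S\<in>Pow I. \<Sum>T\<in>Pow I. (\<Prod>k\<in>I. expectation (\<lambda>\<omega>. u k (pair_count S T k) (P k \<omega>))) * c S T)"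
proof -
  have int: "integrable M (\<lambda>\<omega>. \<Prod>k\<in>I. u k (pair_count S T k) (P k \<omega>))" for S T
    by (intro has_moments_integrable has_moments_prod u)
  have E: "expectation (\<lambda>\<omega>. \<Prod>k\<in>I. u k (pair_count S T k) (P k \<omega>)) =
      (\<Prod>k\<in>I. expectation (\<lambda>\<omega>. u k (pair_count S T k) (P k \<omega>)))" for S T
    by (rule expectation_prod_P[OF I, of "\<lambda>k x. u k (pair_count S T k) x"])
      (auto intro!: u(1) has_moments_integrable u(2))
  show ?thesis
    unfolding bichaos_def by (simp add: Bochner_Integration.integral_sum int E mult.commute)
qed

lemma expectation_power_basis:
  assumes "k \<ge> 1"
  shows "expectation (\<lambda>\<omega>. power_basis k 0 (P k \<omega>)) = 1" "expectation (\<lambda>\<omega>. power_basis k 1 (P k \<omega>)) = 0"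
    "expectation (\<lambda>\<omega>. power_basis k 2 (P k \<omega>)) = 1"
  using P_moments[OF assms] by (simp_all add: power_basis_def prob_space)

text \<open>The monomials are orthonormal: a site in exactly one of \<open>S\<close> and
  \<open>T\<close> contributes the mean 0 of \<open>P k\<close>, and all other sites contribute
  1.\<close>

lemma expectation_chaos_sq:
  assumes I: "finite I" "I \<subseteq> {1..}"
  shows "expectation (\<lambda>\<omega>. (chaos I a \<omega>)\<^sup>2) = (\<Sum>S\<in>Pow I. (a S)\<^sup>2)"
proof -
  have k1: "k \<ge> 1" if "k \<in> I" for k using that I by auto
  have "expectation (\<lambda>\<omega>. (chaos I a \<omega>)\<^sup>2) =
    (\<Sum>S\<in>Pow I. \<Sum>T\<in>Pow I. (\<Prod>k\<in>I. expectation (\<lambda>\<omega>. power_basis k (pair_count S T k) (P k \<omega>))) * (a S * a T))"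
    unfolding chaos_sq_eq[OF I(1)] by (rule expectation_bichaos[OF I power_basis_props(1) power_basis_props(2)[OF k1]])
  also have "\<dots> = (\<Sum>S\<in>Pow I. \<Sum>T\<in>Pow I. if T = S then a S * a T else 0)"
  proof (intro sum.cong refl)
    fix S T assume ST: "S \<in> Pow I" "T \<in> Pow I"
    show "(\<Prod>k\<in>I. expectation (\<lambda>\<omega>. power_basis k (pair_count S T k) (P k \<omega>))) * (a S * a T) =
        (if T = S then a S * a T else 0)"
    proof (cases "T = S")
      case True
      have "(\<Prod>k\<in>I. expectation (\<lambda>\<omega>. power_basis k (pair_count S T k) (P k \<omega>))) = 1"
      proof (intro prod.neutral ballI)
        fix k assume "k \<in> I"
        have "pair_count S T k = 0 \<or> pair_count S T k = 2" using True by (simp add: pair_count_def)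
        then show "expectation (\<lambda>\<omega>. power_basis k (pair_count S T k) (P k \<omega>)) = 1"
          using expectation_power_basis[OF k1[OF \<open>k \<in> I\<close>]] by auto
      qed
      with True show ?thesis by simp
    next
      case False
      then obtain k where "k \<in> I" "(k \<in> S) \<noteq> (k \<in> T)" using ST by blast
      moreover from this have "pair_count S T k = 1" by (auto simp: pair_count_def)
      ultimately have "expectation (\<lambda>\<omega>. power_basis k (pair_count S T k) (P k \<omega>)) = 0"
        using expectation_power_basis(2)[OF k1] by simp
      then have "(\<Prod>k\<in>I. expectation (\<lambda>\<omega>. power_basis k (pair_count S T k) (P k \<omega>))) = 0"
        using I(1) \<open>k \<in> I\<close> by (intro prod_zero) auto
      with False show ?thesis by simp
    qed
  qed
  also have "\<dots> = (\<Sum>S\<in>Pow I. (a S)\<^sup>2)"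
    using I(1) by (simp add: sum.delta power2_eq_square)
  finally show ?thesis .
qed

text \<open>Here \<open>T\<close> is the projection of \<open>F\<^sup>2\<close> to the chaos of order \<open>2 * q\<close>. A site contributes to
  \<open>E (F\<^sup>2 * T)\<close> only if its multiplicity on the left is at least that on the right, and since all
  multiplicities add up to \<open>2 * q\<close>, they must agree.\<close>

lemma fourth_moment_ge:
  assumes I: "finite I" "I \<subseteq> {1..}" and a: "\<And>S. card S \<noteq> q \<Longrightarrow> a S = 0" and q: "q \<ge> 1"
  shows "(\<Sum>S\<in>Pow I. (a S)\<^sup>2)\<^sup>2 + (\<Sum>x\<in>Pow I. \<Sum>x'\<in>Pow I. (set_contr I a x x')\<^sup>2)
    \<le> expectation (\<lambda>\<omega>. chaos I a \<omega> ^ 4)"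
proof -
  define F where "F = chaos I a"
  define T where "T = bichaos I (\<lambda>S T. a S * a T) charlier"
  define v where "v = (\<Sum>S\<in>Pow I. (a S)\<^sup>2)"
  define d where "d = (\<Sum>x\<in>Pow I. \<Sum>x'\<in>Pow I. (set_contr I a x x')\<^sup>2)"
  have k1: "k \<ge> 1" if "k \<in> I" for k using that I by auto
  have F2: "(F \<omega>)\<^sup>2 = bichaos I (\<lambda>S T. a S * a T) power_basis \<omega>" for \<omega>
    unfolding F_def by (rule chaos_sq_eq[OF I(1)])
  have TT: "expectation (\<lambda>\<omega>. T \<omega> * T \<omega>) = d"
  proof -
    have "expectation (\<lambda>\<omega>. T \<omega> * T \<omega>) = (\<Sum>S\<in>Pow I. \<Sum>T\<in>Pow I. \<Sum>S'\<in>Pow I. \<Sum>T'\<in>Pow I.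
      (\<Prod>k\<in>I. expectation (\<lambda>\<omega>. charlier k (pair_count S T k) (P k \<omega>) * charlier k (pair_count S' T' k) (P k \<omega>))) *
      (a S * a T * (a S' * a T')))"
      unfolding T_def by (rule expectation_bichaos_mult[OF I charlier_props(1) charlier_props(2)[OF k1]
            charlier_props(1) charlier_props(2)[OF k1]])
    also have "\<dots> = (\<Sum>S\<in>Pow I. \<Sum>T\<in>Pow I. \<Sum>S'\<in>Pow I. \<Sum>T'\<in>Pow I.
      (\<Prod>k\<in>I. wick_weight (pair_count S T k) (pair_count S' T' k)) * (a S * a T * (a S' * a T')))"
      by (intro sum.cong refl arg_cong2[where f="(*)"] prod.cong charlier_orth k1 pair_count_le)
    finally show ?thesis unfolding wick_sum_contr[OF I(1)] d_def .
  qed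
  have FT: "expectation (\<lambda>\<omega>. (F \<omega>)\<^sup>2 * T \<omega>) = d"
  proof -
    have "expectation (\<lambda>\<omega>. (F \<omega>)\<^sup>2 * T \<omega>) = (\<Sum>S\<in>Pow I. \<Sum>T\<in>Pow I. \<Sum>S'\<in>Pow I. \<Sum>T'\<in>Pow I.
      (\<Prod>k\<in>I. expectation (\<lambda>\<omega>. power_basis k (pair_count S T k) (P k \<omega>) * charlier k (pair_count S' T' k) (P k \<omega>))) *
      (a S * a T * (a S' * a T')))"
      unfolding T_def F2 by (rule expectation_bichaos_mult[OF I power_basis_props(1) power_basis_props(2)[OF k1]
            charlier_props(1) charlier_props(2)[OF k1]])
    also have "\<dots> = (\<Sum>S\<in>Pow I. \<Sum>T\<in>Pow I. \<Sum>S'\<in>Pow I. \<Sum>T'\<in>Pow I.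
      (\<Prod>k\<in>I. wick_weight (pair_count S T k) (pair_count S' T' k)) * (a S * a T * (a S' * a T')))"
    proof (intro sum.cong refl)
      fix S T S' T' assume sub: "S \<in> Pow I" "T \<in> Pow I" "S' \<in> Pow I" "T' \<in> Pow I"
      let ?e = "\<lambda>k. expectation (\<lambda>\<omega>. power_basis k (pair_count S T k) (P k \<omega>) * charlier k (pair_count S' T' k) (P k \<omega>))"
      let ?w = "\<lambda>k. wick_weight (pair_count S T k) (pair_count S' T' k)"
      show "(\<Prod>k\<in>I. ?e k) * (a S * a T * (a S' * a T')) = (\<Prod>k\<in>I. ?w k) * (a S * a T * (a S' * a T'))"
      proof (cases "card S = q \<and> card T = q \<and> card S' = q \<and> card T' = q")
        case False
        then show ?thesis using a by fastforce
      next
        case True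
        then have eq: "(\<Sum>k\<in>I. pair_count S T k) = (\<Sum>k\<in>I. pair_count S' T' k)"
          using sub I(1) by (simp add: sum_pair_count)
        show ?thesis
        proof (cases "\<exists>k\<in>I. pair_count S T k < pair_count S' T' k")
          case True
          then obtain k where k: "k \<in> I" "pair_count S T k < pair_count S' T' k" by auto
          then have "?w k = 0" "?e k = 0"
            using power_basis_charlier[OF k1[OF k(1)] pair_count_le[of S T] pair_count_le[of S' T']] by (auto simp: wick_weight_def)
          then have "prod ?w I = 0" "prod ?e I = 0" using I(1) k(1) by (auto intro!: prod_zero)
          then show ?thesis by simp
        next
          case False
          then have le: "\<And>k. k \<in> I \<Longrightarrow> pair_count S' T' k \<le> pair_count S T k" by (auto simp: not_less)
          have "pair_count S T k = pair_count S' T' k" if "k \<in> I" for k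
            using sum_mono_inv[OF eq[symmetric] le that I(1)] by simp
          then have "?e k = ?w k" if "k \<in> I" for k
            using power_basis_charlier[OF k1[OF that] pair_count_le[of S' T' k] pair_count_le[of S' T' k]] that by simp
          then show ?thesis by simp
        qed
      qed
    qed
    finally show ?thesis unfolding wick_sum_contr[OF I(1)] d_def .
  qed
  have T0: "expectation T = 0"
  proof -
    have "expectation T = (\<Sum>S\<in>Pow I. \<Sum>T\<in>Pow I.
        (\<Prod>k\<in>I. expectation (\<lambda>\<omega>. charlier k (pair_count S T k) (P k \<omega>))) * (a S * a T))"
      unfolding T_def by (rule expectation_bichaos[OF I charlier_props(1) charlier_props(2)[OF k1]])
    also have "\<dots> = (\<Sum>S\<in>Pow I. \<Sum>T\<in>Pow I. 0)"
    proof (intro sum.cong refl)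
      fix S T assume sub: "S \<in> Pow I" "T \<in> Pow I"
      show "(\<Prod>k\<in>I. expectation (\<lambda>\<omega>. charlier k (pair_count S T k) (P k \<omega>))) * (a S * a T) = 0"
      proof (cases "card S = q")
        case True
        \<comment> \<open>Here \<open>q \<ge> 1\<close> matters: a site of \<open>S\<close> has
          positive multiplicity, and its Charlier factor is centred.\<close>
        with q obtain k where k: "k \<in> S" by (metis card.empty equals0I not_one_le_zero)
        with sub have kI: "k \<in> I" by auto
        have "expectation (\<lambda>\<omega>. charlier k (pair_count S T k) (P k \<omega>)) = 0"
          using charlier_orth[OF k1[OF kI] pair_count_le[of S T k], of 0] k
          by (auto simp: charlier_def[of _ 0] wick_weight_def pair_count_def)
        then have "(\<Prod>k\<in>I. expectation (\<lambda>\<omega>. charlier k (pair_count S T k) (P k \<omega>))) = 0"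
          using I(1) kI by (intro prod_zero) auto
        then show ?thesis by simp
      qed (simp add: a)
    qed
    finally show ?thesis by simp
  qed
  have hmF: "has_moments M F" unfolding F_def by (rule has_moments_chaos[OF I(2)])
  have hmT: "has_moments M T"
    unfolding T_def by (rule has_moments_bichaos[OF charlier_props(2)[OF k1]])
  have EF2: "expectation (\<lambda>\<omega>. (F \<omega>)\<^sup>2) = v"
    unfolding F_def v_def by (rule expectation_chaos_sq[OF I])
  note ints = hmF hmT has_moments_integrable has_moments_mult has_moments_power
  \<comment> \<open>Bessel's inequality for the orthogonal variables 1 and \<open>T\<close>. Since
    \<open>E T = 0\<close> and \<open>E (F\<^sup>2 * T) = E T\<^sup>2 = d\<close>, expanding the
    square yields \<open>E F\<^sup>4 \<ge> v\<^sup>2 + d\<close>.\<close>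
  have "0 \<le> expectation (\<lambda>\<omega>. ((F \<omega>)\<^sup>2 - v - T \<omega>)\<^sup>2)" by simp
  also have "\<dots> = expectation (\<lambda>\<omega>. F \<omega> ^ 4 + v\<^sup>2 + T \<omega> * T \<omega> - 2 * v * (F \<omega>)\<^sup>2
      - 2 * ((F \<omega>)\<^sup>2 * T \<omega>) + 2 * v * T \<omega>)"
    by (intro Bochner_Integration.integral_cong) (auto simp: power2_eq_square power4_eq_xxxx algebra_simps)
  also have "\<dots> = expectation (\<lambda>\<omega>. F \<omega> ^ 4) + v\<^sup>2 + d - 2 * v * v - 2 * d + 2 * v * 0"
    using T0 by (simp add: ints TT FT EF2 prob_space)
  finally show ?thesis by (simp add: F_def v_def d_def power2_eq_square)
qed

end

text \<open>Empty \<open>x\<close> and \<open>x\<close> of size \<open>q\<close> are left out. They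
  belong to the contractions of all variables and of none, and account for the two copies of the
  squared variance in \<open>sum_contr_sq_ge\<close>.\<close>

definition contr_sum :: "'i set \<Rightarrow> nat \<Rightarrow> ('i set \<Rightarrow> real) \<Rightarrow> real" where
  "contr_sum I q a = (\<Sum>x\<in>{x\<in>Pow I. 1 \<le> card x \<and> card x < q}. \<Sum>x'\<in>Pow I. (set_contr I a x x')\<^sup>2)"

text \<open>A nonzero term requires both unions with the disjoint set \<open>y\<close> to have size
  \<open>q\<close>.\<close>

lemma contr_nonzero:
  assumes I: "finite I" "x \<subseteq> I" "x' \<subseteq> I" and a: "\<And>S. card S \<noteq> q \<Longrightarrow> a S = 0"
    and nz: "set_contr I a x x' \<noteq> 0"
  shows "card x' = card x" "card x \<le> q"
proof -
  obtain y where y: "y \<in> Pow I" "(if y \<inter> (x \<union> x') = {} then a (x \<union> y) * a (x' \<union> y) else 0) \<noteq> 0"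
    using nz unfolding set_contr_def by (rule sum.not_neutral_contains_not_neutral)
  then have d: "y \<inter> (x \<union> x') = {}" and aa: "a (x \<union> y) \<noteq> 0" "a (x' \<union> y) \<noteq> 0"
    by (auto split: if_splits)
  have fin: "finite x" "finite x'" "finite y"
    using finite_subset[OF I(2,1)] finite_subset[OF I(3,1)] finite_subset[of y, OF _ I(1)] y(1) by auto
  have c: "card (x \<union> y) = q" "card (x' \<union> y) = q" using a[of "x \<union> y"] a[of "x' \<union> y"] aa by blast+
  have "card (x \<union> y) = card x + card y" "card (x' \<union> y) = card x' + card y"
    using d by (intro card_Un_disjoint fin, blast)+
  with c show "card x' = card x" "card x \<le> q" by linarith+
qed

lemma contr_empty: "set_contr I a {} {} = (\<Sum>S\<in>Pow I. (a S)\<^sup>2)"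
  by (simp add: set_contr_def power2_eq_square)

text \<open>Joining a nonempty disjoint \<open>y\<close> to a set of size \<open>q\<close> leaves
  the support of \<open>a\<close>, so only \<open>y = {}\<close> contributes.\<close>

lemma contr_full:
  assumes I: "finite I" "x \<subseteq> I" "x' \<subseteq> I" and a: "\<And>S. card S \<noteq> q \<Longrightarrow> a S = 0" and "card x = q"
  shows "set_contr I a x x' = a x * a x'"
proof -
  have "(\<Sum>y\<in>Pow I. if y \<inter> (x \<union> x') = {} then a (x \<union> y) * a (x' \<union> y) else 0) =
      (\<Sum>y\<in>Pow I. if y = {} then a x * a x' else 0)"
  proof (intro sum.cong refl)
    fix y assume y: "y \<in> Pow I"
    have fin: "finite x" "finite y" using I y finite_subset by auto
    have "a (x \<union> y) = 0" if "y \<noteq> {}" "y \<inter> (x \<union> x') = {}"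
    proof (rule a)
      have "card (x \<union> y) = card x + card y" using that fin by (subst card_Un_disjoint) auto
      moreover have "card y > 0" using that fin by (simp add: card_gt_0_iff)
      ultimately show "card (x \<union> y) \<noteq> q" using \<open>card x = q\<close> by simp
    qed
    then show "(if y \<inter> (x \<union> x') = {} then a (x \<union> y) * a (x' \<union> y) else 0) =
        (if y = {} then a x * a x' else 0)" by auto
  qed
  then show ?thesis using I(1) by (simp add: set_contr_def)
qed

text \<open>Sort by the size of \<open>x\<close>: the empty set contributes at least
  \<open>v\<^sup>2\<close>, by its term with empty \<open>x'\<close>; the sets of size
  \<open>q\<close> contribute exactly \<open>v\<^sup>2\<close>, because the contraction is then a
  product; the sizes in between make up \<open>contr_sum\<close>.\<close>

lemma sum_contr_sq_ge:
  assumes I: "finite I" and a: "\<And>S. card S \<noteq> q \<Longrightarrow> a S = 0" and q: "q \<ge> 1"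
  shows "2 * (\<Sum>S\<in>Pow I. (a S)\<^sup>2)\<^sup>2 + contr_sum I q a \<le> (\<Sum>x\<in>Pow I. \<Sum>x'\<in>Pow I. (set_contr I a x x')\<^sup>2)"
proof -
  define v where "v = (\<Sum>S\<in>Pow I. (a S)\<^sup>2)"
  define h where "h = (\<lambda>x. \<Sum>x'\<in>Pow I. (set_contr I a x x')\<^sup>2)"
  let ?A = "{x\<in>Pow I. 1 \<le> card x \<and> card x < q}" and ?B = "{x\<in>Pow I. card x = q}"
  have fin: "finite (Pow I)" using I by simp
  have h0: "h x \<ge> 0" for x by (auto simp: h_def intro: sum_nonneg)
  have "v\<^sup>2 = (set_contr I a {} {})\<^sup>2" by (simp add: contr_empty v_def)
  also have "\<dots> \<le> h {}"
    unfolding h_def using fin by (intro member_le_sum) auto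
  finally have 1: "v\<^sup>2 \<le> h {}" .
  have "v = (\<Sum>S\<in>?B. (a S)\<^sup>2)"
    unfolding v_def using a fin by (intro sum.mono_neutral_right) auto
  then have "v\<^sup>2 = (\<Sum>x\<in>?B. (a x)\<^sup>2 * v)"
    by (simp add: power2_eq_square sum_distrib_right)
  also have "\<dots> = (\<Sum>x\<in>?B. h x)"
    unfolding h_def v_def sum_distrib_left
  proof (intro sum.cong refl)
    fix x x' assume "x \<in> ?B" "x' \<in> Pow I"
    then show "(a x)\<^sup>2 * (a x')\<^sup>2 = (set_contr I a x x')\<^sup>2"
      using contr_full[OF I _ _ a, of x x'] by (simp add: power_mult_distrib)
  qed
  finally have 2: "v\<^sup>2 = (\<Sum>x\<in>?B. h x)" .
  have "2 * v\<^sup>2 + contr_sum I q a \<le> (\<Sum>x\<in>{{}}. h x) + (\<Sum>x\<in>?B. h x) + (\<Sum>x\<in>?A. h x)"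
    using 1 2 by (simp add: contr_sum_def h_def)
  also have "\<dots> = (\<Sum>x\<in>({{}} \<union> ?B) \<union> ?A. h x)"
  proof -
    have fAB: "finite ?A" "finite ?B" using I by auto
    have "(\<Sum>x\<in>{{}} \<union> ?B. h x) = (\<Sum>x\<in>{{}}. h x) + (\<Sum>x\<in>?B. h x)"
      using q fAB by (intro sum.union_disjoint) auto
    moreover have "(\<Sum>x\<in>({{}} \<union> ?B) \<union> ?A. h x) = (\<Sum>x\<in>{{}} \<union> ?B. h x) + (\<Sum>x\<in>?A. h x)"
      using fAB by (intro sum.union_disjoint) auto
    ultimately show ?thesis by simp
  qed
  also have "\<dots> \<le> (\<Sum>x\<in>Pow I. h x)"
    using fin h0 by (intro sum_mono2) auto
  finally show ?thesis by (simp add: v_def h_def)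
qed

lemma contr_sum_nonneg: "contr_sum I q a \<ge> 0"
  unfolding contr_sum_def by (intro sum_nonneg) auto

text \<open>The common sites of \<open>S\<close> and \<open>T\<close> are divided into retained
  ones, \<open>W\<close>, and contracted ones, \<open>y\<close>. The three sets are recovered as
  \<open>S = x \<union> y\<close>, \<open>T = x' \<union> y\<close> and
  \<open>W = x \<inter> x'\<close>.\<close>

lemma sum_triples_regroup:
  fixes h :: "'i set \<Rightarrow> 'i set \<Rightarrow> 'i set \<Rightarrow> real"
  assumes "finite I"
  shows "(\<Sum>S\<in>Pow I. \<Sum>T\<in>Pow I. \<Sum>W\<in>Pow (S \<inter> T). h (W \<union> (S - T)) (W \<union> (T - S)) (S \<inter> T - W)) =
    (\<Sum>x\<in>Pow I. \<Sum>x'\<in>Pow I. \<Sum>y\<in>Pow I. if y \<inter> (x \<union> x') = {} then h x x' y else 0)"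
proof -
  have fin: "finite (Pow I)" "\<And>S T. S \<in> Pow I \<Longrightarrow> finite (Pow (S \<inter> T))"
    using assms finite_subset by auto
  have "(\<Sum>S\<in>Pow I. \<Sum>T\<in>Pow I. \<Sum>W\<in>Pow (S \<inter> T). h (W \<union> (S - T)) (W \<union> (T - S)) (S \<inter> T - W)) =
    (\<Sum>(S,T,W)\<in>(SIGMA S:Pow I. SIGMA T:Pow I. Pow (S \<inter> T)). h (W \<union> (S - T)) (W \<union> (T - S)) (S \<inter> T - W))"
    using fin by (simp add: sum.Sigma del: Pow_iff)
  also have "\<dots> = (\<Sum>(x,x',y)\<in>(SIGMA x:Pow I. SIGMA x':Pow I. {y\<in>Pow I. y \<inter> (x \<union> x') = {}}). h x x' y)"
    by (rule sum.reindex_bij_witness[where j = "\<lambda>(S,T,W). (W \<union> (S - T), W \<union> (T - S), S \<inter> T - W)"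
          and i = "\<lambda>(x,x',y). (x \<union> y, x' \<union> y, x \<inter> x')"]) auto
  also have "\<dots> = (\<Sum>x\<in>Pow I. \<Sum>x'\<in>Pow I. \<Sum>y\<in>{y\<in>Pow I. y \<inter> (x \<union> x') = {}}. h x x' y)"
    using fin by (simp add: sum.Sigma del: Pow_iff)
  also have "\<dots> = (\<Sum>x\<in>Pow I. \<Sum>x'\<in>Pow I. \<Sum>y\<in>Pow I. if y \<inter> (x \<union> x') = {} then h x x' y else 0)"
    by (intro sum.cong refl sum.inter_filter fin(1))
  finally show ?thesis .
qed

context normalized_poisson
begin

lemma fourth_cumulant_ge_contr_sum:
  assumes I: "finite I" "I \<subseteq> {1..}" and a: "\<And>S. card S \<noteq> q \<Longrightarrow> a S = 0" and q: "q \<ge> 1"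
  shows "contr_sum I q a \<le> expectation (\<lambda>\<omega>. chaos I a \<omega> ^ 4) - 3 * (\<Sum>S\<in>Pow I. (a S)\<^sup>2)\<^sup>2"
proof -
  have "(\<Sum>S\<in>Pow I. (a S)\<^sup>2)\<^sup>2 + (\<Sum>x\<in>Pow I. \<Sum>x'\<in>Pow I. (set_contr I a x x')\<^sup>2)
      \<le> expectation (\<lambda>\<omega>. chaos I a \<omega> ^ 4)"
    by (rule fourth_moment_ge[OF I _ q]) (rule a)
  moreover have "2 * (\<Sum>S\<in>Pow I. (a S)\<^sup>2)\<^sup>2 + contr_sum I q a
      \<le> (\<Sum>x\<in>Pow I. \<Sum>x'\<in>Pow I. (set_contr I a x x')\<^sup>2)"
    by (rule sum_contr_sq_ge[OF I(1) _ q]) (rule a)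
  ultimately show ?thesis by linarith
qed

section \<open>The coefficients \<open>B i\<close> and the variance of the sum of their
  squares\<close>

definition chaos_grad :: "nat set \<Rightarrow> (nat set \<Rightarrow> real) \<Rightarrow> nat \<Rightarrow> 'w \<Rightarrow> real" where
  "chaos_grad I a i = chaos (I - {i}) (\<lambda>S. a (insert i S))"

text \<open>Degrees 1 and 2 have covariance \<open>\<kappa> k\<close>, so this basis is not
  orthogonal. In exchange the square of \<open>P k\<close> has no linear component, and products of
  two monomials expand without Poisson corrections. Positive degrees are centred, which is enough
  for a variance bound.\<close>

definition square_basis :: "nat \<Rightarrow> nat \<Rightarrow> real \<Rightarrow> real" where
  "square_basis k m x = (if m = 0 then 1 else if m = 1 then x else x ^ 2 - 1)"

lemma square_basis_props:
  "square_basis k m \<in> borel_measurable borel" "k \<ge> 1 \<Longrightarrow> has_moments M (\<lambda>\<omega>. square_basis k m (P k \<omega>))"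
proof -
  show "square_basis k m \<in> borel_measurable borel" unfolding square_basis_def by simp
  assume "k \<ge> 1"
  then have "has_moments M (\<lambda>\<omega>. P k \<omega> ^ 2 - 1)"
    by (intro has_moments_diff has_moments_mult has_moments_power has_moments_P has_moments_const)
  with \<open>k \<ge> 1\<close> show "has_moments M (\<lambda>\<omega>. square_basis k m (P k \<omega>))"
    using has_moments_P[of k] by (cases "m = 0"; cases "m = 1") (auto simp: square_basis_def)
qed

lemma chaos_grad_eq:
  assumes "finite I" "i \<in> I"
  shows "chaos_grad I a i \<omega> = (\<Sum>S\<in>Pow I. if i \<in> S then a S * (\<Prod>k\<in>S - {i}. P k \<omega>) else 0)"
proof -
  have "(\<Sum>S\<in>Pow I. if i \<in> S then a S * (\<Prod>k\<in>S - {i}. P k \<omega>) else 0) =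
      (\<Sum>S\<in>{S\<in>Pow I. i \<in> S}. a S * (\<Prod>k\<in>S - {i}. P k \<omega>))"
    using assms(1) by (simp add: sum.inter_filter del: Pow_iff)
  also have "\<dots> = (\<Sum>S\<in>Pow (I - {i}). a (insert i S) * (\<Prod>k\<in>S. P k \<omega>))"
    by (rule sum.reindex_bij_witness[where i = "insert i" and j = "\<lambda>S. S - {i}"])
      (use assms in \<open>auto simp: insert_absorb\<close>)
  finally show ?thesis by (simp add: chaos_grad_def chaos_def)
qed

lemma prod_square_basis:
  assumes "finite I" "x \<subseteq> I" "x' \<subseteq> I"
  shows "(\<Prod>k\<in>I. square_basis k (pair_count x x' k) (P k \<omega>)) =
    (\<Prod>k\<in>x - x'. P k \<omega>) * (\<Prod>k\<in>x' - x. P k \<omega>) * (\<Prod>k\<in>x \<inter> x'. P k \<omega> ^ 2 - 1)"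
proof -
  have *: "prod h A = (\<Prod>k\<in>I. if k \<in> A then h k else 1)" if "A \<subseteq> I" for h :: "nat \<Rightarrow> real" and A
    using that assms(1) by (simp add: prod.inter_restrict[symmetric] Int_absorb1)
  have sub: "x - x' \<subseteq> I" "x' - x \<subseteq> I" "x \<inter> x' \<subseteq> I" using assms by auto
  show ?thesis
    unfolding *[OF sub(1)] *[OF sub(2)] *[OF sub(3)] prod.distrib[symmetric]
    by (intro prod.cong) (auto simp: square_basis_def pair_count_def)
qed

text \<open>Expand \<open>(P k)\<^sup>2 = 1 + ((P k)\<^sup>2 - 1)\<close> at all sites shared by the two factors and sort by the set \<open>y\<close>
  of sites where 1 was chosen, one of which is \<open>i\<close>.\<close>

lemma sum_chaos_grad_sq_eq:
  assumes I: "finite I" and a: "\<And>S. card S \<noteq> q \<Longrightarrow> a S = 0"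
  shows "(\<Sum>i\<in>I. (chaos_grad I a i \<omega>)\<^sup>2) =
    bichaos I (\<lambda>x x'. (real q - real (card x)) * set_contr I a x x') square_basis \<omega>"
proof -
  let ?p = "\<lambda>S. \<Prod>k\<in>S. P k \<omega>"
  have fS: "finite S" if "S \<in> Pow I" for S using that I finite_subset by auto
  have inner: "(\<Sum>i\<in>S \<inter> T. ?p (S - {i}) * ?p (T - {i})) =
      (\<Sum>W\<in>Pow (S \<inter> T). real (card (S \<inter> T - W)) * (?p (S - T) * ?p (T - S) * (\<Prod>k\<in>W. P k \<omega> ^ 2 - 1)))"
    if ST: "S \<in> Pow I" "T \<in> Pow I" for S T
  proof -
    let ?y = "\<lambda>W. \<Prod>k\<in>W. P k \<omega> ^ 2 - 1"
    have fin: "finite S" "finite T" "finite (S \<inter> T)" using fS ST by auto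
    \<comment> \<open>Besides the sites in only one of the sets, the common sites other than
      \<open>i\<close> appear squared; expanding their squares as \<open>(P k)\<^sup>2 - 1\<close>
      plus 1 yields the sum over \<open>W\<close>.\<close>
    have one: "?p (S - {i}) * ?p (T - {i}) =
        (\<Sum>W\<in>Pow (S \<inter> T). if i \<in> W then 0 else ?p (S - T) * ?p (T - S) * ?y W)" if i: "i \<in> S \<inter> T" for i
    proof -
      have "S - {i} = (S - T) \<union> (S \<inter> T - {i})" "T - {i} = (T - S) \<union> (S \<inter> T - {i})"
        using i by auto
      then have "?p (S - {i}) = ?p (S - T) * ?p (S \<inter> T - {i})"
        "?p (T - {i}) = ?p (T - S) * ?p (S \<inter> T - {i})"
        using fin by (auto intro!: prod.union_disjoint)
      then have "?p (S - {i}) * ?p (T - {i}) =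
          ?p (S - T) * ?p (T - S) * (\<Prod>k\<in>S \<inter> T - {i}. (P k \<omega> ^ 2 - 1) + 1)"
        by (simp add: power2_eq_square prod.distrib)
      also have "\<dots> = (\<Sum>W\<in>Pow (S \<inter> T - {i}). ?p (S - T) * ?p (T - S) * ?y W)"
        using fin by (subst prod_add) (simp_all add: sum_distrib_left)
      also have "Pow (S \<inter> T - {i}) = {W\<in>Pow (S \<inter> T). \<not> i \<in> W}" by auto
      also have "(\<Sum>W\<in>{W\<in>Pow (S \<inter> T). \<not> i \<in> W}. ?p (S - T) * ?p (T - S) * ?y W) =
          (\<Sum>W\<in>Pow (S \<inter> T). if i \<in> W then 0 else ?p (S - T) * ?p (T - S) * ?y W)"
        unfolding sum.inter_filter[OF finite_Pow_iff[THEN iffD2, OF fin(3)]]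
        by (intro sum.cong refl) simp
      finally show ?thesis .
    qed
    have "(\<Sum>i\<in>S \<inter> T. ?p (S - {i}) * ?p (T - {i})) =
      (\<Sum>i\<in>S \<inter> T. \<Sum>W\<in>Pow (S \<inter> T). if i \<in> W then 0 else ?p (S - T) * ?p (T - S) * ?y W)"
      by (intro sum.cong refl one)
    also have "\<dots> = (\<Sum>W\<in>Pow (S \<inter> T). \<Sum>i\<in>S \<inter> T. if i \<in> W then 0 else ?p (S - T) * ?p (T - S) * ?y W)"
      by (rule sum.swap)
    \<comment> \<open>A set \<open>W\<close> occurs once for every common site \<open>i\<close>
      outside it, hence the cardinality as a factor.\<close>
    also have "\<dots> = (\<Sum>W\<in>Pow (S \<inter> T). real (card (S \<inter> T - W)) * (?p (S - T) * ?p (T - S) * ?y W))"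
      using fin by (intro sum.cong refl) (simp add: sum.If_cases Diff_eq)
    finally show ?thesis .
  qed
  have "(\<Sum>i\<in>I. (chaos_grad I a i \<omega>)\<^sup>2) = (\<Sum>i\<in>I. \<Sum>S\<in>Pow I. \<Sum>T\<in>Pow I.
      if i \<in> S \<inter> T then a S * a T * (?p (S - {i}) * ?p (T - {i})) else 0)"
  proof (intro sum.cong refl)
    fix i assume "i \<in> I"
    show "(chaos_grad I a i \<omega>)\<^sup>2 = (\<Sum>S\<in>Pow I. \<Sum>T\<in>Pow I.
      if i \<in> S \<inter> T then a S * a T * (?p (S - {i}) * ?p (T - {i})) else 0)"
      unfolding chaos_grad_eq[OF I \<open>i \<in> I\<close>] power2_eq_square sum_product
      by (intro sum.cong refl) simp
  qed
  also have "\<dots> = (\<Sum>S\<in>Pow I. \<Sum>T\<in>Pow I. \<Sum>i\<in>I.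
      if i \<in> S \<inter> T then a S * a T * (?p (S - {i}) * ?p (T - {i})) else 0)"
    by (subst sum.swap, rule sum.cong[OF refl], rule sum.swap)
  also have "\<dots> = (\<Sum>S\<in>Pow I. \<Sum>T\<in>Pow I. a S * a T * (\<Sum>i\<in>S \<inter> T. ?p (S - {i}) * ?p (T - {i})))"
  proof (intro sum.cong refl)
    fix S T assume "S \<in> Pow I" "T \<in> Pow I"
    then have "I \<inter> (S \<inter> T) = S \<inter> T" by auto
    then show "(\<Sum>i\<in>I. if i \<in> S \<inter> T then a S * a T * (?p (S - {i}) * ?p (T - {i})) else 0) =
      a S * a T * (\<Sum>i\<in>S \<inter> T. ?p (S - {i}) * ?p (T - {i}))"
      using I by (subst sum.inter_restrict[symmetric]) (auto simp: sum_distrib_left)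
  qed
  also have "\<dots> = (\<Sum>S\<in>Pow I. \<Sum>T\<in>Pow I. \<Sum>W\<in>Pow (S \<inter> T). a S * a T *
      (real (card (S \<inter> T - W)) * (?p (S - T) * ?p (T - S) * (\<Prod>k\<in>W. P k \<omega> ^ 2 - 1))))"
    by (intro sum.cong refl) (simp only: inner sum_distrib_left)
  also have "\<dots> = (\<Sum>S\<in>Pow I. \<Sum>T\<in>Pow I. \<Sum>W\<in>Pow (S \<inter> T).
      (\<lambda>x x' y. a (x \<union> y) * a (x' \<union> y) * (real (card y) * (\<Prod>k\<in>I. square_basis k (pair_count x x' k) (P k \<omega>))))
        (W \<union> (S - T)) (W \<union> (T - S)) (S \<inter> T - W))"
  proof (intro sum.cong refl)
    fix S T W assume sub: "S \<in> Pow I" "T \<in> Pow I" "W \<in> Pow (S \<inter> T)"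
    have e: "W \<union> (S - T) \<union> (S \<inter> T - W) = S" "W \<union> (T - S) \<union> (S \<inter> T - W) = T"
      "W \<union> (S - T) - (W \<union> (T - S)) = S - T" "W \<union> (T - S) - (W \<union> (S - T)) = T - S"
      "(W \<union> (S - T)) \<inter> (W \<union> (T - S)) = W" "W \<union> (S - T) \<subseteq> I" "W \<union> (T - S) \<subseteq> I"
      using sub by auto
    show "a S * a T * (real (card (S \<inter> T - W)) * (?p (S - T) * ?p (T - S) * (\<Prod>k\<in>W. P k \<omega> ^ 2 - 1))) =
      (\<lambda>x x' y. a (x \<union> y) * a (x' \<union> y) * (real (card y) * (\<Prod>k\<in>I. square_basis k (pair_count x x' k) (P k \<omega>))))
        (W \<union> (S - T)) (W \<union> (T - S)) (S \<inter> T - W)"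
      unfolding e(1,2) prod_square_basis[OF I e(6,7)] e(3-5) ..
  qed
  also have "\<dots> = (\<Sum>x\<in>Pow I. \<Sum>x'\<in>Pow I. \<Sum>y\<in>Pow I. if y \<inter> (x \<union> x') = {} then
      a (x \<union> y) * a (x' \<union> y) * (real (card y) * (\<Prod>k\<in>I. square_basis k (pair_count x x' k) (P k \<omega>))) else 0)"
    by (rule sum_triples_regroup[OF I])
  also have "\<dots> = bichaos I (\<lambda>x x'. (real q - real (card x)) * set_contr I a x x') square_basis \<omega>"
    unfolding bichaos_def set_contr_def sum_distrib_left sum_distrib_right
  proof (intro sum.cong refl)
    fix x x' y assume sub: "x \<in> Pow I" "x' \<in> Pow I" "y \<in> Pow I"
    show "(if y \<inter> (x \<union> x') = {} then
      a (x \<union> y) * a (x' \<union> y) * (real (card y) * (\<Prod>k\<in>I. square_basis k (pair_count x x' k) (P k \<omega>))) else 0) =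
      (real q - real (card x)) * (if y \<inter> (x \<union> x') = {} then a (x \<union> y) * a (x' \<union> y) else 0) *
      (\<Prod>k\<in>I. square_basis k (pair_count x x' k) (P k \<omega>))"
    \<comment> \<open>On the support of \<open>a\<close> the number of contracted sites is
      determined by \<open>x\<close>: \<open>card y = q - card x\<close>.\<close>
    proof (cases "y \<inter> (x \<union> x') = {} \<and> card (x \<union> y) = q")
      case True
      then have "card x + card y = q"
        using fS[OF sub(1)] fS[OF sub(3)] card_Un_disjoint[of x y] by (simp add: Int_commute Int_Un_distrib)
      then have "real q - real (card x) = real (card y)" by auto
      with True show ?thesis by simp
    qed (use a in auto)
  qed
  finally show ?thesis .
qed

text \<open>A bound for all covariances in \<open>square_basis\<close>; the largest is
  \<open>2 + (\<kappa> k)\<^sup>2\<close>, and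
  \<open>(\<kappa> k)\<^sup>2 = 1 / lam k \<le> 1 / \<alpha>\<close>.\<close>

definition K\<^sub>2 :: real where "K\<^sub>2 = 2 + 1 / \<alpha>"

lemma K2_ge: "K\<^sub>2 \<ge> 2"
  using alpha_pos by (simp add: K\<^sub>2_def)

lemma square_basis_covariance:
  assumes k: "k \<ge> 1" and "m \<le> 2" "n \<le> 2"
  defines "e \<equiv> expectation (\<lambda>\<omega>. square_basis k m (P k \<omega>) * square_basis k n (P k \<omega>))"
  shows "m = 0 \<Longrightarrow> n = 0 \<Longrightarrow> e = 1" "(m = 0) \<noteq> (n = 0) \<Longrightarrow> e = 0" "\<bar>e\<bar> \<le> K\<^sub>2"
proof -
  let ?c = "square_basis k"
  let ?E = "\<lambda>m n. expectation (\<lambda>\<omega>. ?c m (P k \<omega>) * ?c n (P k \<omega>))"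
  note c = square_basis_def power2_eq_square power3_eq_cube power4_eq_xxxx
  have E: "?E 0 0 = 1" "?E 0 1 = 0" "?E 0 2 = 0" "?E 1 1 = 1" "?E 1 2 = \<kappa> k" "?E 2 2 = 2 + (\<kappa> k)\<^sup>2"
    using expectation_poly4[OF k, of "\<lambda>x. ?c 0 x * ?c 0 x" 1 0 0 0 0]
      expectation_poly4[OF k, of "\<lambda>x. ?c 0 x * ?c 1 x" 0 1 0 0 0]
      expectation_poly4[OF k, of "\<lambda>x. ?c 0 x * ?c 2 x" "-1" 0 1 0 0]
      expectation_poly4[OF k, of "\<lambda>x. ?c 1 x * ?c 1 x" 0 0 1 0 0]
      expectation_poly4[OF k, of "\<lambda>x. ?c 1 x * ?c 2 x" 0 "-1" 0 1 0]
      expectation_poly4[OF k, of "\<lambda>x. ?c 2 x * ?c 2 x" 1 0 "-2" 0 1]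
    by (simp_all add: c algebra_simps)
  have sym: "?E m n = ?E n m" for m n by (simp add: mult.commute)
  have mn: "m = 0 \<or> m = 1 \<or> m = 2" "n = 0 \<or> n = 1 \<or> n = 2" using assms by auto
  show "m = 0 \<Longrightarrow> n = 0 \<Longrightarrow> e = 1" using E by (simp add: e_def)
  show "(m = 0) \<noteq> (n = 0) \<Longrightarrow> e = 0"
    using mn E sym[of 1 0] sym[of 2 0] unfolding e_def by (elim disjE) simp_all
  have "(\<kappa> k)\<^sup>2 \<le> 1 / \<alpha>"
    using kappa_sq[OF k] lam_ge[OF k] alpha_pos by (simp add: frac_le)
  moreover have "\<kappa> k \<le> 1 + (\<kappa> k)\<^sup>2"
    using sum_squares_bound[of "\<kappa> k" 1] kappa_pos[OF k] by simp
  ultimately have "\<bar>\<kappa> k\<bar> \<le> K\<^sub>2" "\<bar>2 + (\<kappa> k)\<^sup>2\<bar> \<le> K\<^sub>2" "1 \<le> K\<^sub>2"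
    using kappa_pos[OF k] alpha_pos by (auto simp: K\<^sub>2_def)
  then show "\<bar>e\<bar> \<le> K\<^sub>2"
    using mn E sym[of 1 0] sym[of 2 0] sym[of 2 1] unfolding e_def by (elim disjE) simp_all
qed

text \<open>A site in only one of the two unions contributes a centred factor, a site in both at
  most \<open>K\<^sub>2\<close>, and a site in neither contributes 1. Multiplicities need not agree,
  since the basis is not orthogonal.\<close>

lemma prod_square_basis_covariance:
  assumes I: "finite I" "I \<subseteq> {1..}" and sub: "S \<subseteq> I" "T \<subseteq> I" "S' \<subseteq> I" "T' \<subseteq> I"
  defines "e \<equiv> \<Prod>k\<in>I. expectation (\<lambda>\<omega>. square_basis k (pair_count S T k) (P k \<omega>) * square_basis k (pair_count S' T' k) (P k \<omega>))"
  shows "\<bar>e\<bar> \<le> (if S \<union> T = S' \<union> T' then K\<^sub>2 ^ card (S \<union> T) else 0)"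
proof -
  have k1: "k \<ge> 1" if "k \<in> I" for k using that I by auto
  let ?e = "\<lambda>k. expectation (\<lambda>\<omega>. square_basis k (pair_count S T k) (P k \<omega>) * square_basis k (pair_count S' T' k) (P k \<omega>))"
  have cnt0: "pair_count S T k = 0 \<longleftrightarrow> k \<notin> S \<union> T" for S T :: "nat set" and k
    by (auto simp: pair_count_def)
  show ?thesis
  proof (cases "S \<union> T = S' \<union> T'")
    case False
    then obtain k where k: "k \<in> I" "(k \<in> S \<union> T) \<noteq> (k \<in> S' \<union> T')" using sub by blast
    then have "?e k = 0"
      using square_basis_covariance(2)[OF k1[OF k(1)] pair_count_le[of S T k] pair_count_le[of S' T' k]] by (simp only: cnt0) blast
    then have "e = 0" unfolding e_def using I(1) k(1) by (intro prod_zero) auto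
    with False show ?thesis by simp
  next
    case True
    have "\<bar>e\<bar> = (\<Prod>k\<in>I. \<bar>?e k\<bar>)" unfolding e_def by (rule abs_prod)
    also have "\<dots> \<le> (\<Prod>k\<in>I. if k \<in> S \<union> T then K\<^sub>2 else 1)"
    proof (intro prod_mono conjI)
      fix k assume k: "k \<in> I"
      show "\<bar>?e k\<bar> \<le> (if k \<in> S \<union> T then K\<^sub>2 else 1)"
      proof (cases "k \<in> S \<union> T")
        case True
        then show ?thesis
          using square_basis_covariance(3)[OF k1[OF k] pair_count_le[of S T k] pair_count_le[of S' T' k]] by simp
      next
        case False
        then have "pair_count S T k = 0" "pair_count S' T' k = 0" using True by (simp_all add: cnt0)
        then show ?thesis
          using square_basis_covariance(1)[OF k1[OF k] pair_count_le[of S T k] pair_count_le[of S' T' k]] False by simp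
      qed
    qed simp
    also have "\<dots> = (\<Prod>k\<in>S \<union> T. K\<^sub>2)"
      using I(1) sub by (subst prod.inter_restrict[symmetric]) (auto simp: Int_absorb1)
    finally show ?thesis using True by simp
  qed
qed

text \<open>Terms with different unions of the two index sets are uncorrelated, and at most
  \<open>4 ^ d\<close> pairs share a union of size at most \<open>d\<close>. Bounding each product
  of coefficients by the mean of their squares therefore reduces the covariance form to its diagonal
  at this cost.\<close>

lemma bichaos_square_basis_second_moment:
  assumes I: "finite I" "I \<subseteq> {1..}"
    and c: "\<And>x x'. x \<subseteq> I \<Longrightarrow> x' \<subseteq> I \<Longrightarrow> c x x' \<noteq> 0 \<Longrightarrow> card (x \<union> x') \<le> d"
  shows "expectation (\<lambda>\<omega>. (bichaos I c square_basis \<omega>)\<^sup>2) \<le>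
    K\<^sub>2 ^ d * 4 ^ d * (\<Sum>x\<in>Pow I. \<Sum>x'\<in>Pow I. (c x x')\<^sup>2)"
proof -
  have k1: "k \<ge> 1" if "k \<in> I" for k using that I by auto
  define \<Omega> where "\<Omega> = Pow I \<times> Pow I"
  define C where "C = (\<lambda>p. c (fst p) (snd p))"
  define U where "U = (\<lambda>p :: nat set \<times> nat set. fst p \<union> snd p)"
  have fin: "finite \<Omega>" using I by (simp add: \<Omega>_def)
  have K: "K\<^sub>2 \<ge> 1" using K2_ge by simp
  let ?e = "\<lambda>S T S' T'. \<Prod>k\<in>I. expectation (\<lambda>\<omega>. square_basis k (pair_count S T k) (P k \<omega>) * square_basis k (pair_count S' T' k) (P k \<omega>))"
  have "expectation (\<lambda>\<omega>. (bichaos I c square_basis \<omega>)\<^sup>2) = (\<Sum>S\<in>Pow I. \<Sum>T\<in>Pow I. \<Sum>S'\<in>Pow I. \<Sum>T'\<in>Pow I.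
      ?e S T S' T' * (c S T * c S' T'))"
    unfolding power2_eq_square by (rule expectation_bichaos_mult[OF I square_basis_props(1) square_basis_props(2)[OF k1]
      square_basis_props(1) square_basis_props(2)[OF k1]])
  also have "\<dots> \<le> (\<Sum>S\<in>Pow I. \<Sum>T\<in>Pow I. \<Sum>S'\<in>Pow I. \<Sum>T'\<in>Pow I.
      if S \<union> T = S' \<union> T' then K\<^sub>2 ^ d * (((c S T)\<^sup>2 + (c S' T')\<^sup>2) / 2) else 0)"
  proof (intro sum_mono)
    fix S T S' T' assume sub: "S \<in> Pow I" "T \<in> Pow I" "S' \<in> Pow I" "T' \<in> Pow I"
    show "?e S T S' T' * (c S T * c S' T') \<le>
      (if S \<union> T = S' \<union> T' then K\<^sub>2 ^ d * (((c S T)\<^sup>2 + (c S' T')\<^sup>2) / 2) else 0)"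
    proof (cases "c S T = 0")
      case True
      then show ?thesis using K by simp
    next
      case False
      then have d: "card (S \<union> T) \<le> d" using c sub by simp
      have le: "\<bar>?e S T S' T'\<bar> \<le> (if S \<union> T = S' \<union> T' then K\<^sub>2 ^ card (S \<union> T) else 0)"
        using prod_square_basis_covariance[OF I] sub by auto
      show ?thesis
      proof (cases "S \<union> T = S' \<union> T'")
        case True
        have "\<bar>?e S T S' T'\<bar> \<le> K\<^sub>2 ^ d"
          using le True power_increasing[OF d K] by simp
        moreover have "\<bar>c S T * c S' T'\<bar> \<le> ((c S T)\<^sup>2 + (c S' T')\<^sup>2) / 2"
          using sum_squares_bound[of "\<bar>c S T\<bar>" "\<bar>c S' T'\<bar>"] by (simp add: abs_mult)
        ultimately have "\<bar>?e S T S' T'\<bar> * \<bar>c S T * c S' T'\<bar> \<le> K\<^sub>2 ^ d * (((c S T)\<^sup>2 + (c S' T')\<^sup>2) / 2)"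
          using K by (intro mult_mono) auto
        moreover have "?e S T S' T' * (c S T * c S' T') \<le> \<bar>?e S T S' T'\<bar> * \<bar>c S T * c S' T'\<bar>"
          using abs_ge_self[of "?e S T S' T' * (c S T * c S' T')"] by (simp only: abs_mult)
        ultimately show ?thesis using True by simp
      next
        case False
        with le have "?e S T S' T' = 0" by simp
        with False show ?thesis by simp
      qed
    qed
  qed
  also have "\<dots> = (\<Sum>p\<in>\<Omega>. \<Sum>p'\<in>\<Omega>. if U p = U p' then K\<^sub>2 ^ d * (((C p)\<^sup>2 + (C p')\<^sup>2) / 2) else 0)"
    unfolding \<Omega>_def U_def C_def by (simp only: sum.cartesian_product' fst_conv snd_conv)
  also have "\<dots> = (\<Sum>p\<in>\<Omega>. \<Sum>p'\<in>\<Omega>. if U p = U p' then K\<^sub>2 ^ d * ((C p)\<^sup>2 / 2) else 0)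
      + (\<Sum>p\<in>\<Omega>. \<Sum>p'\<in>\<Omega>. if U p = U p' then K\<^sub>2 ^ d * ((C p')\<^sup>2 / 2) else 0)"
    unfolding sum.distrib[symmetric]
    by (intro sum.cong refl) (auto simp: add_divide_distrib distrib_left)
  also have "(\<Sum>p\<in>\<Omega>. \<Sum>p'\<in>\<Omega>. if U p = U p' then K\<^sub>2 ^ d * ((C p')\<^sup>2 / 2) else 0) =
      (\<Sum>p\<in>\<Omega>. \<Sum>p'\<in>\<Omega>. if U p = U p' then K\<^sub>2 ^ d * ((C p)\<^sup>2 / 2) else 0)"
    by (subst sum.swap) (simp add: eq_commute)
  also have "(\<Sum>p\<in>\<Omega>. \<Sum>p'\<in>\<Omega>. if U p = U p' then K\<^sub>2 ^ d * ((C p)\<^sup>2 / 2) else 0) + \<dots> =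
      (\<Sum>p\<in>\<Omega>. real (card {p'\<in>\<Omega>. U p = U p'}) * (K\<^sub>2 ^ d * (C p)\<^sup>2))"
  proof (subst sum.distrib[symmetric], intro sum.cong refl)
    fix p assume "p \<in> \<Omega>"
    have "(\<Sum>p'\<in>\<Omega>. if U p = U p' then K\<^sub>2 ^ d * ((C p)\<^sup>2 / 2) else 0) =
        (\<Sum>p'\<in>{p'\<in>\<Omega>. U p = U p'}. K\<^sub>2 ^ d * ((C p)\<^sup>2 / 2))"
      by (rule sum.inter_filter[OF fin, symmetric])
    then show "(\<Sum>p'\<in>\<Omega>. if U p = U p' then K\<^sub>2 ^ d * ((C p)\<^sup>2 / 2) else 0) +
        (\<Sum>p'\<in>\<Omega>. if U p = U p' then K\<^sub>2 ^ d * ((C p)\<^sup>2 / 2) else 0) =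
        real (card {p'\<in>\<Omega>. U p = U p'}) * (K\<^sub>2 ^ d * (C p)\<^sup>2)" by simp
  qed
  also have "\<dots> \<le> (\<Sum>p\<in>\<Omega>. 4 ^ d * (K\<^sub>2 ^ d * (C p)\<^sup>2))"
  proof (intro sum_mono)
    fix p assume p: "p \<in> \<Omega>"
    show "real (card {p'\<in>\<Omega>. U p = U p'}) * (K\<^sub>2 ^ d * (C p)\<^sup>2) \<le> 4 ^ d * (K\<^sub>2 ^ d * (C p)\<^sup>2)"
    proof (cases "C p = 0")
      case False
      then have d: "card (U p) \<le> d" using c p by (auto simp: U_def C_def \<Omega>_def)
      have fU: "finite (U p)" using p by (auto simp: U_def \<Omega>_def intro: finite_subset[OF _ I(1)])
      have "p' \<in> Pow (U p) \<times> Pow (U p)" if "U p = U p'" for p'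
        unfolding that by (cases p') (simp add: U_def)
      then have "card {p'\<in>\<Omega>. U p = U p'} \<le> card (Pow (U p) \<times> Pow (U p))"
        using fU by (intro card_mono) blast+
      also have "\<dots> = (2 ^ card (U p)) * (2 ^ card (U p))"
        using fU by (simp add: card_cartesian_product card_Pow)
      also have "\<dots> = 4 ^ card (U p)" by (simp add: power_mult_distrib[symmetric])
      also have "\<dots> \<le> 4 ^ d" using d by (intro power_increasing) auto
      finally have "real (card {p'\<in>\<Omega>. U p = U p'}) \<le> 4 ^ d"
        by (metis of_nat_le_iff of_nat_numeral of_nat_power)
      then show ?thesis using K by (intro mult_right_mono) auto
    qed simp
  qed
  also have "\<dots> = K\<^sub>2 ^ d * 4 ^ d * (\<Sum>x\<in>Pow I. \<Sum>x'\<in>Pow I. (c x x')\<^sup>2)"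
    unfolding \<Omega>_def C_def
    by (simp only: sum.cartesian_product' fst_conv snd_conv sum_distrib_left mult_ac)
  finally show ?thesis .
qed

text \<open>In the expansion of the sum of squares the constant term is \<open>real q * v\<close>,
  which is subtracted, and the terms with \<open>card x = q\<close> carry the factor 0. Exactly the
  coefficients collected in \<open>contr_sum\<close> remain, with weights at most
  \<open>q\<close>.\<close>

lemma sum_chaos_grad_sq_variance:
  assumes I: "finite I" "I \<subseteq> {1..}" and a: "\<And>S. card S \<noteq> q \<Longrightarrow> a S = 0"
  shows "expectation (\<lambda>\<omega>. ((\<Sum>i\<in>I. (chaos_grad I a i \<omega>)\<^sup>2) - real q * (\<Sum>S\<in>Pow I. (a S)\<^sup>2))\<^sup>2) \<le>
    K\<^sub>2 ^ (2 * q) * 4 ^ (2 * q) * (real q)\<^sup>2 * contr_sum I q a"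
proof -
  define v where "v = (\<Sum>S\<in>Pow I. (a S)\<^sup>2)"
  define c where "c = (\<lambda>x x'. (real q - real (card x)) * set_contr I a x x')"
  define c' where "c' = (\<lambda>x x'. if x = {} \<and> x' = {} then 0 else c x x')"
  have nz: "card x' = card x \<and> card x \<le> q" if "x \<subseteq> I" "x' \<subseteq> I" "set_contr I a x x' \<noteq> 0" for x x'
    using contr_nonzero[OF I(1) that(1,2) _ that(3)] a by blast
  have eq: "(\<Sum>i\<in>I. (chaos_grad I a i \<omega>)\<^sup>2) - real q * v = bichaos I c' square_basis \<omega>" for \<omega>
  proof -
    let ?R = "\<lambda>x x'. \<Prod>k\<in>I. square_basis k (pair_count x x' k) (P k \<omega>)"
    have "(\<Sum>i\<in>I. (chaos_grad I a i \<omega>)\<^sup>2) = bichaos I c square_basis \<omega>"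
      unfolding c_def by (rule sum_chaos_grad_sq_eq[OF I(1)]) (rule a)
    also have "\<dots> = (\<Sum>x\<in>Pow I. \<Sum>x'\<in>Pow I. c' x x' * ?R x x' +
        (if x' = {} then (if x = {} then c {} {} * ?R {} {} else 0) else 0))"
      unfolding bichaos_def by (intro sum.cong refl) (auto simp: c'_def)
    also have "\<dots> = bichaos I c' square_basis \<omega> + c {} {} * ?R {} {}"
      using I(1) by (simp add: sum.distrib bichaos_def)
    also have "?R {} {} = 1" by (intro prod.neutral) (auto simp: pair_count_def square_basis_def)
    finally show ?thesis by (simp add: c_def contr_empty v_def)
  qed
  have "expectation (\<lambda>\<omega>. (bichaos I c' square_basis \<omega>)\<^sup>2) \<le>
      K\<^sub>2 ^ (2 * q) * 4 ^ (2 * q) * (\<Sum>x\<in>Pow I. \<Sum>x'\<in>Pow I. (c' x x')\<^sup>2)"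
  proof (rule bichaos_square_basis_second_moment[OF I])
    fix x x' assume x: "x \<subseteq> I" "x' \<subseteq> I" "c' x x' \<noteq> 0"
    then have "set_contr I a x x' \<noteq> 0" by (auto simp: c'_def c_def split: if_splits)
    then have "card x' = card x" "card x \<le> q" using nz x by auto
    then show "card (x \<union> x') \<le> 2 * q" using card_Un_le[of x x'] by linarith
  qed
  also have "(\<Sum>x\<in>Pow I. \<Sum>x'\<in>Pow I. (c' x x')\<^sup>2) \<le> (real q)\<^sup>2 * contr_sum I q a"
  proof -
    have "(\<Sum>x\<in>Pow I. \<Sum>x'\<in>Pow I. (c' x x')\<^sup>2) \<le>
      (\<Sum>x\<in>Pow I. if 1 \<le> card x \<and> card x < q then \<Sum>x'\<in>Pow I. (real q)\<^sup>2 * (set_contr I a x x')\<^sup>2 else 0)"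
    proof (intro sum_mono)
      fix x assume x: "x \<in> Pow I"
      have fx: "finite x" using x by (auto intro: finite_subset[OF _ I(1)])
      show "(\<Sum>x'\<in>Pow I. (c' x x')\<^sup>2) \<le>
        (if 1 \<le> card x \<and> card x < q then \<Sum>x'\<in>Pow I. (real q)\<^sup>2 * (set_contr I a x x')\<^sup>2 else 0)"
      proof (cases "1 \<le> card x \<and> card x < q")
        case True
        have "(c' x x')\<^sup>2 \<le> (real q)\<^sup>2 * (set_contr I a x x')\<^sup>2" for x'
          using True by (auto simp: c'_def c_def power_mult_distrib intro!: mult_right_mono power_mono)
        with True show ?thesis by (auto intro!: sum_mono)
      next
        case False
        have "c' x x' = 0" if "x' \<in> Pow I" for x'
        proof (rule ccontr)
          assume n: "c' x x' \<noteq> 0"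
          then have "set_contr I a x x' \<noteq> 0" and "card x \<noteq> q"
            by (auto simp: c'_def c_def split: if_splits)
          then have "card x' = card x" "card x < q" using nz[of x x'] x that by auto
          with False have "card x = 0" "card x' = 0" by auto
          moreover have "finite x'" using that by (auto intro: finite_subset[OF _ I(1)])
          ultimately have "x = {}" "x' = {}" using fx by auto
          with n show False by (simp add: c'_def)
        qed
        then show ?thesis unfolding if_not_P[OF False] by simp
      qed
    qed
    also have "\<dots> = (real q)\<^sup>2 * contr_sum I q a"
      unfolding contr_sum_def sum.inter_filter[OF finite_Pow_iff[THEN iffD2, OF I(1)]] sum_distrib_left
      by (intro sum.cong refl) (simp add: sum_distrib_left)
    finally show ?thesis .
  qed
  finally show ?thesis using K2_ge unfolding v_def[symmetric] eq by (simp add: mult.assoc)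
qed

text \<open>For a homogeneous polynomial all weights in \<open>sixth_moment_chaos\<close> equal
  \<open>K\<^sub>6 ^ d\<close>. The fourth moment lies between the second and the sixth by the
  scaled inequality in the proof, where \<open>s\<close> is the second moment. Only subsets of
  \<open>I\<close> are constrained, because inserting \<open>i\<close> into a set changes its size
  only if \<open>i\<close> is not yet there.\<close>

lemma chaos_moments_le:
  assumes I: "finite I" "I \<subseteq> {1..}" and a: "\<And>S. S \<subseteq> I \<Longrightarrow> card S \<noteq> d \<Longrightarrow> a S = 0"
  shows "expectation (\<lambda>\<omega>. chaos I a \<omega> ^ 6) \<le> (K\<^sub>6 ^ d * (\<Sum>S\<in>Pow I. (a S)\<^sup>2)) ^ 3"
    and "expectation (\<lambda>\<omega>. chaos I a \<omega> ^ 4) \<le> ((K\<^sub>6 ^ d) ^ 3 + 1) / 2 * (\<Sum>S\<in>Pow I. (a S)\<^sup>2)\<^sup>2"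
proof -
  define s where "s = (\<Sum>S\<in>Pow I. (a S)\<^sup>2)"
  have "(\<Sum>S\<in>Pow I. K\<^sub>6 ^ card S * (a S)\<^sup>2) = K\<^sub>6 ^ d * s"
    unfolding s_def sum_distrib_left
  proof (intro sum.cong refl)
    fix S assume "S \<in> Pow I"
    then show "K\<^sub>6 ^ card S * (a S)\<^sup>2 = K\<^sub>6 ^ d * (a S)\<^sup>2"
      using a[of S] by (cases "card S = d") auto
  qed
  then show 6: "expectation (\<lambda>\<omega>. chaos I a \<omega> ^ 6) \<le> (K\<^sub>6 ^ d * (\<Sum>S\<in>Pow I. (a S)\<^sup>2)) ^ 3"
    using sixth_moment_chaos[OF I, of a] by (simp add: s_def)
  have hm: "has_moments M (chaos I a)" by (rule has_moments_chaos[OF I(2)])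
  show "expectation (\<lambda>\<omega>. chaos I a \<omega> ^ 4) \<le> ((K\<^sub>6 ^ d) ^ 3 + 1) / 2 * (\<Sum>S\<in>Pow I. (a S)\<^sup>2)\<^sup>2"
  proof (cases "s = 0")
    case True
    then have "a S = 0" if "S \<in> Pow I" for S
      using I(1) that unfolding s_def by (subst (asm) sum_nonneg_eq_0_iff) auto
    then have "chaos I a \<omega> = 0" for \<omega> by (simp add: chaos_def)
    then show ?thesis using True by (simp add: s_def[symmetric])
  next
    case False
    then have s: "s > 0" unfolding s_def by (simp add: less_le sum_nonneg)
    have "x ^ 4 \<le> (1 / (2 * s)) * x ^ 6 + (s / 2) * x ^ 2" for x :: real
    proof -
      have "0 \<le> x^2 * (x^2 - s)^2 / (2 * s)" using s by simp
      also have "\<dots> = (1 / (2 * s)) * x ^ 6 + (s / 2) * x ^ 2 - x ^ 4"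
        using s by (simp add: field_simps eval_nat_numeral)
      finally show ?thesis by simp
    qed
    then have "expectation (\<lambda>\<omega>. chaos I a \<omega> ^ 4) \<le>
        expectation (\<lambda>\<omega>. (1 / (2 * s)) * chaos I a \<omega> ^ 6 + (s / 2) * chaos I a \<omega> ^ 2)"
      using hm by (intro integral_mono has_moments_integrable has_moments_mult has_moments_power
          has_moments_add has_moments_const) auto
    also have "\<dots> = (1 / (2 * s)) * expectation (\<lambda>\<omega>. chaos I a \<omega> ^ 6) + (s / 2) * s"
      using hm expectation_chaos_sq[OF I, of a]
      by (subst Bochner_Integration.integral_add) (auto simp: has_moments_integrable_power s_def)
    also have "\<dots> \<le> (1 / (2 * s)) * (K\<^sub>6 ^ d * s) ^ 3 + (s / 2) * s"
      using 6 s by (intro add_mono mult_left_mono) (auto simp: s_def)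
    also have "\<dots> = ((K\<^sub>6 ^ d) ^ 3 + 1) / 2 * s\<^sup>2"
      using s by (simp add: field_simps power2_eq_square power3_eq_cube)
    finally show ?thesis by (simp add: s_def)
  qed
qed

lemma chaos_split:
  assumes "finite I" "i \<in> I"
  shows "chaos I a \<omega> = chaos (I - {i}) a \<omega> + P i \<omega> * chaos_grad I a i \<omega>"
proof -
  have "insert i (I - {i}) = I" using assms by auto
  then show ?thesis
    using chaos_insert[of "I - {i}" i a \<omega>] assms by (simp add: chaos_grad_def)
qed

text \<open>Euler's identity for homogeneous polynomials: each monomial is recovered once from each
  of its \<open>q\<close> variables.\<close>

lemma sum_P_chaos_grad:
  assumes I: "finite I" and a: "\<And>S. card S \<noteq> q \<Longrightarrow> a S = 0"
  shows "(\<Sum>i\<in>I. P i \<omega> * chaos_grad I a i \<omega>) = real q * chaos I a \<omega>"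
proof -
  have "(\<Sum>i\<in>I. P i \<omega> * chaos_grad I a i \<omega>) =
      (\<Sum>i\<in>I. \<Sum>S\<in>Pow I. if i \<in> S then a S * (\<Prod>k\<in>S. P k \<omega>) else 0)"
  proof (intro sum.cong refl)
    fix i assume i: "i \<in> I"
    have "P i \<omega> * (\<Prod>k\<in>S - {i}. P k \<omega>) = (\<Prod>k\<in>S. P k \<omega>)" if "S \<in> Pow I" "i \<in> S" for S
      using that I finite_subset[of S I] by (intro prod.remove[symmetric]) auto
    then show "P i \<omega> * chaos_grad I a i \<omega> = (\<Sum>S\<in>Pow I. if i \<in> S then a S * (\<Prod>k\<in>S. P k \<omega>) else 0)"
      unfolding chaos_grad_eq[OF I i] sum_distrib_left by (intro sum.cong refl) auto
  qed
  also have "\<dots> = (\<Sum>S\<in>Pow I. \<Sum>i\<in>I. if i \<in> S then a S * (\<Prod>k\<in>S. P k \<omega>) else 0)"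
    by (rule sum.swap)
  also have "\<dots> = (\<Sum>S\<in>Pow I. real q * (a S * (\<Prod>k\<in>S. P k \<omega>)))"
  proof (intro sum.cong refl)
    fix S assume S: "S \<in> Pow I"
    then have "(\<Sum>i\<in>I. if i \<in> S then a S * (\<Prod>k\<in>S. P k \<omega>) else 0) = real (card S) * (a S * (\<Prod>k\<in>S. P k \<omega>))"
      using I by (subst sum.inter_restrict[symmetric]) (auto simp: Int_absorb1)
    then show "(\<Sum>i\<in>I. if i \<in> S then a S * (\<Prod>k\<in>S. P k \<omega>) else 0) = real q * (a S * (\<Prod>k\<in>S. P k \<omega>))"
      using a[of S] by (cases "card S = q") auto
  qed
  finally show ?thesis by (simp add: chaos_def sum_distrib_left)
qed

end

text \<open>The second moment of \<open>chaos_grad I a i\<close>, that is, the part of the variance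
  carried by the monomials containing \<open>i\<close>.\<close>

definition influence :: "'i set \<Rightarrow> ('i set \<Rightarrow> real) \<Rightarrow> 'i \<Rightarrow> real" where
  "influence I a i = (\<Sum>S\<in>Pow (I - {i}). (a (insert i S))\<^sup>2)"

lemma sum_influence:
  assumes I: "finite I" and a: "\<And>S. card S \<noteq> q \<Longrightarrow> a S = 0"
  shows "(\<Sum>i\<in>I. influence I a i) = real q * (\<Sum>S\<in>Pow I. (a S)\<^sup>2)"
proof -
  have "(\<Sum>i\<in>I. influence I a i) = (\<Sum>i\<in>I. \<Sum>S\<in>Pow I. if i \<in> S then (a S)\<^sup>2 else 0)"
  proof (intro sum.cong refl)
    fix i assume i: "i \<in> I"
    have "(\<Sum>S\<in>Pow I. if i \<in> S then (a S)\<^sup>2 else 0) = (\<Sum>S\<in>{S\<in>Pow I. i \<in> S}. (a S)\<^sup>2)"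
      using I by (intro sum.inter_filter[symmetric]) simp
    also have "\<dots> = influence I a i" unfolding influence_def
      by (rule sum.reindex_bij_witness[where i = "insert i" and j = "\<lambda>S. S - {i}"])
        (use i in \<open>auto simp: insert_absorb\<close>)
    finally show "influence I a i = (\<Sum>S\<in>Pow I. if i \<in> S then (a S)\<^sup>2 else 0)" ..
  qed
  also have "\<dots> = (\<Sum>S\<in>Pow I. \<Sum>i\<in>I. if i \<in> S then (a S)\<^sup>2 else 0)"
    by (rule sum.swap)
  also have "\<dots> = (\<Sum>S\<in>Pow I. real q * (a S)\<^sup>2)"
  proof (intro sum.cong refl)
    fix S assume S: "S \<in> Pow I"
    then have "(\<Sum>i\<in>I. if i \<in> S then (a S)\<^sup>2 else 0) = real (card S) * (a S)\<^sup>2"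
      using I by (subst sum.inter_restrict[symmetric]) (auto simp: Int_absorb1)
    then show "(\<Sum>i\<in>I. if i \<in> S then (a S)\<^sup>2 else 0) = real q * (a S)\<^sup>2"
      using a[of S] by (cases "card S = q") auto
  qed
  finally show ?thesis by (simp add: sum_distrib_left)
qed

text \<open>An influence is the diagonal contraction at \<open>x = x' = {i}\<close>. Singletons are
  among the sets counted by \<open>contr_sum\<close> precisely because
  \<open>q \<ge> 2\<close>.\<close>

lemma sum_influence_sq:
  assumes I: "finite I" and q: "q \<ge> 2"
  shows "(\<Sum>i\<in>I. (influence I a i)\<^sup>2) \<le> contr_sum I q a"
proof -
  have eq: "influence I a i = set_contr I a {i} {i}" if "i \<in> I" for i
  proof -
    have "(\<Sum>y\<in>Pow I. if y \<inter> {i} = {} then (a (insert i y))\<^sup>2 else 0) =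
        (\<Sum>y\<in>{y\<in>Pow I. y \<inter> {i} = {}}. (a (insert i y))\<^sup>2)"
      using I by (intro sum.inter_filter[symmetric]) simp
    also have "{y\<in>Pow I. y \<inter> {i} = {}} = Pow (I - {i})" by auto
    finally show ?thesis
      by (simp add: influence_def set_contr_def power2_eq_square insert_is_Un[symmetric] cong: if_cong)
  qed
  have "(\<Sum>i\<in>I. (influence I a i)\<^sup>2) = (\<Sum>i\<in>I. (set_contr I a {i} {i})\<^sup>2)"
    using eq by simp
  also have "\<dots> \<le> (\<Sum>i\<in>I. \<Sum>x'\<in>Pow I. (set_contr I a {i} x')\<^sup>2)"
    using I by (intro sum_mono member_le_sum) auto
  also have "\<dots> = (\<Sum>x\<in>(\<lambda>i. {i}) ` I. \<Sum>x'\<in>Pow I. (set_contr I a x x')\<^sup>2)"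
    by (subst sum.reindex) auto
  also have "\<dots> \<le> contr_sum I q a"
    unfolding contr_sum_def using I q by (intro sum_mono2) (auto intro!: sum_nonneg)
  finally show ?thesis .
qed

context normalized_poisson
begin

lemma chaos_grad_moments:
  assumes I: "finite I" "I \<subseteq> {1..}" and a: "\<And>S. card S \<noteq> q \<Longrightarrow> a S = 0" and i: "i \<in> I"
  shows "has_moments M (chaos_grad I a i)" "expectation (\<lambda>\<omega>. (chaos_grad I a i \<omega>)\<^sup>2) = influence I a i"
    and "expectation (\<lambda>\<omega>. chaos_grad I a i \<omega> ^ 4) \<le> ((K\<^sub>6 ^ (q - 1)) ^ 3 + 1) / 2 * (influence I a i)\<^sup>2"
proof -
  have I': "finite (I - {i})" "I - {i} \<subseteq> {1..}" using I by auto
  show "has_moments M (chaos_grad I a i)" unfolding chaos_grad_def by (rule has_moments_chaos[OF I'(2)])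
  show "expectation (\<lambda>\<omega>. (chaos_grad I a i \<omega>)\<^sup>2) = influence I a i"
    unfolding chaos_grad_def influence_def by (rule expectation_chaos_sq[OF I'])
  show "expectation (\<lambda>\<omega>. chaos_grad I a i \<omega> ^ 4) \<le> ((K\<^sub>6 ^ (q - 1)) ^ 3 + 1) / 2 * (influence I a i)\<^sup>2"
    unfolding chaos_grad_def influence_def
  proof (rule chaos_moments_le(2)[OF I'])
    fix S assume S: "S \<subseteq> I - {i}" "card S \<noteq> q - 1"
    then have "finite S" "i \<notin> S" using finite_subset[OF S(1) I'(1)] by auto
    then have "card (insert i S) \<noteq> q" using S by auto
    then show "a (insert i S) = 0" by (rule a)
  qed
qed

end

section \<open>The central limit theorem\<close>

text \<open>With this criterion characteristic functions are differentiated by a Taylor bound under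
  the expectation, without interchanging a limit and an integral.\<close>

lemma has_vector_derivative_quadraticI:
  fixes f :: "real \<Rightarrow> 'a::real_normed_vector"
  assumes "\<And>y. norm (f y - f x - (y - x) *\<^sub>R D) \<le> C * (y - x)\<^sup>2"
  shows "(f has_vector_derivative D) (at x within S)"
  unfolding has_vector_derivative_def has_derivative_within
proof
  show "bounded_linear (\<lambda>h. h *\<^sub>R D)" by (rule bounded_linear_scaleR_left)
  have "((\<lambda>y. C * norm (y - x)) \<longlongrightarrow> C * norm (x - x)) (at x within S)"
    by (intro tendsto_intros)
  then have t0: "((\<lambda>y. C * norm (y - x)) \<longlongrightarrow> 0) (at x within S)" by simp
  have le: "norm ((1 / norm (y - x)) *\<^sub>R (f y - (f x + (y - x) *\<^sub>R D))) \<le> C * norm (y - x)" for y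
  proof (cases "y = x")
    case False
    have "norm ((1 / norm (y - x)) *\<^sub>R (f y - (f x + (y - x) *\<^sub>R D))) \<le> (C * (y - x)\<^sup>2) / norm (y - x)"
      using assms[of y] by (simp add: divide_right_mono diff_diff_eq)
    also have "\<dots> = C * norm (y - x)"
    proof -
      define r where "r = norm (y - x)"
      have "r \<noteq> 0" "(y - x)\<^sup>2 = r\<^sup>2" using False by (auto simp: r_def)
      then show ?thesis unfolding r_def[symmetric] by (simp add: power2_eq_square)
    qed
    finally show ?thesis .
  qed simp
  show "((\<lambda>y. (1 / norm (y - x)) *\<^sub>R (f y - (f x + (y - x) *\<^sub>R D))) \<longlongrightarrow> 0) (at x within S)"
    by (rule Lim_null_comparison[OF eventuallyI[OF le] t0])
qed

lemma norm_integral_le: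
  fixes f :: "'a \<Rightarrow> 'b::{banach, second_countable_topology}"
  assumes f: "integrable M f" and g: "integrable M g" and le: "\<And>x. norm (f x) \<le> g x"
  shows "norm (\<integral>x. f x \<partial>M) \<le> (\<integral>x. g x \<partial>M)"
  by (rule order_trans[OF integral_norm_bound])
    (intro integral_mono integrable_norm f g le)

lemma iexp_bounds:
  "cmod (iexp x - 1) \<le> \<bar>x\<bar>" "cmod (iexp x - 1 - \<i> * x) \<le> x\<^sup>2 / 2" "cmod (iexp x) = 1"
  using iexp_approx1[of x 0] iexp_approx1[of x 1]
  by (simp_all add: norm_exp_i_times diff_diff_eq power2_eq_square[symmetric])

lemma iexp_add: "iexp (x + y) = iexp x * iexp y"
  by (simp add: exp_add[symmetric] distrib_left)

section \<open>Characteristic functions of random variables with moments\<close>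

context prob_space
begin

definition char_fun :: "('a \<Rightarrow> real) \<Rightarrow> real \<Rightarrow> complex" where
  "char_fun F t = expectation (\<lambda>\<omega>. iexp (t * F \<omega>))"

lemma integrable_times_iexp:
  fixes Y :: "'a \<Rightarrow> real"
  assumes Y: "integrable M Y" and [measurable]: "F \<in> borel_measurable M"
  shows "integrable M (\<lambda>\<omega>. Y \<omega> * iexp (t * F \<omega>))"
proof (rule Bochner_Integration.integrable_bound[OF Y])
  have [measurable]: "Y \<in> borel_measurable M" using Y by auto
  show "(\<lambda>\<omega>. Y \<omega> * iexp (t * F \<omega>)) \<in> borel_measurable M" by measurable
qed (simp add: norm_mult norm_exp_i_times)

text \<open>The second-order Taylor bound for the exponential, integrated, has a constant given by
  the second moment of \<open>F\<close>.\<close>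

lemma char_fun_vector_derivative:
  assumes F: "has_moments M F"
  shows "(char_fun F has_vector_derivative (\<i> * expectation (\<lambda>\<omega>. F \<omega> * iexp (s * F \<omega>)))) (at s within S)"
proof (rule has_vector_derivative_quadraticI)
  fix y
  have [measurable]: "F \<in> borel_measurable M" using F by auto
  have i1: "integrable M (\<lambda>\<omega>. iexp (t * F \<omega>))" for t
    using integrable_times_iexp[of "\<lambda>_. 1" F t] by simp
  have i2: "integrable M (\<lambda>\<omega>. F \<omega> * iexp (s * F \<omega>))"
    by (intro integrable_times_iexp has_moments_integrable F) measurable
  have "char_fun F y - char_fun F s - (y - s) *\<^sub>R (\<i> * expectation (\<lambda>\<omega>. F \<omega> * iexp (s * F \<omega>))) =
      expectation (\<lambda>\<omega>. iexp (y * F \<omega>) - iexp (s * F \<omega>) - ((y - s) * \<i>) * (F \<omega> * iexp (s * F \<omega>)))"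
    unfolding char_fun_def using i1 i2
    by (simp add: scaleR_conv_of_real mult.assoc)
  also have "cmod \<dots> \<le> expectation (\<lambda>\<omega>. (y - s)\<^sup>2 / 2 * F \<omega> ^ 2)"
  proof (rule norm_integral_le)
    show "integrable M (\<lambda>\<omega>. iexp (y * F \<omega>) - iexp (s * F \<omega>) - ((y - s) * \<i>) * (F \<omega> * iexp (s * F \<omega>)))"
      using i1 i2 by (intro Bochner_Integration.integrable_diff integrable_mult_right)
    show "integrable M (\<lambda>\<omega>. (y - s)\<^sup>2 / 2 * F \<omega> ^ 2)"
      using F by (intro integrable_mult_right has_moments_integrable_power)
    fix \<omega>
    have "iexp (y * F \<omega>) - iexp (s * F \<omega>) - ((y - s) * \<i>) * (F \<omega> * iexp (s * F \<omega>)) =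
        iexp (s * F \<omega>) * (iexp ((y - s) * F \<omega>) - 1 - \<i> * ((y - s) * F \<omega>))"
      using iexp_add[of "s * F \<omega>" "(y - s) * F \<omega>"] by (simp add: algebra_simps)
    then have "cmod (iexp (y * F \<omega>) - iexp (s * F \<omega>) - ((y - s) * \<i>) * (F \<omega> * iexp (s * F \<omega>))) =
        cmod (iexp ((y - s) * F \<omega>) - 1 - \<i> * ((y - s) * F \<omega>))"
      by (simp only: norm_mult iexp_bounds(3) mult_1_left)
    also have "\<dots> \<le> ((y - s) * F \<omega>)\<^sup>2 / 2" using iexp_bounds(2)[of "(y - s) * F \<omega>"] by simp
    finally show "cmod (iexp (y * F \<omega>) - iexp (s * F \<omega>) - ((y - s) * \<i>) * (F \<omega> * iexp (s * F \<omega>)))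
        \<le> (y - s)\<^sup>2 / 2 * F \<omega> ^ 2" by (simp add: power_mult_distrib)
  qed
  also have "\<dots> = expectation (\<lambda>\<omega>. F \<omega> ^ 2) / 2 * (y - s)\<^sup>2" by simp
  finally show "cmod (char_fun F y - char_fun F s - (y - s) *\<^sub>R (\<i> * expectation (\<lambda>\<omega>. F \<omega> * iexp (s * F \<omega>))))
      \<le> expectation (\<lambda>\<omega>. F \<omega> ^ 2) / 2 * (y - s)\<^sup>2" .
qed

text \<open>The function \<open>exp (\<sigma>\<^sup>2 * s\<^sup>2 / 2) * char_fun F s\<close> has small derivative and equals 1 at \<open>s = 0\<close>.\<close>

lemma char_fun_stein_bound:
  assumes F: "has_moments M F"
    and bound: "\<And>s. \<bar>s\<bar> \<le> \<bar>t\<bar> \<Longrightarrow>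
      cmod (expectation (\<lambda>\<omega>. F \<omega> * iexp (s * F \<omega>)) - \<i> * s * v * char_fun F s) \<le> \<delta>"
  shows "cmod (exp (\<sigma>\<^sup>2 * t\<^sup>2 / 2) *\<^sub>R char_fun F t - 1) \<le>
    exp (\<sigma>\<^sup>2 * t\<^sup>2 / 2) * (\<bar>t\<bar> * \<bar>\<sigma>\<^sup>2 - v\<bar> + \<delta>) * \<bar>t\<bar>"
proof -
  define S where "S = {- \<bar>t\<bar> .. \<bar>t\<bar>}"
  define e where "e = (\<lambda>s. expectation (\<lambda>\<omega>. F \<omega> * iexp (s * F \<omega>)))"
  define \<psi> where "\<psi> = (\<lambda>s. exp (\<sigma>\<^sup>2 * s\<^sup>2 / 2) *\<^sub>R char_fun F s)"
  define \<psi>' where "\<psi>' = (\<lambda>s. exp (\<sigma>\<^sup>2 * s\<^sup>2 / 2) *\<^sub>R (\<i> * e s) + (\<sigma>\<^sup>2 * s * exp (\<sigma>\<^sup>2 * s\<^sup>2 / 2)) *\<^sub>R char_fun F s)"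
  have [measurable]: "F \<in> borel_measurable M" using F by auto
  have char_fun_le: "cmod (char_fun F s) \<le> 1" for s
  proof -
    have "cmod (char_fun F s) \<le> expectation (\<lambda>\<omega>. cmod (iexp (s * F \<omega>)))"
      unfolding char_fun_def by (rule integral_norm_bound)
    then show ?thesis by (simp only: iexp_bounds(3)) (simp add: prob_space)
  qed
  have der: "(\<psi> has_vector_derivative \<psi>' s) (at s within S)" for s
  proof -
    have "((\<lambda>s. exp (\<sigma>\<^sup>2 * s\<^sup>2 / 2)) has_field_derivative \<sigma>\<^sup>2 * s * exp (\<sigma>\<^sup>2 * s\<^sup>2 / 2)) (at s within S)"
      by (auto intro!: derivative_eq_intros)
    from has_vector_derivative_scaleR[OF this char_fun_vector_derivative[OF F, of s S]]
    show ?thesis by (simp add: \<psi>_def \<psi>'_def e_def)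
  qed
  have nb: "cmod (\<psi>' s) \<le> exp (\<sigma>\<^sup>2 * t\<^sup>2 / 2) * (\<bar>t\<bar> * \<bar>\<sigma>\<^sup>2 - v\<bar> + \<delta>)" if "s \<in> S" for s
  proof -
    have s: "\<bar>s\<bar> \<le> \<bar>t\<bar>" using that by (auto simp: S_def)
    \<comment> \<open>The part \<open>\<i> * s * v * char_fun F s\<close> of the mean nearly cancels
      the derivative of the Gaussian weight. What is left is the error controlled by
      \<open>bound\<close> and a multiple of \<open>\<sigma>\<^sup>2 - v\<close>.\<close>
    have "\<psi>' s = exp (\<sigma>\<^sup>2 * s\<^sup>2 / 2) *\<^sub>R (\<i> * (e s - \<i> * s * v * char_fun F s) + (s * (\<sigma>\<^sup>2 - v)) *\<^sub>R char_fun F s)"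
      by (simp add: \<psi>'_def scaleR_conv_of_real algebra_simps)
    then have "cmod (\<psi>' s) = exp (\<sigma>\<^sup>2 * s\<^sup>2 / 2) *
        cmod (\<i> * (e s - \<i> * s * v * char_fun F s) + (s * (\<sigma>\<^sup>2 - v)) *\<^sub>R char_fun F s)"
      by simp
    also have "\<dots> \<le> exp (\<sigma>\<^sup>2 * s\<^sup>2 / 2) * (\<delta> + \<bar>t\<bar> * \<bar>\<sigma>\<^sup>2 - v\<bar>)"
    proof (intro mult_left_mono)
      have "cmod ((s * (\<sigma>\<^sup>2 - v)) *\<^sub>R char_fun F s) \<le> \<bar>t\<bar> * \<bar>\<sigma>\<^sup>2 - v\<bar> * 1"
        unfolding norm_scaleR abs_mult using s char_fun_le by (intro mult_mono) auto
      moreover have "cmod (\<i> * (e s - \<i> * s * v * char_fun F s)) \<le> \<delta>"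
        using bound[OF s] by (simp add: norm_mult e_def)
      ultimately show "cmod (\<i> * (e s - \<i> * s * v * char_fun F s) + (s * (\<sigma>\<^sup>2 - v)) *\<^sub>R char_fun F s)
          \<le> \<delta> + \<bar>t\<bar> * \<bar>\<sigma>\<^sup>2 - v\<bar>"
        by (intro norm_triangle_le) linarith
    qed simp
    also have "\<dots> \<le> exp (\<sigma>\<^sup>2 * t\<^sup>2 / 2) * (\<delta> + \<bar>t\<bar> * \<bar>\<sigma>\<^sup>2 - v\<bar>)"
    proof (intro mult_right_mono)
      show "exp (\<sigma>\<^sup>2 * s\<^sup>2 / 2) \<le> exp (\<sigma>\<^sup>2 * t\<^sup>2 / 2)"
        using s by (simp add: mult_left_mono abs_le_square_iff)
      have "0 \<le> \<delta>" using bound[OF s] norm_ge_zero order_trans by blast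
      then show "0 \<le> \<delta> + \<bar>t\<bar> * \<bar>\<sigma>\<^sup>2 - v\<bar>" by simp
    qed
    finally show ?thesis by (simp add: add.commute)
  qed
  have "cmod (\<psi> t - \<psi> 0) \<le> exp (\<sigma>\<^sup>2 * t\<^sup>2 / 2) * (\<bar>t\<bar> * \<bar>\<sigma>\<^sup>2 - v\<bar> + \<delta>) * norm (t - 0)"
  proof (rule differentiable_bound)
    show "convex S" "t \<in> S" "0 \<in> S" by (auto simp: S_def)
    fix s assume s: "s \<in> S"
    show "(\<psi> has_derivative (\<lambda>h. h *\<^sub>R \<psi>' s)) (at s within S)"
      using der[of s] by (simp add: has_vector_derivative_def)
    show "onorm (\<lambda>h. h *\<^sub>R \<psi>' s) \<le> exp (\<sigma>\<^sup>2 * t\<^sup>2 / 2) * (\<bar>t\<bar> * \<bar>\<sigma>\<^sup>2 - v\<bar> + \<delta>)"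
    proof (rule onorm_bound)
      have "0 \<le> cmod (\<psi>' s)" by simp
      then show "0 \<le> exp (\<sigma>\<^sup>2 * t\<^sup>2 / 2) * (\<bar>t\<bar> * \<bar>\<sigma>\<^sup>2 - v\<bar> + \<delta>)" using nb[OF s] by linarith
      fix h :: real
      have "norm (h *\<^sub>R \<psi>' s) = cmod (\<psi>' s) * norm h" by simp
      also have "\<dots> \<le> exp (\<sigma>\<^sup>2 * t\<^sup>2 / 2) * (\<bar>t\<bar> * \<bar>\<sigma>\<^sup>2 - v\<bar> + \<delta>) * norm h"
        using nb[OF s] by (intro mult_right_mono) auto
      finally show "norm (h *\<^sub>R \<psi>' s) \<le> exp (\<sigma>\<^sup>2 * t\<^sup>2 / 2) * (\<bar>t\<bar> * \<bar>\<sigma>\<^sup>2 - v\<bar> + \<delta>) * norm h" .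
    qed
  qed
  moreover have "\<psi> 0 = 1" by (simp add: \<psi>_def char_fun_def prob_space)
  ultimately show ?thesis by (simp add: \<psi>_def)
qed

text \<open>By Fubini an identity may be checked with \<open>V\<close> frozen at each value. This
  carries a one-variable identity over to functions with independent random coefficients.\<close>

lemma expectation_indep_eqI:
  fixes f g :: "'b \<times> 'b \<Rightarrow> complex"
  assumes ind: "indep_var S X T V"
    and [measurable]: "f \<in> borel_measurable (S \<Otimes>\<^sub>M T)" "g \<in> borel_measurable (S \<Otimes>\<^sub>M T)"
    and int: "integrable M (\<lambda>\<omega>. f (X \<omega>, V \<omega>))" "integrable M (\<lambda>\<omega>. g (X \<omega>, V \<omega>))"
    and eq: "\<And>v. v \<in> space T \<Longrightarrow> expectation (\<lambda>\<omega>. f (X \<omega>, v)) = expectation (\<lambda>\<omega>. g (X \<omega>, v))"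
  shows "expectation (\<lambda>\<omega>. f (X \<omega>, V \<omega>)) = expectation (\<lambda>\<omega>. g (X \<omega>, V \<omega>))"
proof -
  have [measurable]: "X \<in> measurable M S" "V \<in> measurable M T"
    and joint: "distr M (S \<Otimes>\<^sub>M T) (\<lambda>\<omega>. (X \<omega>, V \<omega>)) = distr M S X \<Otimes>\<^sub>M distr M T V"
    using ind by (auto simp: indep_var_distribution_eq)
  interpret X: prob_space "distr M S X" by (rule prob_space_distr) measurable
  interpret V: prob_space "distr M T V" by (rule prob_space_distr) measurable
  interpret pair_sigma_finite "distr M S X" "distr M T V" ..
  have *: "expectation (\<lambda>\<omega>. h (X \<omega>, V \<omega>)) =
      (\<integral>v. expectation (\<lambda>\<omega>. h (X \<omega>, v)) \<partial>distr M T V)"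
    if [measurable]: "h \<in> borel_measurable (S \<Otimes>\<^sub>M T)" and i: "integrable M (\<lambda>\<omega>. h (X \<omega>, V \<omega>))"
    for h :: "'b \<times> 'b \<Rightarrow> complex"
  proof -
    have i': "integrable (distr M S X \<Otimes>\<^sub>M distr M T V) (\<lambda>(x, v). h (x, v))"
      unfolding joint[symmetric] using i by (simp add: integrable_distr_eq)
    have "expectation (\<lambda>\<omega>. h (X \<omega>, V \<omega>)) = integral\<^sup>L (distr M (S \<Otimes>\<^sub>M T) (\<lambda>\<omega>. (X \<omega>, V \<omega>))) h"
      by (simp add: integral_distr)
    also have "\<dots> = (\<integral>v. (\<integral>x. h (x, v) \<partial>distr M S X) \<partial>distr M T V)"
      unfolding joint using integral_snd[OF i'] by simp
    also have "\<dots> = (\<integral>v. expectation (\<lambda>\<omega>. h (X \<omega>, v)) \<partial>distr M T V)"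
    proof (intro Bochner_Integration.integral_cong refl)
      fix v assume "v \<in> space (distr M T V)"
      then have [measurable]: "(\<lambda>x. h (x, v)) \<in> borel_measurable S" by simp
      show "(\<integral>x. h (x, v) \<partial>distr M S X) = expectation (\<lambda>\<omega>. h (X \<omega>, v))"
        by (simp add: integral_distr)
    qed
    finally show ?thesis .
  qed
  show ?thesis
    unfolding *[OF assms(2) int(1)] *[OF assms(3) int(2)]
    by (rule Bochner_Integration.integral_cong[OF refl]) (simp add: eq)
qed

end

section \<open>The Stein identity with random coefficients\<close>

context normalized_poisson
begin

text \<open>Freeze \<open>A\<close> and \<open>B\<close> at \<open>a\<close> and \<open>b\<close>
  and apply \<open>P_stein\<close> to the exponential of \<open>t * (a + x * b)\<close>; shifting
  \<open>x\<close> by \<open>\<kappa> i\<close> only multiplies it by a phase independent of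
  \<open>x\<close>.\<close>

lemma P_stein_chaos:
  fixes a b :: "nat set \<Rightarrow> real"
  assumes I: "finite I" "I \<subseteq> {1..}" "i \<ge> 1" "i \<notin> I"
  defines "A \<equiv> chaos I a" and "B \<equiv> chaos I b"
  shows "expectation (\<lambda>\<omega>. (P i \<omega> * B \<omega>) * iexp (t * (A \<omega> + P i \<omega> * B \<omega>))) =
    expectation (\<lambda>\<omega>. (B \<omega> / \<kappa> i) * (iexp (t * (\<kappa> i * B \<omega>)) - 1) * iexp (t * (A \<omega> + P i \<omega> * B \<omega>)))"
proof -
  define f where "f = (\<lambda>((x :: real, _ :: real), (a, b)). complex_of_real (x * b) * iexp (t * (a + x * b)))"
  define g where "g = (\<lambda>((x :: real, _ :: real), (a, b)). complex_of_real (b / \<kappa> i) *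
      (iexp (t * (\<kappa> i * b)) - 1) * iexp (t * (a + x * b)))"
  have hm: "has_moments M A" "has_moments M B" "has_moments M (P i)"
    unfolding A_def B_def using has_moments_chaos[OF I(2)] has_moments_P[OF I(3)] by auto
  have [measurable]: "A \<in> borel_measurable M" "B \<in> borel_measurable M" "P i \<in> borel_measurable M"
    using hm by auto
  \<comment> \<open>The dummy component 0 makes both random variables pairs of reals, since
    \<open>indep_var\<close> relates variables of one type.\<close>
  have ind: "indep_var (borel \<Otimes>\<^sub>M borel) (\<lambda>\<omega>. (P i \<omega>, 0 :: real)) (borel \<Otimes>\<^sub>M borel) (\<lambda>\<omega>. (A \<omega>, B \<omega>))"
  proof -
    have "(\<lambda>x :: real. (x, 0 :: real)) \<in> measurable borel (borel \<Otimes>\<^sub>M borel)"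
      "(\<lambda>x. x) \<in> measurable (borel \<Otimes>\<^sub>M borel) (borel \<Otimes>\<^sub>M borel :: (real \<times> real) measure)"
      by measurable
    from indep_chaos[OF I this, of a b] show ?thesis unfolding A_def B_def .
  qed
  have k: "\<kappa> i > 0" using kappa_pos I(3) by auto
  have "expectation (\<lambda>\<omega>. f ((P i \<omega>, 0), (A \<omega>, B \<omega>))) = expectation (\<lambda>\<omega>. g ((P i \<omega>, 0), (A \<omega>, B \<omega>)))"
  proof (rule expectation_indep_eqI[OF ind])
    show "f \<in> borel_measurable ((borel \<Otimes>\<^sub>M borel) \<Otimes>\<^sub>M borel \<Otimes>\<^sub>M borel)"
      "g \<in> borel_measurable ((borel \<Otimes>\<^sub>M borel) \<Otimes>\<^sub>M borel \<Otimes>\<^sub>M borel)"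
      unfolding f_def g_def split_beta' by measurable
    show "integrable M (\<lambda>\<omega>. f ((P i \<omega>, 0), (A \<omega>, B \<omega>)))"
      unfolding f_def prod.case
      by (intro integrable_times_iexp has_moments_integrable has_moments_mult hm) measurable
    have "integrable M (\<lambda>\<omega>. 2 * \<bar>B \<omega> / \<kappa> i\<bar>)"
      using has_moments_integrable[OF hm(2)] by simp
    then show "integrable M (\<lambda>\<omega>. g ((P i \<omega>, 0), (A \<omega>, B \<omega>)))"
    proof (rule Bochner_Integration.integrable_bound)
      show "(\<lambda>\<omega>. g ((P i \<omega>, 0), A \<omega>, B \<omega>)) \<in> borel_measurable M" unfolding g_def prod.case by measurable
      have "cmod (iexp x - 1) \<le> 2" for x
        using norm_triangle_ineq4[of "iexp x" 1] by (simp add: norm_exp_i_times)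
      then have "\<bar>B \<omega> / \<kappa> i\<bar> * cmod (iexp x - 1) \<le> \<bar>B \<omega> / \<kappa> i\<bar> * 2" for \<omega> x
        by (intro mult_left_mono) auto
      then show "AE \<omega> in M. cmod (g ((P i \<omega>, 0), A \<omega>, B \<omega>)) \<le> norm (2 * \<bar>B \<omega> / \<kappa> i\<bar>)"
        by (intro AE_I2) (simp only: g_def prod.case norm_mult iexp_bounds(3) norm_of_real mult_1_right
            real_norm_def abs_mult abs_idempotent abs_numeral mult.commute[of 2])
    qed
    fix v :: "real \<times> real"
    obtain a b where v: "v = (a, b)" by (cases v)
    define h where "h = (\<lambda>x :: real. iexp (t * (a + x * b)))"
    have [measurable]: "h \<in> borel_measurable borel" unfolding h_def by measurable
    have ih: "integrable M (\<lambda>\<omega>. h (P i \<omega> + c))" for c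
      by (rule integrable_const_bound[of _ 1]) (auto simp: h_def norm_exp_i_times)
    have st: "expectation (\<lambda>\<omega>. P i \<omega> *\<^sub>R h (P i \<omega>)) =
        (1 / \<kappa> i) *\<^sub>R (expectation (\<lambda>\<omega>. h (P i \<omega> + \<kappa> i)) - expectation (\<lambda>\<omega>. h (P i \<omega>)))"
      using P_stein[OF I(3), of h] ih[of 0] ih[of "\<kappa> i"] by simp
    have sh: "h (x + \<kappa> i) = iexp (t * (\<kappa> i * b)) * h x" for x
      unfolding h_def iexp_add[symmetric] by (simp add: algebra_simps)
    have "expectation (\<lambda>\<omega>. f ((P i \<omega>, 0), v)) = expectation (\<lambda>\<omega>. complex_of_real b * (P i \<omega> *\<^sub>R h (P i \<omega>)))"
      by (intro Bochner_Integration.integral_cong) (auto simp: f_def v h_def scaleR_conv_of_real)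
    also have "\<dots> = complex_of_real b * (1 / \<kappa> i) *\<^sub>R
        (iexp (t * (\<kappa> i * b)) * expectation (\<lambda>\<omega>. h (P i \<omega>)) - expectation (\<lambda>\<omega>. h (P i \<omega>)))"
      unfolding integral_mult_right_zero st sh ..
    also have "\<dots> = complex_of_real (b / \<kappa> i) * (iexp (t * (\<kappa> i * b)) - 1) * expectation (\<lambda>\<omega>. h (P i \<omega>))"
      by (simp add: scaleR_conv_of_real algebra_simps)
    also have "\<dots> = expectation (\<lambda>\<omega>. g ((P i \<omega>, 0), v))"
      unfolding integral_mult_right_zero[symmetric]
      by (intro Bochner_Integration.integral_cong) (auto simp: g_def v h_def)
    finally show "expectation (\<lambda>\<omega>. f ((P i \<omega>, 0), v)) = expectation (\<lambda>\<omega>. g ((P i \<omega>, 0), v))" .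
  qed
  then show ?thesis by (simp only: f_def g_def prod.case)
qed

end

context prob_space
begin

lemma expectation_abs_le_sqrt:
  assumes "has_moments M X"
  shows "expectation (\<lambda>\<omega>. \<bar>X \<omega>\<bar>) \<le> sqrt (expectation (\<lambda>\<omega>. (X \<omega>)\<^sup>2))"
proof -
  have i: "integrable M (\<lambda>\<omega>. \<bar>X \<omega>\<bar>)" "integrable M (\<lambda>\<omega>. \<bar>X \<omega>\<bar>\<^sup>2)"
    using has_moments_integrable_abs[OF assms, of 1] has_moments_integrable_abs[OF assms, of 2] by simp_all
  have "(expectation (\<lambda>\<omega>. \<bar>X \<omega>\<bar>))\<^sup>2 \<le> expectation (\<lambda>\<omega>. \<bar>X \<omega>\<bar>\<^sup>2)"
    using variance_eq[OF i] variance_positive[of "\<lambda>\<omega>. \<bar>X \<omega>\<bar>"] by simp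
  then show ?thesis by (intro real_le_rsqrt) simp
qed

end

context normalized_poisson
begin

text \<open>The factor \<open>\<kappa> i\<close> in the error term is essential for \<open>q = 1\<close>, where the coefficients need not be
  small if the parameters \<open>lam i\<close> are unbounded.\<close>

lemma chaos_stein_bound:
  assumes I: "finite I" "I \<subseteq> {1..}" and a: "\<And>S. card S \<noteq> q \<Longrightarrow> a S = 0"
    and q: "q \<ge> 1" and \<theta>: "\<theta> > 0"
  defines "v \<equiv> \<Sum>S\<in>Pow I. (a S)\<^sup>2"
    and "m4 \<equiv> \<Sum>i\<in>I. (\<kappa> i)\<^sup>2 * expectation (\<lambda>\<omega>. chaos_grad I a i \<omega> ^ 4)"
  defines "w \<equiv> expectation (\<lambda>\<omega>. ((\<Sum>i\<in>I. (chaos_grad I a i \<omega>)\<^sup>2) - real q * v)\<^sup>2)"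
  shows "cmod (expectation (\<lambda>\<omega>. chaos I a \<omega> * iexp (s * chaos I a \<omega>)) - \<i> * s * v * char_fun (chaos I a) s)
    \<le> s\<^sup>2 / (4 * real q) * (\<theta> * q * v + m4 / \<theta>) + \<bar>s\<bar> / q * sqrt w"
proof -
  define F where "F = chaos I a"
  define B where "B = chaos_grad I a"
  define e where "e = (\<lambda>\<omega>. iexp (s * F \<omega>))"
  define G where "G = (\<lambda>\<omega>. \<Sum>i\<in>I. (B i \<omega>)\<^sup>2)"
  have k1: "i \<ge> 1" if "i \<in> I" for i using that I by auto
  have hF: "has_moments M F" unfolding F_def by (rule has_moments_chaos[OF I(2)])
  have hB: "has_moments M (B i)" if "i \<in> I" for i
    unfolding B_def by (rule chaos_grad_moments(1)[OF I _ that]) (rule a)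
  have hG: "has_moments M G" unfolding G_def by (intro has_moments_sum has_moments_power hB)
  have [measurable]: "F \<in> borel_measurable M" using hF by auto
  note int_e = integrable_times_iexp[OF _ has_moments_measurable[OF hF], of _ s]
  have iPB: "integrable M (\<lambda>\<omega>. complex_of_real (P i \<omega> * B i \<omega>) * e \<omega>)" if "i \<in> I" for i
    unfolding e_def using hB[OF that] has_moments_P[OF k1[OF that]]
    by (intro int_e has_moments_integrable has_moments_mult)
  have iB2: "integrable M (\<lambda>\<omega>. complex_of_real ((B i \<omega>)\<^sup>2) * e \<omega>)" if "i \<in> I" for i
    unfolding e_def using hB[OF that] by (intro int_e has_moments_integrable has_moments_power)
  \<comment> \<open>By \<open>P_stein_chaos\<close> the first mean contains
    \<open>iexp (s * (\<kappa> i * B i)) - 1\<close> times \<open>B i / \<kappa> i\<close>. Its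
    first-order part is \<open>\<i> * s * (B i)\<^sup>2\<close>, and the Taylor remainder is at most
    \<open>s\<^sup>2 / 2\<close> times \<open>\<kappa> i\<close> times the cubed modulus of
    \<open>B i\<close>.\<close>
  have step: "cmod (expectation (\<lambda>\<omega>. complex_of_real (P i \<omega> * B i \<omega>) * e \<omega>)
      - \<i> * s * expectation (\<lambda>\<omega>. complex_of_real ((B i \<omega>)\<^sup>2) * e \<omega>))
      \<le> s\<^sup>2 / 4 * (\<theta> * influence I a i + (\<kappa> i)\<^sup>2 * expectation (\<lambda>\<omega>. B i \<omega> ^ 4) / \<theta>)" if i: "i \<in> I" for i
  proof -
    have I': "finite (I - {i})" "I - {i} \<subseteq> {1..}" using I by auto
    have k: "\<kappa> i > 0" using kappa_pos k1[OF i] by simp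
    have Fi: "F \<omega> = chaos (I - {i}) a \<omega> + P i \<omega> * B i \<omega>" for \<omega>
      unfolding F_def B_def by (rule chaos_split[OF I(1) i])
    have st: "expectation (\<lambda>\<omega>. complex_of_real (P i \<omega> * B i \<omega>) * e \<omega>) =
        expectation (\<lambda>\<omega>. complex_of_real (B i \<omega> / \<kappa> i) * (iexp (s * (\<kappa> i * B i \<omega>)) - 1) * e \<omega>)"
      unfolding e_def Fi unfolding B_def chaos_grad_def
      using P_stein_chaos[OF I' k1[OF i], where a=a and b="\<lambda>S. a (insert i S)" and t=s] by simp
    have int: "integrable M (\<lambda>\<omega>. complex_of_real (B i \<omega> / \<kappa> i) * (iexp (s * (\<kappa> i * B i \<omega>)) - 1) * e \<omega>)"
    proof (rule Bochner_Integration.integrable_bound)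
      show "integrable M (\<lambda>\<omega>. 2 * \<bar>B i \<omega> / \<kappa> i\<bar>)" using has_moments_integrable[OF hB[OF i]] by simp
      have [measurable]: "B i \<in> borel_measurable M" using hB[OF i] by auto
      show "(\<lambda>\<omega>. complex_of_real (B i \<omega> / \<kappa> i) * (iexp (s * (\<kappa> i * B i \<omega>)) - 1) * e \<omega>) \<in> borel_measurable M"
        unfolding e_def by measurable
      have "cmod (iexp x - 1) \<le> 2" for x
        using norm_triangle_ineq4[of "iexp x" 1] by (simp add: norm_exp_i_times)
      then have "\<bar>B i \<omega> / \<kappa> i\<bar> * cmod (iexp x - 1) \<le> \<bar>B i \<omega> / \<kappa> i\<bar> * 2" for \<omega> x
        by (intro mult_left_mono) auto
      then show "AE \<omega> in M. cmod (complex_of_real (B i \<omega> / \<kappa> i) * (iexp (s * (\<kappa> i * B i \<omega>)) - 1) * e \<omega>)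
          \<le> norm (2 * \<bar>B i \<omega> / \<kappa> i\<bar>)"
        by (intro AE_I2) (simp only: e_def norm_mult iexp_bounds(3) norm_of_real mult_1_right
            real_norm_def abs_mult abs_idempotent abs_numeral mult.commute[of 2])
    qed
    have eq: "expectation (\<lambda>\<omega>. complex_of_real (P i \<omega> * B i \<omega>) * e \<omega>)
      - \<i> * s * expectation (\<lambda>\<omega>. complex_of_real ((B i \<omega>)\<^sup>2) * e \<omega>) =
      expectation (\<lambda>\<omega>. complex_of_real (B i \<omega> / \<kappa> i) * (iexp (s * (\<kappa> i * B i \<omega>)) - 1) * e \<omega>
        - \<i> * s * (complex_of_real ((B i \<omega>)\<^sup>2) * e \<omega>))"
      unfolding st
      by (subst Bochner_Integration.integral_diff[OF int integrable_mult_right[OF iB2[OF i]]])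
        (simp only: integral_mult_right_zero)
    have le: "cmod (expectation (\<lambda>\<omega>. complex_of_real (B i \<omega> / \<kappa> i) * (iexp (s * (\<kappa> i * B i \<omega>)) - 1) * e \<omega>
        - \<i> * s * (complex_of_real ((B i \<omega>)\<^sup>2) * e \<omega>))) \<le> expectation (\<lambda>\<omega>. s\<^sup>2 / 4 * (\<theta> * (B i \<omega>)\<^sup>2 + (\<kappa> i)\<^sup>2 * B i \<omega> ^ 4 / \<theta>))"
    proof (rule norm_integral_le)
      show "integrable M (\<lambda>\<omega>. complex_of_real (B i \<omega> / \<kappa> i) * (iexp (s * (\<kappa> i * B i \<omega>)) - 1) * e \<omega>
        - \<i> * s * (complex_of_real ((B i \<omega>)\<^sup>2) * e \<omega>))"
        by (intro Bochner_Integration.integrable_diff int integrable_mult_right iB2[OF i])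
      show "integrable M (\<lambda>\<omega>. s\<^sup>2 / 4 * (\<theta> * (B i \<omega>)\<^sup>2 + (\<kappa> i)\<^sup>2 * B i \<omega> ^ 4 / \<theta>))"
        using hB[OF i] by (intro has_moments_integrable has_moments_mult has_moments_add
            has_moments_divide has_moments_power has_moments_const)
      fix \<omega>
      define b where "b = B i \<omega>"
      have "complex_of_real (b / \<kappa> i) * (iexp (s * (\<kappa> i * b)) - 1) * e \<omega> - \<i> * s * (complex_of_real (b\<^sup>2) * e \<omega>)
        = complex_of_real (b / \<kappa> i) * (iexp (s * (\<kappa> i * b)) - 1 - \<i> * (s * (\<kappa> i * b))) * e \<omega>"
        using k by (simp add: field_simps power2_eq_square)
      then have "cmod (complex_of_real (b / \<kappa> i) * (iexp (s * (\<kappa> i * b)) - 1) * e \<omega> - \<i> * s * (complex_of_real (b\<^sup>2) * e \<omega>))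
        = \<bar>b / \<kappa> i\<bar> * cmod (iexp (s * (\<kappa> i * b)) - 1 - \<i> * (s * (\<kappa> i * b)))"
        by (simp only: norm_mult e_def iexp_bounds(3) norm_of_real mult_1_right)
      also have "\<dots> \<le> \<bar>b / \<kappa> i\<bar> * ((s * (\<kappa> i * b))\<^sup>2 / 2)"
        using iexp_bounds(2)[of "s * (\<kappa> i * b)"] by (intro mult_left_mono) auto
      also have "\<dots> = s\<^sup>2 / 2 * (\<bar>b\<bar> * (\<kappa> i * b\<^sup>2))"
        using k by (simp add: power_mult_distrib field_simps power2_eq_square)
      \<comment> \<open>The cubic error is divided into a quadratic and a quartic term. The
        parameter \<open>\<theta>\<close> balances them and is chosen only in
        \<open>chaos_clt\<close>.\<close>
      also have "\<dots> \<le> s\<^sup>2 / 2 * ((\<theta> * b\<^sup>2 + (\<kappa> i)\<^sup>2 * b ^ 4 / \<theta>) / 2)"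
      proof (intro mult_left_mono)
        have "0 \<le> (\<theta> * \<bar>b\<bar> - \<kappa> i * b\<^sup>2)\<^sup>2 / (2 * \<theta>)" using \<theta> by simp
        also have "\<dots> = (\<theta> * b\<^sup>2 + (\<kappa> i)\<^sup>2 * b ^ 4 / \<theta>) / 2 - \<bar>b\<bar> * (\<kappa> i * b\<^sup>2)"
          using \<theta> by (simp add: power2_diff power_mult_distrib field_simps power2_eq_square power4_eq_xxxx)
        finally show "\<bar>b\<bar> * (\<kappa> i * b\<^sup>2) \<le> (\<theta> * b\<^sup>2 + (\<kappa> i)\<^sup>2 * b ^ 4 / \<theta>) / 2" by simp
      qed simp
      finally show "cmod (complex_of_real (B i \<omega> / \<kappa> i) * (iexp (s * (\<kappa> i * B i \<omega>)) - 1) * e \<omega>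
          - \<i> * s * (complex_of_real ((B i \<omega>)\<^sup>2) * e \<omega>)) \<le> s\<^sup>2 / 4 * (\<theta> * (B i \<omega>)\<^sup>2 + (\<kappa> i)\<^sup>2 * B i \<omega> ^ 4 / \<theta>)"
        by (simp add: b_def)
    qed
    have "expectation (\<lambda>\<omega>. s\<^sup>2 / 4 * (\<theta> * (B i \<omega>)\<^sup>2 + (\<kappa> i)\<^sup>2 * B i \<omega> ^ 4 / \<theta>)) =
        s\<^sup>2 / 4 * (\<theta> * influence I a i + (\<kappa> i)\<^sup>2 * expectation (\<lambda>\<omega>. B i \<omega> ^ 4) / \<theta>)"
    proof -
      have "expectation (\<lambda>\<omega>. (B i \<omega>)\<^sup>2) = influence I a i"
        unfolding B_def by (rule chaos_grad_moments(2)[OF I _ i]) (rule a)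
      moreover have "integrable M (\<lambda>\<omega>. \<theta> * (B i \<omega>)\<^sup>2)"
        by (intro has_moments_integrable has_moments_mult has_moments_power has_moments_const hB[OF i])
      moreover have "integrable M (\<lambda>\<omega>. (\<kappa> i)\<^sup>2 * B i \<omega> ^ 4 / \<theta>)"
        by (intro has_moments_integrable has_moments_mult has_moments_divide
            has_moments_power has_moments_const hB[OF i])
      ultimately show ?thesis
        by (simp only: integral_mult_right_zero Bochner_Integration.integral_add integral_divide_zero)
    qed
    with le show ?thesis unfolding eq by (simp only:)
  qed
  have sPB: "(\<Sum>i\<in>I. P i \<omega> * B i \<omega>) = real q * F \<omega>" for \<omega>
    unfolding B_def F_def by (rule sum_P_chaos_grad[OF I(1)]) (rule a)
  have EF: "complex_of_real q * expectation (\<lambda>\<omega>. F \<omega> * e \<omega>) =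
      (\<Sum>i\<in>I. expectation (\<lambda>\<omega>. complex_of_real (P i \<omega> * B i \<omega>) * e \<omega>))"
  proof -
    have "(\<Sum>i\<in>I. expectation (\<lambda>\<omega>. complex_of_real (P i \<omega> * B i \<omega>) * e \<omega>)) =
        expectation (\<lambda>\<omega>. \<Sum>i\<in>I. complex_of_real (P i \<omega> * B i \<omega>) * e \<omega>)"
      by (rule Bochner_Integration.integral_sum[OF iPB, symmetric])
    also have "\<dots> = expectation (\<lambda>\<omega>. complex_of_real q * (F \<omega> * e \<omega>))"
      unfolding sum_distrib_right[symmetric] of_real_sum[symmetric] sPB by (simp add: mult.assoc)
    finally show ?thesis by simp
  qed
  have EG: "expectation (\<lambda>\<omega>. G \<omega> * e \<omega>) =
      (\<Sum>i\<in>I. expectation (\<lambda>\<omega>. complex_of_real ((B i \<omega>)\<^sup>2) * e \<omega>))"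
    unfolding G_def of_real_sum sum_distrib_right by (rule Bochner_Integration.integral_sum[OF iB2])
  have part1: "cmod (complex_of_real q * expectation (\<lambda>\<omega>. F \<omega> * e \<omega>) - \<i> * s * expectation (\<lambda>\<omega>. G \<omega> * e \<omega>))
      \<le> s\<^sup>2 / 4 * (\<theta> * (q * v) + m4 / \<theta>)"
  proof -
    have "complex_of_real q * expectation (\<lambda>\<omega>. F \<omega> * e \<omega>) - \<i> * s * expectation (\<lambda>\<omega>. G \<omega> * e \<omega>) =
        (\<Sum>i\<in>I. expectation (\<lambda>\<omega>. complex_of_real (P i \<omega> * B i \<omega>) * e \<omega>)
         - \<i> * s * expectation (\<lambda>\<omega>. complex_of_real ((B i \<omega>)\<^sup>2) * e \<omega>))"
      unfolding EF EG sum_subtractf sum_distrib_left ..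
    also have "cmod \<dots> \<le> (\<Sum>i\<in>I. s\<^sup>2 / 4 * (\<theta> * influence I a i + (\<kappa> i)\<^sup>2 * expectation (\<lambda>\<omega>. B i \<omega> ^ 4) / \<theta>))"
      by (intro sum_norm_le step)
    also have "\<dots> = s\<^sup>2 / 4 * (\<theta> * (\<Sum>i\<in>I. influence I a i) + m4 / \<theta>)"
      unfolding m4_def B_def
      by (simp only: sum_distrib_left sum_divide_distrib sum.distrib[symmetric])
    also have "(\<Sum>i\<in>I. influence I a i) = real q * v"
      unfolding v_def by (rule sum_influence[OF I(1)]) (rule a)
    finally show ?thesis .
  qed
  \<comment> \<open>Replacing \<open>G\<close> by its mean \<open>q * v\<close> costs at most its
    standard deviation.\<close>
  have part2: "cmod (expectation (\<lambda>\<omega>. G \<omega> * e \<omega>) - complex_of_real (q * v) * char_fun F s) \<le> sqrt w"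
  proof -
    have hGv: "has_moments M (\<lambda>\<omega>. G \<omega> - q * v)" by (intro has_moments_diff hG has_moments_const)
    have ie: "integrable M e"
      using int_e[of "\<lambda>_. 1"] by (simp add: e_def)
    have iGe: "integrable M (\<lambda>\<omega>. complex_of_real (G \<omega>) * e \<omega>)"
      unfolding e_def by (intro int_e has_moments_integrable hG)
    have "expectation (\<lambda>\<omega>. G \<omega> * e \<omega>) - complex_of_real (q * v) * char_fun F s =
        expectation (\<lambda>\<omega>. complex_of_real (G \<omega> - q * v) * e \<omega>)"
      unfolding char_fun_def e_def[symmetric] of_real_diff left_diff_distrib
      by (subst Bochner_Integration.integral_diff[OF iGe integrable_mult_right[OF ie]])
        (simp only: integral_mult_right_zero e_def)
    also have "cmod \<dots> \<le> expectation (\<lambda>\<omega>. \<bar>G \<omega> - q * v\<bar>)"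
    proof (rule norm_integral_le)
      show "integrable M (\<lambda>\<omega>. complex_of_real (G \<omega> - q * v) * e \<omega>)"
        unfolding e_def by (intro int_e has_moments_integrable hGv)
      show "integrable M (\<lambda>\<omega>. \<bar>G \<omega> - q * v\<bar>)"
        using has_moments_integrable_abs[OF hGv, of 1] by simp
      show "cmod (complex_of_real (G \<omega> - q * v) * e \<omega>) \<le> \<bar>G \<omega> - q * v\<bar>" for \<omega>
        by (simp only: norm_mult e_def iexp_bounds(3) norm_of_real mult_1_right)
    qed
    also have "\<dots> \<le> sqrt w"
      using expectation_abs_le_sqrt[OF hGv] by (simp add: w_def G_def B_def)
    finally show ?thesis .
  qed
  have q0: "real q > 0" using q by simp
  have "real q * cmod (expectation (\<lambda>\<omega>. F \<omega> * e \<omega>) - \<i> * s * v * char_fun F s) =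
      cmod (complex_of_real q * (expectation (\<lambda>\<omega>. F \<omega> * e \<omega>) - \<i> * s * v * char_fun F s))"
    by (simp add: norm_mult)
  also have "\<dots> = cmod ((complex_of_real q * expectation (\<lambda>\<omega>. F \<omega> * e \<omega>) - \<i> * s * expectation (\<lambda>\<omega>. G \<omega> * e \<omega>))
      + \<i> * s * (expectation (\<lambda>\<omega>. G \<omega> * e \<omega>) - complex_of_real (q * v) * char_fun F s))"
    by (simp add: algebra_simps)
  also have "\<dots> \<le> s\<^sup>2 / 4 * (\<theta> * (q * v) + m4 / \<theta>) + \<bar>s\<bar> * sqrt w"
  proof (intro norm_triangle_mono part1)
    show "cmod (\<i> * s * (expectation (\<lambda>\<omega>. G \<omega> * e \<omega>) - complex_of_real (q * v) * char_fun F s)) \<le> \<bar>s\<bar> * sqrt w"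
      using mult_left_mono[OF part2, of "\<bar>s\<bar>"] by (simp add: norm_mult)
  qed
  finally have "cmod (expectation (\<lambda>\<omega>. F \<omega> * e \<omega>) - \<i> * s * v * char_fun F s) \<le>
      (s\<^sup>2 / 4 * (\<theta> * (q * v) + m4 / \<theta>) + \<bar>s\<bar> * sqrt w) / q"
    using q0 by (simp add: pos_le_divide_eq mult.commute)
  also have "\<dots> = s\<^sup>2 / (4 * real q) * (\<theta> * q * v + m4 / \<theta>) + \<bar>s\<bar> / q * sqrt w"
    using q0 by (simp add: add_divide_distrib mult.assoc)
  finally show ?thesis by (simp add: F_def e_def)
qed

end

section \<open>Convergence of characteristic functions to the normal one\<close>

lemma real_distribution_normal: "\<sigma> > 0 \<Longrightarrow> real_distribution (density lborel (normal_density 0 \<sigma>))"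
  using prob_space_normal_density[of \<sigma> 0]
  by (auto simp: real_distribution_def real_distribution_axioms_def)

lemma char_normal:
  assumes \<sigma>: "\<sigma> > 0"
  shows "char (density lborel (normal_density 0 \<sigma>)) t = exp (- (\<sigma>\<^sup>2 * t\<^sup>2 / 2))"
proof -
  interpret std: real_distribution std_normal_distribution by (rule real_dist_normal_dist)
  have "distributed std_normal_distribution lborel (\<lambda>x. x) std_normal_density"
    by (simp add: distributed_def distr_id2)
  from std.normal_density_affine[OF this, of \<sigma> 0] \<sigma>
  have "distributed std_normal_distribution lborel (\<lambda>x. \<sigma> * x) (normal_density 0 \<sigma>)" by simp
  then have "density lborel (normal_density 0 \<sigma>) = distr std_normal_distribution lborel (\<lambda>x. \<sigma> * x)"
    by (simp add: distributed_distr_eq_density)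
  also have "\<dots> = distr std_normal_distribution borel (\<lambda>x. \<sigma> * x)"
    by (intro distr_cong) auto
  finally have "char (density lborel (normal_density 0 \<sigma>)) t = char std_normal_distribution (t * \<sigma>)"
    by (simp add: char_def integral_distr mult.assoc)
  then show ?thesis
    by (simp add: char_std_normal_distribution power_mult_distrib mult.commute)
qed

context normalized_poisson
begin

text \<open>The quartic sum and the variance are separate hypotheses, since they tend to 0 for
  different reasons when \<open>q = 1\<close> and when \<open>q \<ge> 2\<close>.\<close>

lemma chaos_clt:
  fixes I :: "nat \<Rightarrow> nat set" and a :: "nat \<Rightarrow> nat set \<Rightarrow> real"
  assumes I: "\<And>n. finite (I n)" "\<And>n. I n \<subseteq> {1..}" and a: "\<And>n S. card S \<noteq> q \<Longrightarrow> a n S = 0"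
    and q: "q \<ge> 1" and \<sigma>: "\<sigma> > 0"
  defines "v \<equiv> \<lambda>n. \<Sum>S\<in>Pow (I n). (a n S)\<^sup>2"
    and "m4 \<equiv> \<lambda>n. \<Sum>i\<in>I n. (\<kappa> i)\<^sup>2 * expectation (\<lambda>\<omega>. chaos_grad (I n) (a n) i \<omega> ^ 4)"
  defines "w \<equiv> \<lambda>n. expectation (\<lambda>\<omega>. ((\<Sum>i\<in>I n. (chaos_grad (I n) (a n) i \<omega>)\<^sup>2) - real q * v n)\<^sup>2)"
  assumes v: "v \<longlonglongrightarrow> \<sigma>\<^sup>2" and m4: "m4 \<longlonglongrightarrow> 0" and w: "w \<longlonglongrightarrow> 0"
  shows "weak_conv_m (\<lambda>n. distr M borel (chaos (I n) (a n))) (density lborel (normal_density 0 \<sigma>))"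
proof (rule levy_continuity)
  have hm: "has_moments M (chaos (I n) (a n))" for n by (rule has_moments_chaos[OF I(2)])
  have [measurable]: "chaos (I n) (a n) \<in> borel_measurable M" for n using hm by auto
  show "real_distribution (distr M borel (chaos (I n) (a n)))" for n
    by (rule real_distribution_distr) measurable
  show "real_distribution (density lborel (normal_density 0 \<sigma>))" by (rule real_distribution_normal[OF \<sigma>])
  fix t :: real
  have char: "char (distr M borel (chaos (I n) (a n))) t = char_fun (chaos (I n) (a n)) t" for n
    by (simp add: char_def char_fun_def integral_distr)
  \<comment> \<open>Both \<open>\<theta>\<close> and \<open>m4 / \<theta>\<close> have to vanish in
    the limit: \<open>\<theta> \<ge> sqrt m4\<close> gives
    \<open>m4 / \<theta> \<le> sqrt m4\<close>, and the second summand keeps \<open>\<theta>\<close>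
    positive if \<open>m4\<close> vanishes.\<close>
  define \<theta> where "\<theta> = (\<lambda>n. sqrt (m4 n) + 1 / real (Suc n))"
  define \<delta> where "\<delta> = (\<lambda>n. t\<^sup>2 / (4 * real q) * (\<theta> n * q * v n + m4 n / \<theta> n) + \<bar>t\<bar> / q * sqrt (w n))"
  have m4_nonneg: "m4 n \<ge> 0" for n
    unfolding m4_def by (intro sum_nonneg mult_nonneg_nonneg integral_nonneg_AE) auto
  have \<theta>_pos: "\<theta> n > 0" for n unfolding \<theta>_def using m4_nonneg[of n] by (simp add: add_nonneg_pos)
  have v_nonneg: "v n \<ge> 0" for n unfolding v_def by (intro sum_nonneg) auto
  have w_nonneg: "w n \<ge> 0" for n unfolding w_def by (intro integral_nonneg_AE) auto
  have sq: "(\<lambda>n. sqrt (m4 n)) \<longlonglongrightarrow> 0" "(\<lambda>n. sqrt (w n)) \<longlonglongrightarrow> 0"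
    using tendsto_real_sqrt[OF m4] tendsto_real_sqrt[OF w] by simp_all
  have \<theta>0: "\<theta> \<longlonglongrightarrow> 0"
    unfolding \<theta>_def using tendsto_add[OF sq(1) LIMSEQ_inverse_real_of_nat] by (simp add: inverse_eq_divide)
  have "(\<lambda>n. m4 n / \<theta> n) \<longlonglongrightarrow> 0"
  proof (rule tendsto_sandwich[OF _ _ tendsto_const sq(1)])
    show "\<forall>\<^sub>F n in sequentially. 0 \<le> m4 n / \<theta> n"
      using m4_nonneg \<theta>_pos by (intro always_eventually allI divide_nonneg_pos) auto
    have "m4 n \<le> sqrt (m4 n) * \<theta> n" for n
    proof -
      have "sqrt (m4 n) * sqrt (m4 n) \<le> sqrt (m4 n) * \<theta> n"
        using m4_nonneg[of n] by (intro mult_left_mono) (auto simp: \<theta>_def)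
      then show ?thesis using m4_nonneg[of n] by simp
    qed
    then show "\<forall>\<^sub>F n in sequentially. m4 n / \<theta> n \<le> sqrt (m4 n)"
      using \<theta>_pos by (intro always_eventually allI) (simp add: pos_divide_le_eq)
  qed
  then have "\<delta> \<longlonglongrightarrow> t\<^sup>2 / (4 * real q) * ((0::real) * real q * \<sigma>\<^sup>2 + 0) + \<bar>t\<bar> / q * 0"
    unfolding \<delta>_def by (intro tendsto_intros \<theta>0 v sq)
  then have \<delta>0: "\<delta> \<longlonglongrightarrow> 0" by simp
  have bound: "cmod (exp (\<sigma>\<^sup>2 * t\<^sup>2 / 2) *\<^sub>R char_fun (chaos (I n) (a n)) t - 1) \<le>
      exp (\<sigma>\<^sup>2 * t\<^sup>2 / 2) * (\<bar>t\<bar> * \<bar>\<sigma>\<^sup>2 - v n\<bar> + \<delta> n) * \<bar>t\<bar>" for n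
  proof (rule char_fun_stein_bound[OF hm])
    fix s :: real assume s: "\<bar>s\<bar> \<le> \<bar>t\<bar>"
    have "cmod (expectation (\<lambda>\<omega>. chaos (I n) (a n) \<omega> * iexp (s * chaos (I n) (a n) \<omega>))
        - \<i> * s * v n * char_fun (chaos (I n) (a n)) s)
        \<le> s\<^sup>2 / (4 * real q) * (\<theta> n * q * v n + m4 n / \<theta> n) + \<bar>s\<bar> / q * sqrt (w n)"
      unfolding v_def m4_def w_def by (rule chaos_stein_bound[OF I _ q \<theta>_pos]) (rule a)
    also have "\<dots> \<le> \<delta> n"
      unfolding \<delta>_def using s m4_nonneg[of n] \<theta>_pos[of n] v_nonneg[of n] w_nonneg[of n]
      by (intro add_mono mult_right_mono divide_right_mono) (auto simp: abs_le_square_iff)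
    finally show "cmod (expectation (\<lambda>\<omega>. chaos (I n) (a n) \<omega> * iexp (s * chaos (I n) (a n) \<omega>))
        - \<i> * s * v n * char_fun (chaos (I n) (a n)) s) \<le> \<delta> n" .
  qed
  have "(\<lambda>n. exp (\<sigma>\<^sup>2 * t\<^sup>2 / 2) * (\<bar>t\<bar> * \<bar>\<sigma>\<^sup>2 - v n\<bar> + \<delta> n) * \<bar>t\<bar>) \<longlonglongrightarrow>
      exp (\<sigma>\<^sup>2 * t\<^sup>2 / 2) * (\<bar>t\<bar> * \<bar>\<sigma>\<^sup>2 - \<sigma>\<^sup>2\<bar> + 0) * \<bar>t\<bar>"
    by (intro tendsto_intros v \<delta>0)
  then have "(\<lambda>n. exp (\<sigma>\<^sup>2 * t\<^sup>2 / 2) *\<^sub>R char_fun (chaos (I n) (a n)) t - 1) \<longlonglongrightarrow> 0"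
    by (intro Lim_null_comparison[OF eventuallyI[OF bound]]) simp
  then have "(\<lambda>n. exp (\<sigma>\<^sup>2 * t\<^sup>2 / 2) *\<^sub>R char_fun (chaos (I n) (a n)) t) \<longlonglongrightarrow> 1"
    by (simp add: LIM_zero_iff)
  then have "(\<lambda>n. exp (- (\<sigma>\<^sup>2 * t\<^sup>2 / 2)) *\<^sub>R (exp (\<sigma>\<^sup>2 * t\<^sup>2 / 2) *\<^sub>R char_fun (chaos (I n) (a n)) t))
      \<longlonglongrightarrow> exp (- (\<sigma>\<^sup>2 * t\<^sup>2 / 2)) *\<^sub>R 1"
    by (intro tendsto_intros)
  then show "(\<lambda>n. char (distr M borel (chaos (I n) (a n))) t) \<longlonglongrightarrow> char (density lborel (normal_density 0 \<sigma>)) t"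
    unfolding char char_normal[OF \<sigma>]
    by (simp only: scaleR_scaleR exp_add[symmetric]) (simp add: scaleR_conv_of_real)
qed

end

section \<open>From weak convergence to fourth moments\<close>

lemma normal_fourth_moment:
  assumes "\<sigma> > 0"
  shows "(\<integral>y. y ^ 4 \<partial>density lborel (normal_density 0 \<sigma>)) = 3 * \<sigma> ^ 4"
    and "integrable (density lborel (normal_density 0 \<sigma>)) (\<lambda>y. y ^ 6)"
proof -
  have "(\<integral>y. y ^ 4 \<partial>density lborel (normal_density 0 \<sigma>)) = (\<integral>y. normal_density 0 \<sigma> y * y ^ 4 \<partial>lborel)"
    by (subst integral_density) (auto simp: normal_density_nonneg)
  also have "\<dots> = 3 * \<sigma> ^ 4"
    using integral_normal_moment_even[OF assms, of 0 2] assms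
    by (simp add: fact_numeral power2_eq_square power4_eq_xxxx field_simps)
  finally show "(\<integral>y. y ^ 4 \<partial>density lborel (normal_density 0 \<sigma>)) = 3 * \<sigma> ^ 4" .
  show "integrable (density lborel (normal_density 0 \<sigma>)) (\<lambda>y. y ^ 6)"
    using integrable_normal_moment[OF assms, of 0 6]
    by (subst integrable_density) (auto simp: normal_density_nonneg)
qed

text \<open>A bounded continuous substitute for the fourth power, to which weak convergence applies;
  sixth moments control the difference.\<close>

definition trunc4 :: "real \<Rightarrow> real \<Rightarrow> real" where "trunc4 R x = min (x ^ 4) (R ^ 4)"

lemma trunc4_props:
  assumes "R > 0"
  shows "isCont (trunc4 R) x" "norm (trunc4 R x) \<le> R ^ 4" "\<bar>x ^ 4 - trunc4 R x\<bar> \<le> x ^ 6 / R\<^sup>2"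
proof -
  show "isCont (trunc4 R) x" unfolding trunc4_def by (intro continuous_intros)
  show "norm (trunc4 R x) \<le> R ^ 4" using assms by (auto simp: trunc4_def abs_if min_def)
  show "\<bar>x ^ 4 - trunc4 R x\<bar> \<le> x ^ 6 / R\<^sup>2"
  proof (cases "x ^ 4 \<le> R ^ 4")
    case True
    then show ?thesis by (simp add: trunc4_def)
  next
    case False
    then have "(R\<^sup>2)\<^sup>2 \<le> (x\<^sup>2)\<^sup>2" by simp
    then have "R\<^sup>2 \<le> x\<^sup>2" by (rule power2_le_imp_le) simp
    then have "x ^ 4 * R\<^sup>2 \<le> x ^ 4 * x\<^sup>2" by (intro mult_left_mono) auto
    then have "x ^ 4 \<le> x ^ 6 / R\<^sup>2"
      using assms by (simp add: pos_le_divide_eq flip: power_add)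
    moreover have "0 \<le> R ^ 4" by simp
    moreover have "\<bar>x ^ 4 - trunc4 R x\<bar> = x ^ 4 - R ^ 4" using False by (simp add: trunc4_def)
    ultimately show ?thesis by linarith
  qed
qed

lemma weak_conv_fourth_moment:
  fixes \<mu> :: "nat \<Rightarrow> real measure" and \<nu> :: "real measure"
  assumes \<mu>: "\<And>n. real_distribution (\<mu> n)" and \<nu>: "real_distribution \<nu>" and conv: "weak_conv_m \<mu> \<nu>"
    and int4: "\<And>n. integrable (\<mu> n) (\<lambda>x. x ^ 4)" "integrable \<nu> (\<lambda>x. x ^ 4)"
    and int6: "\<And>n. integrable (\<mu> n) (\<lambda>x. x ^ 6)" "integrable \<nu> (\<lambda>x. x ^ 6)"
    and bound: "\<And>n. (\<integral>x. x ^ 6 \<partial>\<mu> n) \<le> C"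
  shows "(\<lambda>n. \<integral>x. x ^ 4 \<partial>\<mu> n) \<longlonglongrightarrow> (\<integral>x. x ^ 4 \<partial>\<nu>)"
proof (rule LIMSEQ_I)
  fix \<epsilon> :: real assume \<epsilon>: "\<epsilon> > 0"
  \<comment> \<open>All sixth moments in question are at most \<open>D - 1\<close>, so the
    truncation error is strictly below \<open>D / R\<^sup>2\<close>, and \<open>R\<close> is chosen
    to make this quotient \<open>\<epsilon> / 3\<close>.\<close>
  define D where "D = max C (\<integral>x. x ^ 6 \<partial>\<nu>) + 1"
  have "(\<integral>x. x ^ 6 \<partial>\<nu>) \<ge> 0" by (intro integral_nonneg_AE) auto
  then have D: "D > 0"
    using max.cobounded2[of "\<integral>x. x ^ 6 \<partial>\<nu>" C] unfolding D_def by linarith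
  define R where "R = sqrt (3 * D / \<epsilon>)"
  have R: "R > 0" "D / R\<^sup>2 = \<epsilon> / 3" using D \<epsilon> by (auto simp: R_def)
  have tr: "\<bar>(\<integral>x. x ^ 4 \<partial>\<rho>) - (\<integral>x. trunc4 R x \<partial>\<rho>)\<bar> < \<epsilon> / 3"
    if \<rho>: "real_distribution \<rho>" and i4: "integrable \<rho> (\<lambda>x. x ^ 4)" and i6: "integrable \<rho> (\<lambda>x. x ^ 6)"
      and b: "(\<integral>x. x ^ 6 \<partial>\<rho>) \<le> D - 1" for \<rho>
  proof -
    interpret real_distribution \<rho> by (rule \<rho>)
    have "trunc4 R \<in> borel_measurable \<rho>"
      unfolding trunc4_def by simp
    then have it: "integrable \<rho> (trunc4 R)"
      using trunc4_props(2)[OF R(1)] by (intro integrable_const_bound[where B="R ^ 4"]) auto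
    have "\<bar>(\<integral>x. x ^ 4 \<partial>\<rho>) - (\<integral>x. trunc4 R x \<partial>\<rho>)\<bar> = \<bar>\<integral>x. x ^ 4 - trunc4 R x \<partial>\<rho>\<bar>"
      using i4 it by simp
    also have "\<dots> \<le> (\<integral>x. x ^ 6 / R\<^sup>2 \<partial>\<rho>)"
      using norm_integral_le[of \<rho> "\<lambda>x. x ^ 4 - trunc4 R x" "\<lambda>x. x ^ 6 / R\<^sup>2"] i4 it i6
        trunc4_props(3)[OF R(1)] by simp
    also have "\<dots> = (\<integral>x. x ^ 6 \<partial>\<rho>) / R\<^sup>2" by simp
    also have "\<dots> < D / R\<^sup>2" using b R by (intro divide_strict_right_mono) auto
    finally show ?thesis using R by simp
  qed
  have "(\<lambda>n. \<integral>x. trunc4 R x \<partial>\<mu> n) \<longlonglongrightarrow> (\<integral>x. trunc4 R x \<partial>\<nu>)"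
    by (rule weak_conv_imp_integral_bdd_continuous_conv[OF \<mu> \<nu> conv]) (rule trunc4_props[OF R(1)])+
  from LIMSEQ_D[OF this, of "\<epsilon> / 3"] \<epsilon>
  obtain N where N: "\<And>n. n \<ge> N \<Longrightarrow> \<bar>(\<integral>x. trunc4 R x \<partial>\<mu> n) - (\<integral>x. trunc4 R x \<partial>\<nu>)\<bar> < \<epsilon> / 3"
    by auto
  show "\<exists>no. \<forall>n\<ge>no. norm ((\<integral>x. x ^ 4 \<partial>\<mu> n) - (\<integral>x. x ^ 4 \<partial>\<nu>)) < \<epsilon>"
  proof (intro exI allI impI)
    fix n assume "n \<ge> N"
    have "(\<integral>x. x ^ 6 \<partial>\<mu> n) \<le> D - 1" using bound[of n] by (simp add: D_def)
    moreover have "(\<integral>x. x ^ 6 \<partial>\<nu>) \<le> D - 1" by (simp add: D_def)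
    ultimately show "norm ((\<integral>x. x ^ 4 \<partial>\<mu> n) - (\<integral>x. x ^ 4 \<partial>\<nu>)) < \<epsilon>"
      using tr[OF \<mu>[of n] int4(1) int6(1)] tr[OF \<nu> int4(2) int6(2)] N[OF \<open>n \<ge> N\<close>]
      unfolding real_norm_def by linarith
  qed
qed

section \<open>Order one and the equivalences for chaoses\<close>

context normalized_poisson
begin

lemma chaos_grad_order_one:
  assumes I: "finite I" and a: "\<And>S. card S \<noteq> 1 \<Longrightarrow> a S = 0" and i: "i \<in> I"
  shows "chaos_grad I a i \<omega> = a {i}"
proof -
  have "(\<Sum>S\<in>Pow (I - {i}). a (insert i S) * (\<Prod>k\<in>S. P k \<omega>)) =
      (\<Sum>S\<in>Pow (I - {i}). if S = {} then a {i} else 0)"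
  proof (intro sum.cong refl)
    fix S assume S: "S \<in> Pow (I - {i})"
    have fS: "finite S" "i \<notin> S" using S by (auto intro: finite_subset[OF _ I])
    show "a (insert i S) * (\<Prod>k\<in>S. P k \<omega>) = (if S = {} then a {i} else 0)"
      using a[of "insert i S"] fS by (auto simp: card_insert_if)
  qed
  then show ?thesis using I by (simp add: chaos_grad_def chaos_def)
qed

text \<open>Fourth cumulants add up over independent summands, and that of
  \<open>a {i} * P i\<close> is \<open>(\<kappa> i)\<^sup>2 * a {i} ^ 4\<close>. The mean is carried
  through the induction because it multiplies the third moment of the new variable.\<close>

lemma fourth_moment_order_one:
  assumes "finite I" "I \<subseteq> {1..}" and a: "\<And>S. card S \<noteq> 1 \<Longrightarrow> a S = 0"
  shows "expectation (chaos I a) = 0 \<and> expectation (\<lambda>\<omega>. chaos I a \<omega> ^ 4) =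
    3 * (\<Sum>S\<in>Pow I. (a S)\<^sup>2)\<^sup>2 + (\<Sum>i\<in>I. (\<kappa> i)\<^sup>2 * a {i} ^ 4)"
  using assms(1,2)
proof (induction I rule: finite_induct)
  case empty
  then show ?case using a[of "{}"] by (simp add: chaos_def[abs_def])
next
  case (insert i I)
  define A where "A = chaos I a"
  define b where "b = a {i}"
  define v where "v = (\<Sum>S\<in>Pow I. (a S)\<^sup>2)"
  have I: "finite I" "I \<subseteq> {1..}" "i \<ge> 1" "i \<notin> I" using insert by auto
  have hA: "has_moments M A" unfolding A_def by (rule has_moments_chaos[OF I(2)])
  have hP: "has_moments M (P i)" by (rule has_moments_P[OF I(3)])
  have "chaos_grad (insert i I) a i \<omega> = b" for \<omega>
    unfolding b_def by (rule chaos_grad_order_one) (use I a in auto)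
  then have F: "chaos (insert i I) a \<omega> = A \<omega> + P i \<omega> * b" for \<omega>
    using chaos_split[of "insert i I" i a \<omega>] I by (simp add: A_def)
  define E where "E = (\<lambda>m. expectation (\<lambda>\<omega>. A \<omega> ^ m))"
  have E0: "E 0 = 1" by (simp add: E_def prob_space)
  have EE: "expectation (\<lambda>\<omega>. P i \<omega> ^ k * A \<omega> ^ m) = expectation (\<lambda>\<omega>. P i \<omega> ^ k) * E m" for k m
    using expectation_P_chaos[OF I, of k a m a 0] by (simp add: A_def E_def)
  have ints: "integrable M (\<lambda>\<omega>. P i \<omega> ^ k * A \<omega> ^ m)" for k m
    by (intro has_moments_integrable has_moments_mult has_moments_power hA hP)
  have IH: "E 1 = 0" "E 4 = 3 * v\<^sup>2 + (\<Sum>i\<in>I. (\<kappa> i)\<^sup>2 * a {i} ^ 4)"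
    using insert.IH I by (auto simp: E_def A_def v_def)
  have E2: "E 2 = v" unfolding E_def A_def v_def by (rule expectation_chaos_sq[OF I(1,2)])
  have vi: "(\<Sum>S\<in>Pow (insert i I). (a S)\<^sup>2) = v + b\<^sup>2"
  proof -
    have "(\<Sum>S\<in>Pow I. (a (insert i S))\<^sup>2) = (\<Sum>S\<in>Pow I. if S = {} then b\<^sup>2 else 0)"
    proof (intro sum.cong refl)
      fix S assume S: "S \<in> Pow I"
      have fS: "finite S" "i \<notin> S" using S I by (auto intro: finite_subset[OF _ I(1)])
      show "(a (insert i S))\<^sup>2 = (if S = {} then b\<^sup>2 else 0)"
        using a[of "insert i S"] fS by (auto simp: card_insert_if b_def)
    qed
    then show ?thesis using I by (simp add: sum_Pow_insert sum.distrib v_def)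
  qed
  have e1: "expectation (chaos (insert i I) a) = 0"
  proof -
    have "expectation (chaos (insert i I) a) = expectation (\<lambda>\<omega>. P i \<omega> ^ 0 * A \<omega> ^ 1 + b * (P i \<omega> ^ 1 * A \<omega> ^ 0))"
      by (intro Bochner_Integration.integral_cong) (auto simp: F)
    also have "\<dots> = E 1 + b * expectation (P i)"
      using ints[of 0 1] ints[of 1 0] EE[of 0 1] EE[of 1 0] by (simp add: E_def prob_space)
    finally show ?thesis using IH P_moments(1)[OF I(3)] by simp
  qed
  have e4: "expectation (\<lambda>\<omega>. chaos (insert i I) a \<omega> ^ 4) =
      E 4 + 6 * b\<^sup>2 * E 2 + 4 * b ^ 3 * \<kappa> i * E 1 + b ^ 4 * (3 + (\<kappa> i)\<^sup>2)"
  proof -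
    let ?m = "\<lambda>k m \<omega>. P i \<omega> ^ k * A \<omega> ^ m"
    have "expectation (\<lambda>\<omega>. chaos (insert i I) a \<omega> ^ 4) = expectation (\<lambda>\<omega>. ?m 0 4 \<omega> + (4 * b) * ?m 1 3 \<omega>
        + (6 * b\<^sup>2) * ?m 2 2 \<omega> + (4 * b ^ 3) * ?m 3 1 \<omega> + b ^ 4 * ?m 4 0 \<omega>)"
      by (intro Bochner_Integration.integral_cong) (auto simp: F eval_nat_numeral algebra_simps)
    also have "\<dots> = expectation (?m 0 4) + (4 * b) * expectation (?m 1 3)
        + (6 * b\<^sup>2) * expectation (?m 2 2) + (4 * b ^ 3) * expectation (?m 3 1) + b ^ 4 * expectation (?m 4 0)"
      by (simp only: Bochner_Integration.integral_add integral_mult_right_zero ints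
          integrable_mult_right Bochner_Integration.integrable_add)
    also have "\<dots> = E 4 + 6 * b\<^sup>2 * E 2 + 4 * b ^ 3 * \<kappa> i * E 1 + b ^ 4 * (3 + (\<kappa> i)\<^sup>2)"
      using P_moments[OF I(3)] E0 unfolding EE by (simp add: prob_space)
    finally show ?thesis .
  qed
  show ?case
    using e1 e4 IH E2 vi I by (simp add: b_def[symmetric] power2_eq_square power4_eq_xxxx algebra_simps)
qed

text \<open>For \<open>q \<ge> 2\<close> the conditions form a cycle: \<open>clt\<close> gives
  \<open>m4\<close> by uniform integrability, \<open>m4\<close> makes \<open>contr_sum\<close>
  vanish by the cumulant bound, and this gives \<open>clt\<close> back. For \<open>q = 1\<close> the
  exact fourth moment takes the place of the cumulant bound.\<close>

lemma chaos_fourth_moment: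
  fixes I :: "nat \<Rightarrow> nat set" and a :: "nat \<Rightarrow> nat set \<Rightarrow> real"
  assumes I: "\<And>n. finite (I n)" "\<And>n. I n \<subseteq> {1..}" and a: "\<And>n S. card S \<noteq> q \<Longrightarrow> a n S = 0"
    and q: "q \<ge> 1" and \<sigma>: "\<sigma> > 0"
    and v: "(\<lambda>n. \<Sum>S\<in>Pow (I n). (a n S)\<^sup>2) \<longlonglongrightarrow> \<sigma>\<^sup>2"
  defines "N \<equiv> density lborel (\<lambda>y. ennreal (normal_density 0 \<sigma> y))"
  defines "clt \<equiv> weak_conv_m (\<lambda>n. distr M borel (chaos (I n) (a n))) N"
    and "m4 \<equiv> (\<lambda>n. expectation (\<lambda>\<omega>. chaos (I n) (a n) \<omega> ^ 4)) \<longlonglongrightarrow> 3 * \<sigma> ^ 4"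
  shows "clt \<longleftrightarrow> m4"
    and "q \<ge> 2 \<Longrightarrow> m4 \<longleftrightarrow> (\<lambda>n. contr_sum (I n) q (a n)) \<longlonglongrightarrow> 0"
    and "q = 1 \<Longrightarrow> m4 \<longleftrightarrow> (\<lambda>n. \<Sum>i\<in>I n. (\<kappa> i)\<^sup>2 * a n {i} ^ 4) \<longlonglongrightarrow> 0"
proof -
  define V where "V = (\<lambda>n. \<Sum>S\<in>Pow (I n). (a n S)\<^sup>2)"
  let ?F = "\<lambda>n. chaos (I n) (a n)"
  have V: "V \<longlonglongrightarrow> \<sigma>\<^sup>2" using v by (simp add: V_def)
  then have V2: "(\<lambda>n. 3 * (V n)\<^sup>2) \<longlonglongrightarrow> 3 * \<sigma> ^ 4"
    using tendsto_mult[OF tendsto_const[of 3] tendsto_power[OF V, of 2]] by simp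
  have hm: "has_moments M (?F n)" for n by (rule has_moments_chaos[OF I(2)])
  have [measurable]: "?F n \<in> borel_measurable M" for n using hm by auto
  have sup: "\<And>S. S \<subseteq> I n \<Longrightarrow> card S \<noteq> q \<Longrightarrow> a n S = 0" for n using a by blast

  have clt_m4: m4 if clt
  proof -
    \<comment> \<open>Convergent second moments are bounded, so \<open>chaos_moments_le\<close>
      bounds the sixth moments uniformly in \<open>n\<close>.\<close>
    obtain B where B: "\<And>n. V n \<le> B"
      using convergent_imp_Bseq[OF convergentI[OF V]] unfolding Bseq_def real_norm_def
      by (meson abs_le_D1)
    have K: "K\<^sub>6 ^ q \<ge> 0" using K6_ge by simp
    have int: "integrable (distr M borel (?F n)) (\<lambda>x. x ^ k)" for n k
      using has_moments_integrable_power[OF hm] by (simp add: integrable_distr_eq)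
    have m: "(\<integral>x. x ^ k \<partial>distr M borel (?F n)) = expectation (\<lambda>\<omega>. ?F n \<omega> ^ k)" for n k
      by (simp add: integral_distr)
    have i6: "integrable N (\<lambda>y. y ^ 6)" unfolding N_def by (rule normal_fourth_moment(2)[OF \<sigma>])
    interpret N: real_distribution N unfolding N_def by (rule real_distribution_normal[OF \<sigma>])
    have i4: "integrable N (\<lambda>y. y ^ 4)"
    proof (rule Bochner_Integration.integrable_bound)
      show "integrable N (\<lambda>y. 1 + y ^ 6)" using i6 by simp
      have "y ^ 4 \<le> 1 + y ^ 6" for y :: real
      proof (cases "\<bar>y\<bar> \<le> 1")
        case True
        then have "\<bar>y\<bar> ^ 4 \<le> 1" by (intro power_le_one) auto
        then show ?thesis by (simp add: add_increasing2)
      next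
        case False
        then have "\<bar>y\<bar> ^ 4 \<le> \<bar>y\<bar> ^ 6" by (intro power_increasing) auto
        then show ?thesis by (simp add: power_even_abs)
      qed
      moreover have "\<bar>1 + y ^ 6\<bar> = 1 + y ^ 6" for y :: real by (intro abs_of_nonneg add_nonneg_nonneg) auto
      ultimately show "AE y in N. norm (y ^ 4) \<le> norm (1 + y ^ 6)" by (intro AE_I2) (simp add: abs_of_nonneg)
    qed simp
    have "(\<lambda>n. \<integral>x. x ^ 4 \<partial>distr M borel (?F n)) \<longlonglongrightarrow> (\<integral>x. x ^ 4 \<partial>N)"
    proof (rule weak_conv_fourth_moment)
      show "real_distribution (distr M borel (?F n))" for n by (rule real_distribution_distr) measurable
      show "real_distribution N" by (rule N.real_distribution_axioms)
      show "weak_conv_m (\<lambda>n. distr M borel (?F n)) N" using that by (simp add: clt_def)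
      show "(\<integral>x. x ^ 6 \<partial>distr M borel (?F n)) \<le> (K\<^sub>6 ^ q * B) ^ 3" for n
      proof -
        have "expectation (\<lambda>\<omega>. ?F n \<omega> ^ 6) \<le> (K\<^sub>6 ^ q * V n) ^ 3"
          unfolding V_def by (rule chaos_moments_le(1)[OF I sup])
        also have "\<dots> \<le> (K\<^sub>6 ^ q * B) ^ 3"
          using K B by (intro power_mono mult_left_mono mult_nonneg_nonneg) (auto simp: V_def sum_nonneg)
        finally show ?thesis unfolding m .
      qed
    qed (use int i4 i6 in auto)
    then show m4 unfolding m4_def m N_def normal_fourth_moment(1)[OF \<sigma>] .
  qed

  have w: "expectation (\<lambda>\<omega>. ((\<Sum>i\<in>I n. (chaos_grad (I n) (a n) i \<omega>)\<^sup>2) - real q * (\<Sum>S\<in>Pow (I n). (a n S)\<^sup>2))\<^sup>2) \<le>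
    K\<^sub>2 ^ (2 * q) * 4 ^ (2 * q) * (real q)\<^sup>2 * contr_sum (I n) q (a n)" for n
    by (rule sum_chaos_grad_sq_variance[OF I]) (rule a)
  have w_nonneg: "0 \<le> expectation (\<lambda>\<omega>. ((\<Sum>i\<in>I n. (chaos_grad (I n) (a n) i \<omega>)\<^sup>2) - real q * (\<Sum>S\<in>Pow (I n). (a n S)\<^sup>2))\<^sup>2)" for n
    by (intro integral_nonneg_AE) auto

  have m4_off: "(\<lambda>n. contr_sum (I n) q (a n)) \<longlonglongrightarrow> 0" if m4
  proof (rule tendsto_sandwich[OF _ _ tendsto_const])
    show "(\<lambda>n. expectation (\<lambda>\<omega>. ?F n \<omega> ^ 4) - 3 * (V n)\<^sup>2) \<longlonglongrightarrow> 0"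
      using tendsto_diff[OF that[unfolded m4_def] V2] by simp
    have "contr_sum (I n) q (a n) \<le> expectation (\<lambda>\<omega>. ?F n \<omega> ^ 4) - 3 * (V n)\<^sup>2" for n
      unfolding V_def by (rule fourth_cumulant_ge_contr_sum[OF I _ q]) (rule a)
    then show "\<forall>\<^sub>F n in sequentially. contr_sum (I n) q (a n) \<le> expectation (\<lambda>\<omega>. ?F n \<omega> ^ 4) - 3 * (V n)\<^sup>2"
      by simp
  qed (simp add: contr_sum_nonneg)

  have off_w: "(\<lambda>n. expectation (\<lambda>\<omega>. ((\<Sum>i\<in>I n. (chaos_grad (I n) (a n) i \<omega>)\<^sup>2)
      - real q * (\<Sum>S\<in>Pow (I n). (a n S)\<^sup>2))\<^sup>2)) \<longlonglongrightarrow> 0"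
    if off: "(\<lambda>n. contr_sum (I n) q (a n)) \<longlonglongrightarrow> 0"
    by (rule tendsto_sandwich[OF always_eventually[OF allI[OF w_nonneg]] always_eventually[OF allI[OF w]]
          tendsto_const tendsto_mult_right_zero[OF off]])

  have off_clt: clt if q2: "q \<ge> 2" and off: "(\<lambda>n. contr_sum (I n) q (a n)) \<longlonglongrightarrow> 0"
    unfolding clt_def N_def
  proof (rule chaos_clt[OF I a q \<sigma> v _ off_w[OF off]])
    \<comment> \<open>\<open>C\<close> combines the bound \<open>1 / \<alpha>\<close> for
      \<open>(\<kappa> i)\<^sup>2\<close> with the constant from \<open>chaos_grad_moments\<close>;
      the squared influences that remain add up to at most \<open>contr_sum\<close>.\<close>
    define C where "C = 1 / \<alpha> * (((K\<^sub>6 ^ (q - 1)) ^ 3 + 1) / 2)"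
    have C: "C \<ge> 0" using K6_ge alpha_pos by (simp add: C_def)
    have "(\<Sum>i\<in>I n. (\<kappa> i)\<^sup>2 * expectation (\<lambda>\<omega>. chaos_grad (I n) (a n) i \<omega> ^ 4)) \<le> C * contr_sum (I n) q (a n)" for n
    proof -
      have "(\<Sum>i\<in>I n. (\<kappa> i)\<^sup>2 * expectation (\<lambda>\<omega>. chaos_grad (I n) (a n) i \<omega> ^ 4)) \<le>
          (\<Sum>i\<in>I n. 1 / \<alpha> * (((K\<^sub>6 ^ (q - 1)) ^ 3 + 1) / 2 * (influence (I n) (a n) i)\<^sup>2))"
      proof (intro sum_mono mult_mono)
        fix i assume i: "i \<in> I n"
        then have i1: "i \<ge> 1" using I(2) by auto
        show "(\<kappa> i)\<^sup>2 \<le> 1 / \<alpha>"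
          using kappa_sq[OF i1] lam_ge[OF i1] alpha_pos by (simp add: frac_le)
        show "expectation (\<lambda>\<omega>. chaos_grad (I n) (a n) i \<omega> ^ 4) \<le> ((K\<^sub>6 ^ (q - 1)) ^ 3 + 1) / 2 * (influence (I n) (a n) i)\<^sup>2"
          by (rule chaos_grad_moments(3)[OF I _ i]) (rule a)
        show "0 \<le> expectation (\<lambda>\<omega>. chaos_grad (I n) (a n) i \<omega> ^ 4)" by (intro integral_nonneg_AE) auto
      qed (use alpha_pos in auto)
      also have "\<dots> = C * (\<Sum>i\<in>I n. (influence (I n) (a n) i)\<^sup>2)"
        unfolding C_def sum_distrib_left by (simp only: mult.assoc)
      also have "\<dots> \<le> C * contr_sum (I n) q (a n)"
        by (intro mult_left_mono sum_influence_sq[OF I(1) q2] C)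
      finally show ?thesis .
    qed
    then show "(\<lambda>n. \<Sum>i\<in>I n. (\<kappa> i)\<^sup>2 * expectation (\<lambda>\<omega>. chaos_grad (I n) (a n) i \<omega> ^ 4)) \<longlonglongrightarrow> 0"
      by (intro tendsto_sandwich[OF _ _ tendsto_const tendsto_mult_right_zero[OF off, of C]]
          always_eventually allI sum_nonneg mult_nonneg_nonneg integral_nonneg_AE) auto
  qed

  have one_m4: "m4 \<longleftrightarrow> (\<lambda>n. \<Sum>i\<in>I n. (\<kappa> i)\<^sup>2 * a n {i} ^ 4) \<longlonglongrightarrow> 0" if q1: "q = 1"
  proof -
    have a1: "card S \<noteq> 1 \<Longrightarrow> a n S = 0" for n S using a q1 by blast
    have eq: "expectation (\<lambda>\<omega>. ?F n \<omega> ^ 4) = 3 * (V n)\<^sup>2 + (\<Sum>i\<in>I n. (\<kappa> i)\<^sup>2 * a n {i} ^ 4)" for n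
      unfolding V_def by (rule conjunct2[OF fourth_moment_order_one[OF I]]) (rule a1)
    show ?thesis
    proof
      assume m4
      from tendsto_diff[OF this[unfolded m4_def] V2]
      show "(\<lambda>n. \<Sum>i\<in>I n. (\<kappa> i)\<^sup>2 * a n {i} ^ 4) \<longlonglongrightarrow> 0" unfolding eq by simp
    next
      assume "(\<lambda>n. \<Sum>i\<in>I n. (\<kappa> i)\<^sup>2 * a n {i} ^ 4) \<longlonglongrightarrow> 0"
      from tendsto_add[OF V2 this] show m4 unfolding m4_def eq by simp
    qed
  qed

  have one_clt: clt if q1: "q = 1" and z: "(\<lambda>n. \<Sum>i\<in>I n. (\<kappa> i)\<^sup>2 * a n {i} ^ 4) \<longlonglongrightarrow> 0"
    unfolding clt_def N_def
  proof (rule chaos_clt[OF I a q \<sigma> v])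
    have a1: "card S \<noteq> 1 \<Longrightarrow> a n S = 0" for n S using a q1 by blast
    \<comment> \<open>There is no size strictly below 1 and at least 1, so the variance hypothesis
      of \<open>chaos_clt\<close> is automatic for linear polynomials.\<close>
    have "contr_sum (I n) q (a n) = 0" for n
      unfolding contr_sum_def using q1 by (intro sum.neutral) auto
    then show "(\<lambda>n. expectation (\<lambda>\<omega>. ((\<Sum>i\<in>I n. (chaos_grad (I n) (a n) i \<omega>)\<^sup>2)
      - real q * (\<Sum>S\<in>Pow (I n). (a n S)\<^sup>2))\<^sup>2)) \<longlonglongrightarrow> 0" by (intro off_w) simp
    have "chaos_grad (I n) (a n) i \<omega> = a n {i}" if "i \<in> I n" for n i \<omega>
      by (rule chaos_grad_order_one[OF I(1) _ that]) (rule a1)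
    then have "(\<Sum>i\<in>I n. (\<kappa> i)\<^sup>2 * expectation (\<lambda>\<omega>. chaos_grad (I n) (a n) i \<omega> ^ 4)) =
        (\<Sum>i\<in>I n. (\<kappa> i)\<^sup>2 * a n {i} ^ 4)" for n
      by (intro sum.cong refl) (simp add: prob_space)
    then show "(\<lambda>n. \<Sum>i\<in>I n. (\<kappa> i)\<^sup>2 * expectation (\<lambda>\<omega>. chaos_grad (I n) (a n) i \<omega> ^ 4)) \<longlonglongrightarrow> 0"
      using z by simp
  qed

  show "q \<ge> 2 \<Longrightarrow> m4 \<longleftrightarrow> (\<lambda>n. contr_sum (I n) q (a n)) \<longlonglongrightarrow> 0"
    using m4_off off_clt clt_m4 by blast
  show "q = 1 \<Longrightarrow> m4 \<longleftrightarrow> (\<lambda>n. \<Sum>i\<in>I n. (\<kappa> i)\<^sup>2 * a n {i} ^ 4) \<longlonglongrightarrow> 0"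
    by (rule one_m4)
  show "clt \<longleftrightarrow> m4"
  proof (cases "q = 1")
    case True
    then show ?thesis using clt_m4 one_clt one_m4 by blast
  next
    case False
    then have "q \<ge> 2" using q by simp
    then show ?thesis using clt_m4 m4_off off_clt by blast
  qed
qed

end

section \<open>Kernels as functions of sets\<close>

lemma card_inj_extensional:
  assumes "finite S" "card S = m"
  shows "card {i \<in> {..<m} \<rightarrow>\<^sub>E S. i ` {..<m} = S} = fact m"
proof -
  have "{i \<in> {..<m} \<rightarrow>\<^sub>E S. i ` {..<m} = S} = {i \<in> {..<m} \<rightarrow>\<^sub>E S. inj_on i {..<m}}"
  proof (intro Collect_cong conj_cong refl)
    fix i assume i: "i \<in> {..<m} \<rightarrow>\<^sub>E S"
    show "i ` {..<m} = S \<longleftrightarrow> inj_on i {..<m}"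
    proof
      assume "i ` {..<m} = S"
      then show "inj_on i {..<m}" using assms by (intro eq_card_imp_inj_on) auto
    next
      assume "inj_on i {..<m}"
      then have "card (i ` {..<m}) = card S" using assms by (simp add: card_image)
      moreover have "i ` {..<m} \<subseteq> S" using i by auto
      ultimately show "i ` {..<m} = S" using assms(1) by (intro card_subset_eq) auto
    qed
  qed
  then show ?thesis
    using card_inj_on_subset_funcset[of "{..<m}" S "{..<m}"] assms
    by (simp add: fact_prod_rev atLeast0LessThan)
qed

lemma finite_multi_index [simp]: "finite (multi_index m N)"
  unfolding multi_index_def by (intro finite_PiE) auto

text \<open>A tuple with a repeated entry has an image of fewer than \<open>m\<close> elements,
  where \<open>h\<close> vanishes, and each set of size \<open>m\<close> is the image of
  \<open>m!\<close> tuples.\<close>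

lemma sum_multi_index_image:
  fixes h :: "nat set \<Rightarrow> real"
  assumes h: "\<And>S. card S \<noteq> m \<Longrightarrow> h S = 0"
  shows "(\<Sum>i\<in>multi_index m N. h (i ` {..<m})) = fact m * (\<Sum>S\<in>Pow {1..N}. h S)"
proof -
  have "(\<Sum>i\<in>multi_index m N. h (i ` {..<m})) =
      (\<Sum>S\<in>Pow {1..N}. \<Sum>i\<in>{i\<in>multi_index m N. i ` {..<m} = S}. h (i ` {..<m}))"
    by (rule sum.group[symmetric], simp, simp) (auto simp: multi_index_def)
  also have "\<dots> = (\<Sum>S\<in>Pow {1..N}. fact m * h S)"
  proof (intro sum.cong refl)
    fix S assume S: "S \<in> Pow {1..N}"
    show "(\<Sum>i\<in>{i\<in>multi_index m N. i ` {..<m} = S}. h (i ` {..<m})) = fact m * h S"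
    proof (cases "card S = m")
      case True
      have "{i\<in>multi_index m N. i ` {..<m} = S} = {i \<in> {..<m} \<rightarrow>\<^sub>E S. i ` {..<m} = S}"
      proof -
        have "i \<in> multi_index m N \<longleftrightarrow> i \<in> {..<m} \<rightarrow>\<^sub>E S" if im: "i ` {..<m} = S" for i :: "nat \<Rightarrow> nat"
        proof -
          have "i k \<in> S" if "k < m" for k using im that by blast
          moreover have "i k \<in> {1..N}" if "k < m" for k using im that S by blast
          ultimately show ?thesis by (simp add: multi_index_def PiE_iff)
        qed
        then show ?thesis by blast
      qed
      moreover have "finite S" using S by (auto intro: finite_subset)
      ultimately have "card {i\<in>multi_index m N. i ` {..<m} = S} = fact m"
        using card_inj_extensional[OF _ True] by simp
      moreover have "(\<Sum>i\<in>{i\<in>multi_index m N. i ` {..<m} = S}. h (i ` {..<m})) =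
          (\<Sum>i\<in>{i\<in>multi_index m N. i ` {..<m} = S}. h S)" by (intro sum.cong) auto
      ultimately show ?thesis by simp
    next
      case False
      have "(\<Sum>i\<in>{i\<in>multi_index m N. i ` {..<m} = S}. h (i ` {..<m})) = 0"
        using h[OF False] by (intro sum.neutral) auto
      then show ?thesis using h[OF False] by simp
    qed
  qed
  finally show ?thesis by (simp add: sum_distrib_left)
qed

text \<open>The increasing enumeration is a canonical tuple with image \<open>S\<close>. Vanishing
  off sets of size \<open>q\<close> takes over the role of vanishing on diagonals.\<close>

definition set_coeff :: "nat \<Rightarrow> nat \<Rightarrow> ((nat \<Rightarrow> nat) \<Rightarrow> real) \<Rightarrow> nat set \<Rightarrow> real" where
  "set_coeff q N f S = (if card S = q \<and> S \<subseteq> {1..N} then f (\<lambda>k\<in>{..<q}. sorted_list_of_set S ! k) else 0)"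

lemma set_coeff_card: "card S \<noteq> q \<Longrightarrow> set_coeff q N f S = 0"
  by (simp add: set_coeff_def)

text \<open>An injective tuple is a permutation of the increasing one with the same image; for all
  other tuples both sides are 0.\<close>

lemma kernel_eq_set_coeff:
  assumes sym: "symmetric_on q N f" and diag: "vanishes_on_diagonals q N f" and i: "i \<in> multi_index q N"
  shows "f i = set_coeff q N f (i ` {..<q})"
proof (cases "inj_on i {..<q}")
  case False
  then obtain k l where "k < q" "l < q" "k \<noteq> l" "i k = i l" by (auto simp: inj_on_def)
  then have "f i = 0" using diag i unfolding vanishes_on_diagonals_def by blast
  moreover have "card (i ` {..<q}) \<noteq> q"
    using False eq_card_imp_inj_on[of "{..<q}" i] by auto
  ultimately show ?thesis by (simp add: set_coeff_card)
next
  case True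
  define S where "S = i ` {..<q}"
  define e where "e = (\<lambda>k\<in>{..<q}. sorted_list_of_set S ! k)"
  have S: "finite S" "card S = q" "S \<subseteq> {1..N}"
    using True i by (auto simp: S_def card_image multi_index_def)
  have "bij_betw (\<lambda>k. sorted_list_of_set S ! k) {..<length (sorted_list_of_set S)} (set (sorted_list_of_set S))"
    by (rule bij_betw_nth) auto
  then have e: "bij_betw e {..<q} S"
    using S by (subst bij_betw_cong[where g="\<lambda>k. sorted_list_of_set S ! k"]) (auto simp: e_def)
  have ib: "bij_betw i {..<q} S" using True by (auto simp: bij_betw_def S_def)
  \<comment> \<open>Fixing the positions from \<open>q\<close> on makes \<open>\<pi>\<close> a
    permutation of \<open>{..<q}\<close>, and there \<open>i\<close> and \<open>e\<close> are both
    \<open>undefined\<close>, so that \<open>i \<circ> \<pi> = e\<close> holds everywhere.\<close>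
  define \<pi> where "\<pi> = (\<lambda>k. if k < q then inv_into {..<q} i (e k) else k)"
  have "bij_betw (inv_into {..<q} i \<circ> e) {..<q} {..<q}"
    by (rule bij_betw_trans[OF e bij_betw_inv_into[OF ib]])
  then have "bij_betw \<pi> {..<q} {..<q}"
    by (subst bij_betw_cong[where g="inv_into {..<q} i \<circ> e"]) (auto simp: \<pi>_def)
  then have perm: "\<pi> permutes {..<q}" by (rule bij_imp_permutes) (auto simp: \<pi>_def)
  have "i \<circ> \<pi> = e"
  proof
    fix k
    show "(i \<circ> \<pi>) k = e k"
    proof (cases "k < q")
      case True
      then have "e k \<in> S" using e by (auto simp: bij_betw_def)
      then show ?thesis using True ib by (simp add: \<pi>_def bij_betw_inv_into_right)
    next
      case False
      then show ?thesis using i by (auto simp: \<pi>_def e_def multi_index_def PiE_def extensional_def)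
    qed
  qed
  with sym i perm have "f e = f i" unfolding symmetric_on_def by metis
  then show ?thesis using S by (simp add: set_coeff_def e_def S_def[symmetric])
qed

lemma homogeneous_sum_eq_sets:
  assumes "symmetric_on q N f" "vanishes_on_diagonals q N f"
  shows "homogeneous_sum q N f X \<omega> = (\<Sum>S\<in>Pow {1..N}. (fact q * set_coeff q N f S) * (\<Prod>k\<in>S. X k \<omega>))"
proof -
  have "homogeneous_sum q N f X \<omega> =
      (\<Sum>i\<in>multi_index q N. set_coeff q N f (i ` {..<q}) * (\<Prod>k\<in>i ` {..<q}. X k \<omega>))"
    unfolding homogeneous_sum_def
  proof (intro sum.cong refl)
    fix i assume i: "i \<in> multi_index q N"
    show "f i * (\<Prod>k<q. X (i k) \<omega>) = set_coeff q N f (i ` {..<q}) * (\<Prod>k\<in>i ` {..<q}. X k \<omega>)"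
    proof (cases "inj_on i {..<q}")
      case True
      then show ?thesis using kernel_eq_set_coeff[OF assms i] by (simp add: prod.reindex)
    next
      case False
      then have "card (i ` {..<q}) \<noteq> q" using eq_card_imp_inj_on[of "{..<q}" i] by auto
      then show ?thesis using kernel_eq_set_coeff[OF assms i] by (simp add: set_coeff_card)
    qed
  qed
  also have "\<dots> = fact q * (\<Sum>S\<in>Pow {1..N}. set_coeff q N f S * (\<Prod>k\<in>S. X k \<omega>))"
    by (rule sum_multi_index_image) (simp add: set_coeff_card)
  finally show ?thesis by (simp add: sum_distrib_left mult.assoc)
qed

section \<open>Tuples as arguments of contractions\<close>

definition tuple_append :: "nat \<Rightarrow> nat \<Rightarrow> (nat \<Rightarrow> 'a) \<Rightarrow> (nat \<Rightarrow> 'a) \<Rightarrow> nat \<Rightarrow> 'a" where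
  "tuple_append l d z t = (\<lambda>k\<in>{..<l + d}. if k < l then z k else t (k - l))"

lemma lessThan_add_eq: "{..<l + d} = {..<l} \<union> (\<lambda>k. l + k) ` {..<(d::nat)}"
proof -
  have "k \<in> (\<lambda>k. l + k) ` {..<d}" if "l \<le> k" "k < l + d" for k
    using that by (intro image_eqI[of _ _ "k - l"]) auto
  then show ?thesis by (auto simp: not_less) (meson not_less)
qed

lemma prod_lessThan_add:
  fixes l d :: nat
  shows "(\<Prod>k<l + d. h k) = (\<Prod>k<l. h k) * (\<Prod>k<d. h (l + k) :: 'a :: comm_monoid_mult)"
  by (induction d) (simp_all add: mult_ac)

lemma tuple_append_image: "tuple_append l d z t ` {..<l + d} = z ` {..<l} \<union> t ` {..<d}"
proof -
  have "tuple_append l d z t ` {..<l} = z ` {..<l}" by (intro image_cong) (auto simp: tuple_append_def)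
  moreover have "tuple_append l d z t ` (\<lambda>k. l + k) ` {..<d} = t ` {..<d}"
    unfolding image_image by (intro image_cong) (auto simp: tuple_append_def)
  ultimately show ?thesis unfolding lessThan_add_eq image_Un by simp
qed

lemma prod_tuple_append: "(\<Prod>k<l + d. h (tuple_append l d z t k)) = (\<Prod>k<l. h (z k)) * (\<Prod>k<d. h (t k))"
  unfolding prod_lessThan_add by (simp add: tuple_append_def)

lemma tuple_append_multi_index_iff:
  "tuple_append l d z t \<in> multi_index (l + d) N \<longleftrightarrow> (\<forall>k<l. z k \<in> {1..N}) \<and> (\<forall>k<d. t k \<in> {1..N})"
proof -
  have "tuple_append l d z t \<in> extensional {..<l + d}" by (simp add: tuple_append_def)
  then have "tuple_append l d z t \<in> multi_index (l + d) N \<longleftrightarrow> tuple_append l d z t ` {..<l + d} \<subseteq> {1..N}"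
    by (simp add: multi_index_def PiE_iff image_subset_iff)
  then show ?thesis unfolding tuple_append_image by auto
qed

text \<open>Up to factorials, the squared norm of the contraction that leaves \<open>d\<close> free
  variables in each factor.\<close>

definition contr_level :: "nat set \<Rightarrow> nat \<Rightarrow> (nat set \<Rightarrow> real) \<Rightarrow> real" where
  "contr_level I d a = (\<Sum>x\<in>{x\<in>Pow I. card x = d}. \<Sum>x'\<in>Pow I. (set_contr I a x x')\<^sup>2)"

lemma level_nonneg: "contr_level I d a \<ge> 0"
  unfolding contr_level_def by (intro sum_nonneg) auto

lemma contr_sum_eq_levels:
  assumes "finite I"
  shows "contr_sum I q a = (\<Sum>d\<in>{1..<q}. contr_level I d a)"
proof -
  have "(\<Sum>d\<in>{1..<q}. contr_level I d a) =
      (\<Sum>d\<in>{1..<q}. \<Sum>x\<in>{x \<in> {x\<in>Pow I. 1 \<le> card x \<and> card x < q}. card x = d}.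
        \<Sum>x'\<in>Pow I. (set_contr I a x x')\<^sup>2)"
    unfolding contr_level_def by (intro sum.cong) auto
  also have "\<dots> = contr_sum I q a"
    unfolding contr_sum_def using assms by (intro sum.group) auto
  finally show ?thesis ..
qed

text \<open>A union has the required size \<open>l + d\<close> only if the entries of
  \<open>z\<close> are distinct and avoid a set of exactly \<open>d\<close> elements. Repetitions in
  \<open>z\<close>, repetitions in the free variables and overlaps between the two thus all give
  0.\<close>

lemma sum_tuples_contr:
  fixes \<phi> :: "nat set \<Rightarrow> real"
  assumes \<phi>: "\<And>S. card S \<noteq> l + d \<Longrightarrow> \<phi> S = 0"
    and T: "finite T" "finite T'" "card T \<le> d" "card T' \<le> d"
  shows "(\<Sum>z\<in>multi_index l N. \<phi> (z ` {..<l} \<union> T) * \<phi> (z ` {..<l} \<union> T')) =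
    fact l * (if card T = d \<and> card T' = d then set_contr {1..N} \<phi> T T' else 0)"
proof -
  define h where "h = (\<lambda>Z. if card Z = l then \<phi> (Z \<union> T) * \<phi> (Z \<union> T') else 0)"
  have small: "\<phi> (Z \<union> U) = 0" if "card Z + card U < l + d" for Z U
  proof (rule \<phi>)
    show "card (Z \<union> U) \<noteq> l + d" using card_Un_le[of Z U] that by linarith
  qed
  have "(\<Sum>z\<in>multi_index l N. \<phi> (z ` {..<l} \<union> T) * \<phi> (z ` {..<l} \<union> T')) =
      (\<Sum>z\<in>multi_index l N. h (z ` {..<l}))"
  proof (intro sum.cong refl)
    fix z :: "nat \<Rightarrow> nat"
    have "card (z ` {..<l}) \<le> l" using card_image_le[of "{..<l}" z] by simp
    then show "\<phi> (z ` {..<l} \<union> T) * \<phi> (z ` {..<l} \<union> T') = h (z ` {..<l})"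
      using small[of "z ` {..<l}" T] T by (auto simp: h_def)
  qed
  also have "\<dots> = fact l * (\<Sum>Z\<in>Pow {1..N}. h Z)"
    by (rule sum_multi_index_image) (simp add: h_def)
  also have "(\<Sum>Z\<in>Pow {1..N}. h Z) = (if card T = d \<and> card T' = d then set_contr {1..N} \<phi> T T' else 0)"
  proof (cases "card T = d \<and> card T' = d")
    case False
    then have lt: "card T < d \<or> card T' < d" using T by auto
    have "h Z = 0" for Z
      using lt small[of Z T] small[of Z T'] by (auto simp: h_def)
    then show ?thesis unfolding if_not_P[OF False] by simp
  next
    case True
    have "h Z = (if Z \<inter> (T \<union> T') = {} then \<phi> (T \<union> Z) * \<phi> (T' \<union> Z) else 0)" if Z: "Z \<in> Pow {1..N}" for Z
    proof -
      have fZ: "finite Z" using Z by (auto intro: finite_subset)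
      show ?thesis
      proof (cases "Z \<inter> (T \<union> T') = {}")
        case disj: True
        then have "card (T \<union> Z) = d + card Z" using T True fZ by (subst card_Un_disjoint) auto
        then have "card Z \<noteq> l \<Longrightarrow> \<phi> (T \<union> Z) = 0" by (intro \<phi>) simp
        then show ?thesis using disj by (auto simp: h_def Un_commute)
      next
        case False
        then have "Z \<inter> T \<noteq> {} \<or> Z \<inter> T' \<noteq> {}" by blast
        moreover have "\<phi> (Z \<union> U) = 0" if "Z \<inter> U \<noteq> {}" "finite U" "card U = d" "card Z = l" for U
        proof (rule \<phi>)
          have "card (Z \<inter> U) > 0" using that fZ by (simp add: card_gt_0_iff)
          then show "card (Z \<union> U) \<noteq> l + d"
            using card_Un_Int[OF fZ that(2)] that by linarith
        qed
        ultimately show ?thesis using False True T by (auto simp: h_def)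
      qed
    qed
    then show ?thesis using True by (simp add: set_contr_def)
  qed
  finally show ?thesis .
qed

definition left_arg :: "nat \<Rightarrow> (nat \<Rightarrow> 'a) \<Rightarrow> nat \<Rightarrow> 'a" where
  "left_arg d y = (\<lambda>k\<in>{..<d}. y k)"

text \<open>The arguments of a contraction are \<open>e = r - l\<close> variables \<open>\<gamma>\<close>, shared by both factors, followed by \<open>c = q - r\<close>
  variables \<open>t\<close> of the first factor and \<open>c\<close> variables \<open>s\<close> of the second one.\<close>

definition right_arg :: "nat \<Rightarrow> nat \<Rightarrow> (nat \<Rightarrow> 'a) \<Rightarrow> nat \<Rightarrow> 'a" where
  "right_arg e c y = (\<lambda>k\<in>{..<e + c}. if k < e then y k else y (e + c + (k - e)))"

lemma args_multi_index:
  assumes "y \<in> multi_index (e + c + c) N"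
  shows "left_arg (e + c) y \<in> multi_index (e + c) N" "right_arg e c y \<in> multi_index (e + c) N"
  using assms by (auto simp: multi_index_def left_arg_def right_arg_def PiE_iff)

text \<open>The left argument contains the shared variables and those of the first factor, the right
  one supplies the rest. For \<open>e = 0\<close> all pairs arise, see
  \<open>image_args_diag\<close>, and norms are exact; for general \<open>e\<close> injectivity
  yields an upper bound.\<close>

lemma inj_on_args:
  "inj_on (\<lambda>y. (left_arg (e + c) y, right_arg e c y)) (multi_index (e + c + c) N)"
proof (rule inj_onI, rule ext)
  fix y y' k
  assume y: "y \<in> multi_index (e + c + c) N" "y' \<in> multi_index (e + c + c) N"
    and eq: "(left_arg (e + c) y, right_arg e c y) = (left_arg (e + c) y', right_arg e c y')"
  consider "k < e + c" | "e + c \<le> k" "k < e + c + c" | "e + c + c \<le> k" by linarith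
  then show "y k = y' k"
  proof cases
    case 1
    then have "left_arg (e + c) y k = y k" "left_arg (e + c) y' k = y' k" by (auto simp: left_arg_def)
    then show ?thesis using eq by simp
  next
    case 2
    then have "right_arg e c y (e + (k - (e + c))) = y k" "right_arg e c y' (e + (k - (e + c))) = y' k"
      by (auto simp: right_arg_def)
    then show ?thesis using eq by simp
  next
    case 3
    then show ?thesis using y by (simp add: multi_index_def PiE_iff extensional_def)
  qed
qed

lemma image_args_diag:
  "(\<lambda>y. (left_arg d y, right_arg 0 d y)) ` multi_index (d + d) N = multi_index d N \<times> multi_index d N"
proof
  show "(\<lambda>y. (left_arg d y, right_arg 0 d y)) ` multi_index (d + d) N \<subseteq> multi_index d N \<times> multi_index d N"
    using args_multi_index[of _ 0 d N] by auto
  show "multi_index d N \<times> multi_index d N \<subseteq> (\<lambda>y. (left_arg d y, right_arg 0 d y)) ` multi_index (d + d) N"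
  proof clarify
    fix t t' assume t: "t \<in> multi_index d N" "t' \<in> multi_index d N"
    have "left_arg d (tuple_append d d t t') = t" "right_arg 0 d (tuple_append d d t t') = t'"
      using t by (auto simp: fun_eq_iff left_arg_def right_arg_def tuple_append_def multi_index_def PiE_iff extensional_def)
    moreover have "tuple_append d d t t' \<in> multi_index (d + d) N"
      unfolding tuple_append_multi_index_iff using t by (auto simp: multi_index_def PiE_iff)
    ultimately show "(t, t') \<in> (\<lambda>y. (left_arg d y, right_arg 0 d y)) ` multi_index (d + d) N"
      by (metis (mono_tags, lifting) image_eqI)
  qed
qed

lemma prod_right_arg:
  "(\<Prod>k<e + c. h (right_arg e c y k)) = (\<Prod>k<e. h (y k)) * (\<Prod>k<c. h (y (e + c + k)) :: real)"
  unfolding prod_lessThan_add by (simp add: right_arg_def)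

text \<open>A contraction as a function of its free tuples, up to normalization; repeated entries
  give 0.\<close>

definition tuple_form :: "nat \<Rightarrow> nat \<Rightarrow> (nat set \<Rightarrow> real) \<Rightarrow> (nat \<Rightarrow> nat) \<Rightarrow> (nat \<Rightarrow> nat) \<Rightarrow> real" where
  "tuple_form N d \<phi> t t' = (if card (t ` {..<d}) = d \<and> card (t' ` {..<d}) = d
     then set_contr {1..N} \<phi> (t ` {..<d}) (t' ` {..<d}) else 0)"

text \<open>Count each tuple through its image, once per argument. The size of the second set is
  then no restriction, since by \<open>contr_nonzero\<close> it equals that of the first wherever
  the contraction is nonzero.\<close>

lemma sum_tuple_form:
  assumes \<phi>: "\<And>S. card S \<noteq> q \<Longrightarrow> \<phi> S = 0"
  shows "(\<Sum>t\<in>multi_index d N. \<Sum>t'\<in>multi_index d N. (tuple_form N d \<phi> t t')\<^sup>2) =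
    (fact d)\<^sup>2 * contr_level {1..N} d \<phi>"
proof -
  define h where "h = (\<lambda>X X'. if card X = d \<and> card X' = d then (set_contr {1..N} \<phi> X X')\<^sup>2 else 0)"
  have "(\<Sum>t\<in>multi_index d N. \<Sum>t'\<in>multi_index d N. (tuple_form N d \<phi> t t')\<^sup>2) =
      (\<Sum>t\<in>multi_index d N. \<Sum>t'\<in>multi_index d N. h (t ` {..<d}) (t' ` {..<d}))"
    by (intro sum.cong refl) (simp add: h_def tuple_form_def)
  also have "\<dots> = (\<Sum>t\<in>multi_index d N. fact d * (\<Sum>X'\<in>Pow {1..N}. h (t ` {..<d}) X'))"
    by (intro sum.cong refl sum_multi_index_image) (simp add: h_def)
  also have "\<dots> = fact d * (\<Sum>X\<in>Pow {1..N}. fact d * (\<Sum>X'\<in>Pow {1..N}. h X X'))"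
    by (rule sum_multi_index_image) (simp add: h_def)
  also have "\<dots> = (fact d)\<^sup>2 * (\<Sum>X\<in>Pow {1..N}. \<Sum>X'\<in>Pow {1..N}. h X X')"
    by (simp add: sum_distrib_left power2_eq_square mult.assoc)
  also have "(\<Sum>X\<in>Pow {1..N}. \<Sum>X'\<in>Pow {1..N}. h X X') =
      (\<Sum>X\<in>Pow {1..N}. if card X = d then \<Sum>X'\<in>Pow {1..N}. (set_contr {1..N} \<phi> X X')\<^sup>2 else 0)"
  proof (intro sum.cong refl)
    fix X assume X: "X \<in> Pow {1..N}"
    show "(\<Sum>X'\<in>Pow {1..N}. h X X') =
        (if card X = d then \<Sum>X'\<in>Pow {1..N}. (set_contr {1..N} \<phi> X X')\<^sup>2 else 0)"
    proof (cases "card X = d")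
      case True
      have "h X X' = (set_contr {1..N} \<phi> X X')\<^sup>2" if "X' \<in> Pow {1..N}" for X'
      proof (cases "set_contr {1..N} \<phi> X X' = 0")
        case False
        have "card X' = card X"
          by (rule contr_nonzero(1)[OF _ _ _ _ False, of q]) (use X that \<phi> in auto)
        then show ?thesis using True by (simp add: h_def)
      qed (simp add: h_def)
      then show ?thesis using True by simp
    qed (simp add: h_def)
  qed
  also have "\<dots> = contr_level {1..N} d \<phi>"
    unfolding contr_level_def by (rule sum.inter_filter[symmetric]) simp
  finally show ?thesis .
qed

section \<open>Norms of star contractions\<close>

locale disjoint_cells = sigma_finite_measure \<mu> for \<mu> :: "'z measure" +
  fixes A :: "nat \<Rightarrow> 'z set" and lam :: "nat \<Rightarrow> real"
  assumes cell_pos: "\<And>i. i \<ge> 1 \<Longrightarrow> lam i > 0"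
    and A_sets: "\<And>i. i \<ge> 1 \<Longrightarrow> A i \<in> sets \<mu>"
    and A_disjoint: "disjoint_family_on A {1..}"
    and A_measure: "\<And>i. i \<ge> 1 \<Longrightarrow> emeasure \<mu> (A i) = ennreal (lam i)"
begin

text \<open>The number of the cell containing \<open>z\<close>, with \<open>0\<close> for points outside the first \<open>N\<close> cells.\<close>

definition cell_index :: "nat \<Rightarrow> 'z \<Rightarrow> nat" where
  "cell_index N z = (if \<exists>i\<in>{1..N}. z \<in> A i then THE i. i \<in> {1..N} \<and> z \<in> A i else 0)"

definition cell_indices :: "nat \<Rightarrow> nat \<Rightarrow> (nat \<Rightarrow> 'z) \<Rightarrow> nat \<Rightarrow> nat" where
  "cell_indices N m x = (\<lambda>k\<in>{..<m}. cell_index N (x k))"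

lemma cell_index_eq_iff:
  assumes "i \<in> {1..N}"
  shows "cell_index N z = i \<longleftrightarrow> z \<in> A i"
proof -
  have uniq: "j = i" if "j \<in> {1..N}" "z \<in> A j" "i \<in> {1..N}" "z \<in> A i" for i j
    using A_disjoint that unfolding disjoint_family_on_def by (metis IntI atLeastAtMost_iff atLeast_iff emptyE)
  have the: "(THE i. i \<in> {1..N} \<and> z \<in> A i) = j" if "j \<in> {1..N}" "z \<in> A j" for j
    by (rule the_equality) (use that uniq in blast)+
  show ?thesis
  proof
    assume "cell_index N z = i"
    then have "\<exists>j\<in>{1..N}. z \<in> A j" using assms by (auto simp: cell_index_def split: if_splits)
    then obtain j where "j \<in> {1..N}" "z \<in> A j" by blast
    then show "z \<in> A i" using the[of j] \<open>cell_index N z = i\<close> by (auto simp: cell_index_def)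
  next
    assume "z \<in> A i"
    then show "cell_index N z = i" using assms the[of i] by (auto simp: cell_index_def)
  qed
qed

lemma cell_indices_eq_iff:
  assumes "i \<in> multi_index m N"
  shows "cell_indices N m x = i \<longleftrightarrow> (\<forall>k<m. x k \<in> A (i k))"
proof -
  have "cell_indices N m x = i \<longleftrightarrow> (\<forall>k<m. cell_index N (x k) = i k)"
    using assms by (auto simp: cell_indices_def multi_index_def fun_eq_iff PiE_iff extensional_def)
  moreover have "i k \<in> {1..N}" if "k < m" for k
    using assms that by (auto simp: multi_index_def PiE_iff)
  ultimately show ?thesis using cell_index_eq_iff by simp
qed

lemma cell_indices_extensional: "cell_indices N m x \<in> extensional {..<m}"
  by (simp add: cell_indices_def)

lemma not_multi_index:
  "i \<in> extensional {..<m} \<Longrightarrow> i \<notin> multi_index m N \<Longrightarrow> \<exists>k<m. i k \<notin> {1..N}"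
  by (auto simp: multi_index_def PiE_iff)

sublocale cells: product_sigma_finite "\<lambda>_ :: nat. \<mu>" ..

text \<open>Functions of the cell indices are constant on products of cells. As \<open>H\<close>
  vanishes on tuples outside the index range, points outside the first \<open>N\<close> cells
  contribute nothing, and integrals over powers of \<open>\<mu>\<close> become finite sums weighted
  by products of \<open>lam\<close>.\<close>

lemma step_eq:
  assumes H: "\<And>i. i \<in> extensional {..<m} \<Longrightarrow> i \<notin> multi_index m N \<Longrightarrow> H i = 0"
    and x: "x \<in> space (power_measure m \<mu>)"
  shows "H (cell_indices N m x) = (\<Sum>i\<in>multi_index m N. indicator (PiE {..<m} (\<lambda>k. A (i k))) x * H i :: real)"
proof -
  have "(\<Sum>i\<in>multi_index m N. indicator (PiE {..<m} (\<lambda>k. A (i k))) x * H i) =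
      (\<Sum>i\<in>multi_index m N. if cell_indices N m x = i then H i else 0)"
    using x by (intro sum.cong refl)
      (auto simp: cell_indices_eq_iff indicator_def space_PiM PiE_iff)
  also have "\<dots> = H (cell_indices N m x)"
    using H[OF cell_indices_extensional] by simp
  finally show ?thesis ..
qed

lemma has_bochner_integral_step:
  assumes H: "\<And>i. i \<in> extensional {..<m} \<Longrightarrow> i \<notin> multi_index m N \<Longrightarrow> H i = 0"
  shows "has_bochner_integral (power_measure m \<mu>) (\<lambda>x. H (cell_indices N m x))
    (\<Sum>i\<in>multi_index m N. (\<Prod>k<m. lam (i k)) * H i)"
proof -
  have "has_bochner_integral (power_measure m \<mu>)
      (\<lambda>x. \<Sum>i\<in>multi_index m N. indicator (PiE {..<m} (\<lambda>k. A (i k))) x * H i)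
      (\<Sum>i\<in>multi_index m N. (\<Prod>k<m. lam (i k)) * H i)"
  proof (intro has_bochner_integral_sum has_bochner_integral_mult_left)
    fix i assume i: "i \<in> multi_index m N"
    have i1: "i k \<ge> 1" if "k < m" for k using i that by (auto simp: multi_index_def PiE_iff)
    have A: "A (i k) \<in> sets \<mu>" if "k \<in> {..<m}" for k using A_sets i1 that by auto
    have S: "PiE {..<m} (\<lambda>k. A (i k)) \<in> sets (power_measure m \<mu>)"
      using A by (intro sets_PiM_I_finite) auto
    have lp: "lam (i k) \<ge> 0" if "k \<in> {..<m}" for k using cell_pos[OF i1] that by (auto intro: less_imp_le)
    have "emeasure (power_measure m \<mu>) (PiE {..<m} (\<lambda>k. A (i k))) = (\<Prod>k<m. emeasure \<mu> (A (i k)))"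
      using A by (intro cells.emeasure_PiM) auto
    also have "\<dots> = (\<Prod>k<m. ennreal (lam (i k)))" using i1 by (intro prod.cong) (auto simp: A_measure)
    also have "\<dots> = ennreal (\<Prod>k<m. lam (i k))" using lp by (intro prod_ennreal) auto
    finally have e: "emeasure (power_measure m \<mu>) (PiE {..<m} (\<lambda>k. A (i k))) = ennreal (\<Prod>k<m. lam (i k))" .
    have "has_bochner_integral (power_measure m \<mu>) (\<lambda>x. indicator (PiE {..<m} (\<lambda>k. A (i k))) x *\<^sub>R (1::real))
        (measure (power_measure m \<mu>) (PiE {..<m} (\<lambda>k. A (i k))) *\<^sub>R 1)"
      by (rule has_bochner_integral_indicator[OF S]) (simp add: e)
    moreover have "measure (power_measure m \<mu>) (PiE {..<m} (\<lambda>k. A (i k))) = (\<Prod>k<m. lam (i k))"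
      unfolding measure_def e by (intro enn2real_ennreal prod_nonneg ballI lp)
    ultimately show "has_bochner_integral (power_measure m \<mu>)
        (indicator (PiE {..<m} (\<lambda>k. A (i k)))) (\<Prod>k<m. lam (i k))" by simp
  qed
  then show ?thesis
    by (rule has_bochner_integral_cong[THEN iffD1, OF refl _ refl, rotated]) (rule step_eq[OF H, symmetric])
qed

lemma L2_norm_step:
  assumes H: "\<And>i. i \<in> extensional {..<m} \<Longrightarrow> i \<notin> multi_index m N \<Longrightarrow> H i = 0"
  shows "L2_norm (power_measure m \<mu>) (\<lambda>x. H (cell_indices N m x)) =
    ennreal (sqrt (\<Sum>i\<in>multi_index m N. (\<Prod>k<m. lam (i k)) * (H i)\<^sup>2))"
proof -
  have H2: "(H i)\<^sup>2 = 0" if "i \<in> extensional {..<m}" "i \<notin> multi_index m N" for i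
    using H[OF that] by simp
  note b = has_bochner_integral_step[where H="\<lambda>i. (H i)\<^sup>2", OF H2]
  have "(\<integral>\<^sup>+x. ennreal ((H (cell_indices N m x))\<^sup>2) \<partial>power_measure m \<mu>) =
      ennreal (\<Sum>i\<in>multi_index m N. (\<Prod>k<m. lam (i k)) * (H i)\<^sup>2)"
    using has_bochner_integral_integral_eq[OF b] nn_integral_eq_integral[OF integrable.intros[OF b]] by simp
  moreover have "(\<Sum>i\<in>multi_index m N. (\<Prod>k<m. lam (i k)) * (H i)\<^sup>2) \<ge> 0"
    by (intro sum_nonneg mult_nonneg_nonneg prod_nonneg)
      (auto simp: multi_index_def PiE_iff intro!: less_imp_le[OF cell_pos])
  ultimately show ?thesis by (simp add: L2_norm_def Let_def)
qed

definition cell_kernel :: "nat \<Rightarrow> nat \<Rightarrow> ((nat \<Rightarrow> nat) \<Rightarrow> real) \<Rightarrow> (nat \<Rightarrow> nat) \<Rightarrow> real" where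
  "cell_kernel q N f i = (if i \<in> multi_index q N then f i * (\<Prod>k<q. 1 / sqrt (lam (i k))) else 0)"

lemma tensor_kernel_eq:
  "tensor_kernel q N f (\<lambda>i z. indicator (A i) z / sqrt (lam i)) x = cell_kernel q N f (cell_indices N q x)"
proof -
  have "tensor_kernel q N f (\<lambda>i z. indicator (A i) z / sqrt (lam i)) x =
      (\<Sum>i\<in>multi_index q N. if cell_indices N q x = i then f i * (\<Prod>k<q. 1 / sqrt (lam (i k))) else 0)"
    unfolding tensor_kernel_def tensor_def
  proof (intro sum.cong refl)
    fix i assume i: "i \<in> multi_index q N"
    show "f i * (\<Prod>k<q. indicator (A (i k)) (x k) / sqrt (lam (i k))) =
        (if cell_indices N q x = i then f i * (\<Prod>k<q. 1 / sqrt (lam (i k))) else 0)"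
    proof (cases "cell_indices N q x = i")
      case True
      then have "\<forall>k<q. x k \<in> A (i k)" using cell_indices_eq_iff[OF i] by blast
      then have "(\<Prod>k<q. indicator (A (i k)) (x k) / sqrt (lam (i k))) = (\<Prod>k<q. 1 / sqrt (lam (i k)))"
        by (intro prod.cong) auto
      then show ?thesis using True by simp
    next
      case False
      then obtain k where "k < q" "x k \<notin> A (i k)" using cell_indices_eq_iff[OF i] by blast
      then have "(\<Prod>k<q. indicator (A (i k)) (x k) / sqrt (lam (i k))) = 0"
        by (intro prod_zero) (auto intro!: bexI[of _ k])
      then show ?thesis using False by simp
    qed
  qed
  also have "\<dots> = cell_kernel q N f (cell_indices N q x)" by (simp add: cell_kernel_def)
  finally show ?thesis .
qed

lemma cell_kernel_zero: "i \<notin> multi_index q N \<Longrightarrow> cell_kernel q N f i = 0"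
  by (simp add: cell_kernel_def)

definition contr_kernel :: "nat \<Rightarrow> nat \<Rightarrow> nat \<Rightarrow> nat \<Rightarrow> ((nat \<Rightarrow> nat) \<Rightarrow> real) \<Rightarrow> (nat \<Rightarrow> nat) \<Rightarrow> real" where
  "contr_kernel l e c N f y = (\<Sum>z\<in>multi_index l N. (\<Prod>k<l. lam (z k)) *
     (cell_kernel (l + (e + c)) N f (tuple_append l (e + c) z (left_arg (e + c) y)) *
      cell_kernel (l + (e + c)) N f (tuple_append l (e + c) z (right_arg e c y))))"

text \<open>The kernel is constant on products of cells, so integrating out \<open>l\<close>
  variables is a sum over cell tuples. Writing \<open>q = l + (e + c)\<close> and
  \<open>r = l + e\<close> avoids truncated subtraction.\<close>

lemma star_contraction_eq:
  fixes f :: "(nat \<Rightarrow> nat) \<Rightarrow> real" and l e c N :: nat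
  defines "g \<equiv> tensor_kernel (l + (e + c)) N f (\<lambda>i z. indicator (A i) z / sqrt (lam i))"
  shows "star_contraction \<mu> (l + (e + c)) (l + (e + c)) (l + e) l g g x =
    contr_kernel l e c N f (cell_indices N (e + c + c) x)"
proof -
  let ?q = "l + (e + c)"
  define y where "y = cell_indices N (e + c + c) x"
  define H where "H = (\<lambda>z. cell_kernel ?q N f (tuple_append l (e + c) z (left_arg (e + c) y)) *
      cell_kernel ?q N f (tuple_append l (e + c) z (right_arg e c y)))"
  have "H z = 0" if "z \<in> extensional {..<l}" "z \<notin> multi_index l N" for z
  proof -
    have "tuple_append l (e + c) z (left_arg (e + c) y) \<notin> multi_index ?q N"
      unfolding tuple_append_multi_index_iff using not_multi_index[OF that] by blast
    then show ?thesis by (simp add: H_def cell_kernel_zero)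
  qed
  note int = has_bochner_integral_integral_eq[OF has_bochner_integral_step[of l N H, OF this]]
  have 1: "cell_indices N ?q (\<lambda>k\<in>{..<?q}. if k < l then z k else x (k - l)) =
      tuple_append l (e + c) (cell_indices N l z) (left_arg (e + c) y)" for z
    by (auto simp: fun_eq_iff cell_indices_def tuple_append_def left_arg_def y_def)
  have 2: "cell_indices N ?q (\<lambda>k\<in>{..<?q}. if k < l then z k else if k < l + e then x (k - l)
        else x ((?q - l) + (k - (l + e)))) =
      tuple_append l (e + c) (cell_indices N l z) (right_arg e c y)" for z
    by (auto simp: fun_eq_iff cell_indices_def tuple_append_def right_arg_def y_def)
  show ?thesis
    unfolding star_contraction_def g_def tensor_kernel_eq 1 2
    using int by (simp add: contr_kernel_def H_def y_def)
qed

text \<open>Every position of \<open>y\<close> enters at least one of the two factors, and the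
  kernel vanishes there if the index is out of range.\<close>

lemma contr_kernel_zero:
  assumes "y \<in> extensional {..<e + c + c}" "y \<notin> multi_index (e + c + c) N"
  shows "contr_kernel l e c N f y = 0"
proof -
  obtain k where k: "k < e + c + c" "y k \<notin> {1..N}" using not_multi_index[OF assms] by blast
  have "cell_kernel (l + (e + c)) N f (tuple_append l (e + c) z (left_arg (e + c) y)) = 0 \<or>
      cell_kernel (l + (e + c)) N f (tuple_append l (e + c) z (right_arg e c y)) = 0" for z
  proof (cases "k < e + c")
    case True
    then have "left_arg (e + c) y k \<notin> {1..N}" using k by (simp add: left_arg_def)
    then have "tuple_append l (e + c) z (left_arg (e + c) y) \<notin> multi_index (l + (e + c)) N"
      unfolding tuple_append_multi_index_iff using True by blast
    then show ?thesis by (simp add: cell_kernel_zero)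
  next
    case False
    then have lt: "e + (k - (e + c)) < e + c" and "right_arg e c y (e + (k - (e + c))) = y k"
      using k by (auto simp: right_arg_def)
    then have "right_arg e c y (e + (k - (e + c))) \<notin> {1..N}" using k by simp
    then have "tuple_append l (e + c) z (right_arg e c y) \<notin> multi_index (l + (e + c)) N"
      unfolding tuple_append_multi_index_iff using lt by blast
    then show ?thesis by (simp add: cell_kernel_zero)
  qed
  then show ?thesis unfolding contr_kernel_def by (intro sum.neutral) auto
qed

text \<open>An integrated variable occurs in both factors, so its two normalizations
  \<open>1 / sqrt lam\<close> cancel against the measure \<open>lam\<close> of the cell. Only the
  free variables keep theirs.\<close>

lemma contr_kernel_eq:
  assumes f: "symmetric_on (l + (e + c)) N f" "vanishes_on_diagonals (l + (e + c)) N f"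
    and y: "y \<in> multi_index (e + c + c) N"
  defines "t \<equiv> left_arg (e + c) y" and "t' \<equiv> right_arg e c y"
  shows "contr_kernel l e c N f y = (\<Prod>k<e + c. 1 / sqrt (lam (t k))) * (\<Prod>k<e + c. 1 / sqrt (lam (t' k))) *
    (fact l * tuple_form N (e + c) (set_coeff (l + (e + c)) N f) t t')"
proof -
  let ?q = "l + (e + c)" and ?d = "e + c"
  let ?\<phi> = "set_coeff ?q N f" and ?\<rho> = "\<lambda>i. 1 / sqrt (lam i)"
  let ?D = "{..<?d}"
  have t: "t \<in> multi_index ?d N" "t' \<in> multi_index ?d N"
    unfolding t_def t'_def by (rule args_multi_index[OF y])+
  have ker: "cell_kernel ?q N f (tuple_append l ?d z s) = ?\<phi> (z ` {..<l} \<union> s ` ?D) * ((\<Prod>k<l. ?\<rho> (z k)) * (\<Prod>k<?d. ?\<rho> (s k)))"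
    if "z \<in> multi_index l N" "s \<in> multi_index ?d N" for z s
  proof -
    have mi: "tuple_append l ?d z s \<in> multi_index ?q N"
      unfolding tuple_append_multi_index_iff using that by (auto simp: multi_index_def PiE_iff)
    then show ?thesis
      using kernel_eq_set_coeff[OF f mi]
      by (simp only: cell_kernel_def if_True tuple_append_image prod_tuple_append[where h="?\<rho>"])
  qed
  have "contr_kernel l e c N f y = (\<Sum>z\<in>multi_index l N.
      (\<Prod>k<?d. ?\<rho> (t k)) * (\<Prod>k<?d. ?\<rho> (t' k)) * (?\<phi> (z ` {..<l} \<union> t ` ?D) * ?\<phi> (z ` {..<l} \<union> t' ` ?D)))"
    unfolding contr_kernel_def t_def[symmetric] t'_def[symmetric]
  proof (intro sum.cong refl)
    fix z assume z: "z \<in> multi_index l N"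
    have "lam (z k) * (?\<rho> (z k) * ?\<rho> (z k)) = 1" if "k < l" for k
    proof -
      have "z k \<ge> 1" using z that by (auto simp: multi_index_def PiE_iff)
      then have "lam (z k) > 0" by (rule cell_pos)
      then show ?thesis by simp
    qed
    then have one: "(\<Prod>k<l. lam (z k)) * ((\<Prod>k<l. ?\<rho> (z k)) * (\<Prod>k<l. ?\<rho> (z k))) = 1"
      unfolding prod.distrib[symmetric] by (intro prod.neutral) auto
    have "(\<Prod>k<l. lam (z k)) * (cell_kernel ?q N f (tuple_append l ?d z t) * cell_kernel ?q N f (tuple_append l ?d z t')) =
      ((\<Prod>k<l. lam (z k)) * ((\<Prod>k<l. ?\<rho> (z k)) * (\<Prod>k<l. ?\<rho> (z k)))) *
      ((\<Prod>k<?d. ?\<rho> (t k)) * (\<Prod>k<?d. ?\<rho> (t' k)) * (?\<phi> (z ` {..<l} \<union> t ` ?D) * ?\<phi> (z ` {..<l} \<union> t' ` ?D)))"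
      unfolding ker[OF z t(1)] ker[OF z t(2)] by (simp only: mult_ac)
    then show "(\<Prod>k<l. lam (z k)) * (cell_kernel ?q N f (tuple_append l ?d z t) * cell_kernel ?q N f (tuple_append l ?d z t')) =
      (\<Prod>k<?d. ?\<rho> (t k)) * (\<Prod>k<?d. ?\<rho> (t' k)) * (?\<phi> (z ` {..<l} \<union> t ` ?D) * ?\<phi> (z ` {..<l} \<union> t' ` ?D))"
      unfolding one by simp
  qed
  also have "\<dots> = (\<Prod>k<?d. ?\<rho> (t k)) * (\<Prod>k<?d. ?\<rho> (t' k)) *
      (\<Sum>z\<in>multi_index l N. ?\<phi> (z ` {..<l} \<union> t ` ?D) * ?\<phi> (z ` {..<l} \<union> t' ` ?D))"
    by (simp only: sum_distrib_left)
  also have "(\<Sum>z\<in>multi_index l N. ?\<phi> (z ` {..<l} \<union> t ` ?D) * ?\<phi> (z ` {..<l} \<union> t' ` ?D)) =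
      fact l * tuple_form N ?d ?\<phi> t t'"
    unfolding tuple_form_def
  proof (rule sum_tuples_contr)
    show "card (t ` ?D) \<le> ?d" "card (t' ` ?D) \<le> ?d"
      using card_image_le[of ?D t] card_image_le[of ?D t'] by auto
  qed (auto simp: set_coeff_card)
  finally show ?thesis .
qed

text \<open>After squaring, a variable of one factor carries \<open>1 / lam\<close>, which cancels
  against the measure of its cell. A variable shared by both factors carries the square of
  \<open>1 / lam\<close>, so a weight \<open>1 / lam\<close> survives for each of the
  \<open>e\<close> shared variables.\<close>

lemma L2_norm_star_contraction:
  fixes f :: "(nat \<Rightarrow> nat) \<Rightarrow> real"
  assumes f: "symmetric_on (l + (e + c)) N f" "vanishes_on_diagonals (l + (e + c)) N f"
  defines "g \<equiv> tensor_kernel (l + (e + c)) N f (\<lambda>i z. indicator (A i) z / sqrt (lam i))"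
  shows "L2_norm (power_measure (e + c + c) \<mu>) (star_contraction \<mu> (l + (e + c)) (l + (e + c)) (l + e) l g g) =
    ennreal (sqrt (\<Sum>y\<in>multi_index (e + c + c) N. (\<Prod>k<e. 1 / lam (y k)) *
      ((fact l)\<^sup>2 * (tuple_form N (e + c) (set_coeff (l + (e + c)) N f) (left_arg (e + c) y) (right_arg e c y))\<^sup>2)))"
proof -
  have "L2_norm (power_measure (e + c + c) \<mu>) (star_contraction \<mu> (l + (e + c)) (l + (e + c)) (l + e) l g g) =
      L2_norm (power_measure (e + c + c) \<mu>) (\<lambda>x. contr_kernel l e c N f (cell_indices N (e + c + c) x))"
    unfolding g_def star_contraction_eq ..
  also have "\<dots> = ennreal (sqrt (\<Sum>y\<in>multi_index (e + c + c) N. (\<Prod>k<e + c + c. lam (y k)) * (contr_kernel l e c N f y)\<^sup>2))"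
    by (rule L2_norm_step) (rule contr_kernel_zero)
  also have "(\<Sum>y\<in>multi_index (e + c + c) N. (\<Prod>k<e + c + c. lam (y k)) * (contr_kernel l e c N f y)\<^sup>2) =
    (\<Sum>y\<in>multi_index (e + c + c) N. (\<Prod>k<e. 1 / lam (y k)) *
      ((fact l)\<^sup>2 * (tuple_form N (e + c) (set_coeff (l + (e + c)) N f) (left_arg (e + c) y) (right_arg e c y))\<^sup>2))"
  proof (intro sum.cong refl)
    fix y assume y: "y \<in> multi_index (e + c + c) N"
    let ?L = "\<lambda>i. lam i" and ?\<rho> = "\<lambda>i. 1 / sqrt (lam i)"
    define Q where "Q = tuple_form N (e + c) (set_coeff (l + (e + c)) N f) (left_arg (e + c) y) (right_arg e c y)"
    have pos: "lam (y k) > 0" if "k < e + c + c" for k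
    proof -
      have "y k \<ge> 1" using y that by (auto simp: multi_index_def PiE_iff)
      then show ?thesis by (rule cell_pos)
    qed
    have sq: "(\<Prod>k<n. ?\<rho> (y (j + k)))\<^sup>2 = (\<Prod>k<n. 1 / lam (y (j + k)))" if "j + n \<le> e + c + c" for j n
      unfolding prod_power_distrib using that by (intro prod.cong) (auto simp: power_divide less_imp_le[OF pos])
    have sq0: "(\<Prod>k<n. ?\<rho> (y k))\<^sup>2 = (\<Prod>k<n. 1 / lam (y k))" if "n \<le> e + c + c" for n
      using sq[of 0 n] that by simp
    have la: "(\<Prod>k<e + c. ?\<rho> (left_arg (e + c) y k)) = (\<Prod>k<e + c. ?\<rho> (y k))"
      by (intro prod.cong) (auto simp: left_arg_def)
    have ra: "(\<Prod>k<e + c. ?\<rho> (right_arg e c y k)) = (\<Prod>k<e. ?\<rho> (y k)) * (\<Prod>k<c. ?\<rho> (y (e + c + k)))"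
      using prod_right_arg[of "?\<rho>" e c y] by simp
    have le: "e + c \<le> e + c + c" "e \<le> e + c + c" "e + c + c \<le> e + c + c" by auto
    have inv: "(\<Prod>k<n. lam (y (j + k))) * (\<Prod>k<n. 1 / lam (y (j + k))) = 1" if "j + n \<le> e + c + c" for j n
    proof -
      have "lam (y (j + k)) \<noteq> 0" if "k < n" for k
        using pos[of "j + k"] that \<open>j + n \<le> e + c + c\<close> by simp
      then show ?thesis unfolding prod.distrib[symmetric] by (intro prod.neutral) auto
    qed
    have "(\<Prod>k<e + c + c. lam (y k)) * (contr_kernel l e c N f y)\<^sup>2 =
      (\<Prod>k<e + c + c. lam (y k)) *
      ((\<Prod>k<e + c. 1 / lam (y k)) * ((\<Prod>k<e. 1 / lam (y k)) * (\<Prod>k<c. 1 / lam (y (e + c + k)))) *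
      ((fact l)\<^sup>2 * Q\<^sup>2))"
      unfolding contr_kernel_eq[OF f y] Q_def[symmetric] la ra power_mult_distrib
      unfolding sq0[OF le(1)] sq0[OF le(2)] sq[OF le(3)] ..
    also have "(\<Prod>k<e + c + c. lam (y k)) = (\<Prod>k<e + c. lam (y k)) * (\<Prod>k<c. lam (y (e + c + k)))"
      unfolding prod_lessThan_add[of _ "e + c" c] by simp
    also have "(\<Prod>k<e + c. lam (y k)) * (\<Prod>k<c. lam (y (e + c + k))) *
      ((\<Prod>k<e + c. 1 / lam (y k)) * ((\<Prod>k<e. 1 / lam (y k)) * (\<Prod>k<c. 1 / lam (y (e + c + k)))) *
      ((fact l)\<^sup>2 * Q\<^sup>2)) =
      ((\<Prod>k<e + c. lam (y k)) * (\<Prod>k<e + c. 1 / lam (y k))) *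
      ((\<Prod>k<c. lam (y (e + c + k))) * (\<Prod>k<c. 1 / lam (y (e + c + k)))) *
      ((\<Prod>k<e. 1 / lam (y k)) * ((fact l)\<^sup>2 * Q\<^sup>2))"
      by (simp only: mult_ac)
    also have "\<dots> = (\<Prod>k<e. 1 / lam (y k)) * ((fact l)\<^sup>2 * Q\<^sup>2)"
      using inv[of 0 "e + c"] inv[of "e + c" c] by simp
    finally show "(\<Prod>k<e + c + c. lam (y k)) * (contr_kernel l e c N f y)\<^sup>2 =
      (\<Prod>k<e. 1 / lam (y k)) * ((fact l)\<^sup>2 * Q\<^sup>2)"
      by (simp only: prod_lessThan_add[of _ "e + c" c])
  qed
  finally show ?thesis .
qed

lemma L2_norm_star_diag:
  fixes f :: "(nat \<Rightarrow> nat) \<Rightarrow> real"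
  assumes f: "symmetric_on (l + d) N f" "vanishes_on_diagonals (l + d) N f"
  defines "g \<equiv> tensor_kernel (l + d) N f (\<lambda>i z. indicator (A i) z / sqrt (lam i))"
  shows "L2_norm (power_measure (d + d) \<mu>) (star_contraction \<mu> (l + d) (l + d) l l g g) =
    ennreal (sqrt ((fact l * fact d)\<^sup>2 * contr_level {1..N} d (set_coeff (l + d) N f)))"
proof -
  let ?\<phi> = "set_coeff (l + d) N f"
  have "(\<Sum>y\<in>multi_index (d + d) N. (fact l)\<^sup>2 * (tuple_form N d ?\<phi> (left_arg d y) (right_arg 0 d y))\<^sup>2) =
      (\<Sum>(t, t')\<in>multi_index d N \<times> multi_index d N. (fact l)\<^sup>2 * (tuple_form N d ?\<phi> t t')\<^sup>2)"
    using inj_on_args[of 0 d N] by (subst image_args_diag[symmetric], subst sum.reindex) auto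
  also have "\<dots> = (fact l)\<^sup>2 * (\<Sum>t\<in>multi_index d N. \<Sum>t'\<in>multi_index d N. (tuple_form N d ?\<phi> t t')\<^sup>2)"
    by (simp add: sum.cartesian_product[symmetric] sum_distrib_left)
  also have "\<dots> = (fact l * fact d)\<^sup>2 * contr_level {1..N} d ?\<phi>"
    by (subst sum_tuple_form[of "l + d"]) (auto simp: set_coeff_card power_mult_distrib)
  finally show ?thesis
    using L2_norm_star_contraction[of l 0 d N f] f by (simp add: g_def)
qed

text \<open>Bound each surviving weight by \<open>1 / \<alpha>\<close>, then drop the condition that
  both arguments agree in the shared variables. The result is the norm of the contraction with both
  indices \<open>l\<close>, whose level is \<open>e + c = q - l\<close>, up to a constant.\<close>

lemma L2_norm_star_le:
  fixes f :: "(nat \<Rightarrow> nat) \<Rightarrow> real"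
  assumes f: "symmetric_on (l + (e + c)) N f" "vanishes_on_diagonals (l + (e + c)) N f"
    and \<alpha>: "\<alpha> > 0" "\<And>i. i \<ge> 1 \<Longrightarrow> \<alpha> \<le> lam i"
  defines "g \<equiv> tensor_kernel (l + (e + c)) N f (\<lambda>i z. indicator (A i) z / sqrt (lam i))"
  shows "L2_norm (power_measure (e + c + c) \<mu>) (star_contraction \<mu> (l + (e + c)) (l + (e + c)) (l + e) l g g) \<le>
    ennreal (sqrt ((1 / \<alpha>) ^ e * (fact l * fact (e + c))\<^sup>2 * contr_level {1..N} (e + c) (set_coeff (l + (e + c)) N f)))"
proof -
  let ?\<phi> = "set_coeff (l + (e + c)) N f" and ?d = "e + c"
  have "(\<Sum>y\<in>multi_index (e + c + c) N. (\<Prod>k<e. 1 / lam (y k)) *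
      ((fact l)\<^sup>2 * (tuple_form N ?d ?\<phi> (left_arg ?d y) (right_arg e c y))\<^sup>2)) \<le>
      (\<Sum>y\<in>multi_index (e + c + c) N. (1 / \<alpha>) ^ e *
      ((fact l)\<^sup>2 * (tuple_form N ?d ?\<phi> (left_arg ?d y) (right_arg e c y))\<^sup>2))"
  proof (intro sum_mono mult_right_mono)
    fix y assume y: "y \<in> multi_index (e + c + c) N"
    have "\<alpha> \<le> lam (y k)" if "k < e" for k
      using y that \<alpha>(2) by (auto simp: multi_index_def PiE_iff)
    then have "(\<Prod>k<e. 1 / lam (y k)) \<le> (\<Prod>k<e. 1 / \<alpha>)"
      using \<alpha>(1) by (intro prod_mono) (auto simp: frac_le intro: order_trans less_imp_le)
    then show "(\<Prod>k<e. 1 / lam (y k)) \<le> (1 / \<alpha>) ^ e" by simp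
  qed auto
  also have "\<dots> = (\<Sum>p\<in>(\<lambda>y. (left_arg ?d y, right_arg e c y)) ` multi_index (e + c + c) N. (1 / \<alpha>) ^ e *
      ((fact l)\<^sup>2 * (tuple_form N ?d ?\<phi> (fst p) (snd p))\<^sup>2))"
    by (subst sum.reindex[OF inj_on_args]) simp
  also have "\<dots> \<le> (\<Sum>p\<in>multi_index ?d N \<times> multi_index ?d N. (1 / \<alpha>) ^ e *
      ((fact l)\<^sup>2 * (tuple_form N ?d ?\<phi> (fst p) (snd p))\<^sup>2))"
    using \<alpha>(1) args_multi_index[of _ e c N] by (intro sum_mono2) auto
  also have "\<dots> = (1 / \<alpha>) ^ e * (fact l)\<^sup>2 * (\<Sum>t\<in>multi_index ?d N. \<Sum>t'\<in>multi_index ?d N. (tuple_form N ?d ?\<phi> t t')\<^sup>2)"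
    by (simp add: sum.cartesian_product' sum_distrib_left mult.assoc)
  also have "\<dots> = (1 / \<alpha>) ^ e * (fact l * fact ?d)\<^sup>2 * contr_level {1..N} ?d ?\<phi>"
    by (subst sum_tuple_form[of "l + ?d"]) (auto simp: set_coeff_card power_mult_distrib)
  finally show ?thesis
    unfolding g_def L2_norm_star_contraction[OF f] by (intro ennreal_leI real_sqrt_le_mono)
qed

text \<open>Each variable contributes
  \<open>lam * (1 / sqrt lam) ^ 4 = 1 / lam \<le> 1 / \<alpha>\<close>, which leaves the fourth
  powers of the coefficients.\<close>

lemma integral_kernel_fourth:
  assumes \<alpha>: "\<alpha> > 0" "\<And>i. i \<ge> 1 \<Longrightarrow> \<alpha> \<le> lam i"
    and f: "symmetric_on q N f" "vanishes_on_diagonals q N f"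
  defines "g \<equiv> tensor_kernel q N f (\<lambda>i z. indicator (A i) z / sqrt (lam i))"
  shows "0 \<le> (\<integral>x. (g x) ^ 4 \<partial>power_measure q \<mu>)"
    and "(\<integral>x. (g x) ^ 4 \<partial>power_measure q \<mu>) \<le>
      (1 / \<alpha>) ^ q * (fact q * (\<Sum>S\<in>Pow {1..N}. (set_coeff q N f S) ^ 4))"
proof -
  show "0 \<le> (\<integral>x. (g x) ^ 4 \<partial>power_measure q \<mu>)" by (intro integral_nonneg_AE) auto
  have "(\<integral>x. (g x) ^ 4 \<partial>power_measure q \<mu>) = (\<Sum>i\<in>multi_index q N. (\<Prod>k<q. lam (i k)) * (cell_kernel q N f i) ^ 4)"
    unfolding g_def tensor_kernel_eq
    by (rule has_bochner_integral_integral_eq[OF has_bochner_integral_step]) (simp add: cell_kernel_zero)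
  also have "\<dots> \<le> (\<Sum>i\<in>multi_index q N. (1 / \<alpha>) ^ q * (set_coeff q N f (i ` {..<q})) ^ 4)"
  proof (intro sum_mono)
    fix i assume i: "i \<in> multi_index q N"
    have pos: "0 < lam (i k)" "\<alpha> \<le> lam (i k)" if "k < q" for k
      using cell_pos[of "i k"] \<alpha>(2)[of "i k"] i that by (auto simp: multi_index_def PiE_iff)
    have "(\<Prod>k<q. lam (i k)) * (\<Prod>k<q. 1 / sqrt (lam (i k))) ^ 4 = (\<Prod>k<q. 1 / lam (i k))"
      unfolding prod_power_distrib prod.distrib[symmetric]
    proof (intro prod.cong refl)
      fix k assume "k \<in> {..<q}"
      then have p: "0 < lam (i k)" using pos by simp
      have "sqrt (lam (i k)) ^ 4 = lam (i k) * lam (i k)"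
        using p by (simp add: power4_eq_xxxx)
      then show "lam (i k) * (1 / sqrt (lam (i k))) ^ 4 = 1 / lam (i k)"
        using p by (simp add: power_one_over)
    qed
    also have "\<dots> \<le> (\<Prod>k<q. 1 / \<alpha>)"
      using \<alpha>(1) pos by (intro prod_mono) (auto simp: frac_le less_imp_le)
    finally have le: "(\<Prod>k<q. lam (i k)) * (\<Prod>k<q. 1 / sqrt (lam (i k))) ^ 4 \<le> (1 / \<alpha>) ^ q" by simp
    have "(\<Prod>k<q. lam (i k)) * (cell_kernel q N f i) ^ 4 =
        ((\<Prod>k<q. lam (i k)) * (\<Prod>k<q. 1 / sqrt (lam (i k))) ^ 4) * (f i) ^ 4"
      using i by (simp add: cell_kernel_def power_mult_distrib mult_ac)
    also have "\<dots> \<le> (1 / \<alpha>) ^ q * (f i) ^ 4" using le by (intro mult_right_mono) auto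
    finally show "(\<Prod>k<q. lam (i k)) * (cell_kernel q N f i) ^ 4 \<le> (1 / \<alpha>) ^ q * (set_coeff q N f (i ` {..<q})) ^ 4"
      using kernel_eq_set_coeff[OF f i] by simp
  qed
  also have "\<dots> = (1 / \<alpha>) ^ q * (\<Sum>i\<in>multi_index q N. (set_coeff q N f (i ` {..<q})) ^ 4)"
    by (simp only: sum_distrib_left)
  also have "(\<Sum>i\<in>multi_index q N. (set_coeff q N f (i ` {..<q})) ^ 4) =
      fact q * (\<Sum>S\<in>Pow {1..N}. (set_coeff q N f S) ^ 4)"
    by (rule sum_multi_index_image[where h="\<lambda>S. (set_coeff q N f S) ^ 4"]) (simp add: set_coeff_card)
  finally show "(\<integral>x. (g x) ^ 4 \<partial>power_measure q \<mu>) \<le>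
      (1 / \<alpha>) ^ q * (fact q * (\<Sum>S\<in>Pow {1..N}. (set_coeff q N f S) ^ 4))" .
qed

end

section \<open>Comparing the limit conditions\<close>

lemma contr_scale: "set_contr I (\<lambda>S. c * a S) x x' = c\<^sup>2 * set_contr I a x x'"
  unfolding set_contr_def sum_distrib_left by (intro sum.cong refl) (simp add: power2_eq_square)

lemma contr_sum_scale: "contr_sum I q (\<lambda>S. c * a S) = c ^ 4 * contr_sum I q a"
  unfolding contr_sum_def contr_scale sum_distrib_left
  by (intro sum.cong refl) (simp add: power_mult_distrib flip: power_mult)

text \<open>Counting each \<open>S\<close> once per element turns the left side, times
  \<open>q\<close>, into a sum over sites. At a site, the sum of the squares of the numbers
  \<open>(a S)\<^sup>2\<close> is at most the square of their sum, which is the squared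
  influence.\<close>

lemma sum_fourth_powers_le:
  assumes "finite I" "q \<ge> 2" and a: "\<And>S. card S \<noteq> q \<Longrightarrow> a S = 0"
  shows "(\<Sum>S\<in>Pow I. a S ^ 4) \<le> contr_sum I q a"
proof -
  define V where "V = (\<Sum>S\<in>Pow I. a S ^ 4)"
  have "V \<ge> 0" unfolding V_def by (intro sum_nonneg) auto
  then have "V \<le> real q * V" using assms(2) by (simp add: mult_le_cancel_right1)
  also have "\<dots> = (\<Sum>i\<in>I. influence I (\<lambda>S. (a S)\<^sup>2) i)"
    unfolding V_def by (subst sum_influence[OF assms(1), of q]) (auto simp: a simp flip: power_mult)
  also have "\<dots> \<le> (\<Sum>i\<in>I. (influence I a i)\<^sup>2)"
  proof (intro sum_mono)
    fix i
    have "influence I (\<lambda>S. (a S)\<^sup>2) i = (\<Sum>S\<in>Pow (I - {i}). (a (insert i S))\<^sup>2 * (a (insert i S))\<^sup>2)"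
      by (simp add: influence_def power2_eq_square)
    also have "\<dots> \<le> (\<Sum>S\<in>Pow (I - {i}). (a (insert i S))\<^sup>2 * influence I a i)"
      unfolding influence_def using assms(1) by (intro sum_mono mult_left_mono member_le_sum) auto
    also have "\<dots> = (influence I a i)\<^sup>2" by (simp add: influence_def sum_distrib_right power2_eq_square)
    finally show "influence I (\<lambda>S. (a S)\<^sup>2) i \<le> (influence I a i)\<^sup>2" .
  qed
  also have "\<dots> \<le> contr_sum I q a" by (rule sum_influence_sq[OF assms(1,2)])
  finally show ?thesis by (simp add: V_def)
qed

lemma level_le_contr_sum:
  assumes "finite I" "1 \<le> d" "d < q"
  shows "contr_level I d a \<le> contr_sum I q a"
  unfolding contr_sum_eq_levels[OF assms(1)] using assms by (intro member_le_sum) (auto simp: level_nonneg)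

lemma ennreal_sqrt_tendsto_0_iff:
  assumes "\<And>n. u n \<ge> 0"
  shows "(\<lambda>n. ennreal (sqrt (u n))) \<longlonglongrightarrow> 0 \<longleftrightarrow> u \<longlonglongrightarrow> 0"
proof
  assume "(\<lambda>n. ennreal (sqrt (u n))) \<longlonglongrightarrow> 0"
  then have "(\<lambda>n. sqrt (u n)) \<longlonglongrightarrow> 0"
    using tendsto_ennreal_iff[of "\<lambda>n. sqrt (u n)" sequentially 0] assms by simp
  from tendsto_power[OF this, of 2] show "u \<longlonglongrightarrow> 0" using assms by simp
next
  assume "u \<longlonglongrightarrow> 0"
  from tendsto_real_sqrt[OF this] have "(\<lambda>n. sqrt (u n)) \<longlonglongrightarrow> 0" by simp
  then show "(\<lambda>n. ennreal (sqrt (u n))) \<longlonglongrightarrow> 0"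
    using tendsto_ennreal_iff[of "\<lambda>n. sqrt (u n)" sequentially 0] assms by simp
qed

text \<open>The kernels are symmetric and vanish on diagonals only for \<open>n \<ge> 1\<close>,
  whereas sequences start at 0.\<close>

lemma tendsto_cong_ge1:
  fixes u w :: "nat \<Rightarrow> 'a::topological_space"
  assumes "\<And>n. n \<ge> 1 \<Longrightarrow> u n = w n"
  shows "u \<longlonglongrightarrow> c \<longleftrightarrow> w \<longlonglongrightarrow> c"
  using assms by (intro tendsto_cong eventually_sequentiallyI[of 1])

lemma weak_conv_m_cong_ge1:
  assumes "\<And>n. n \<ge> 1 \<Longrightarrow> \<mu> n = \<mu>' n"
  shows "weak_conv_m \<mu> \<nu> \<longleftrightarrow> weak_conv_m \<mu>' \<nu>"
  unfolding weak_conv_m_def weak_conv_def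
  using tendsto_cong_ge1[of "\<lambda>n. cdf (\<mu> n) _" "\<lambda>n. cdf (\<mu>' n) _"] assms by simp

lemma L2_norm_AE_zero:
  assumes "AE x in M. h x = 0"
  shows "L2_norm M h = 0"
proof -
  have "(\<integral>\<^sup>+x. ennreal ((h x)\<^sup>2) \<partial>M) = (\<integral>\<^sup>+x. 0 \<partial>M)"
    using assms by (intro nn_integral_cong_AE) auto
  then show ?thesis by (simp add: L2_norm_def)
qed

lemma in_L2_has_moments:
  assumes "has_moments M F"
  shows "in_L2 M F"
proof -
  have "(\<integral>\<^sup>+x. ennreal ((F x)\<^sup>2) \<partial>M) = ennreal (\<integral>x. (F x)\<^sup>2 \<partial>M)"
    by (intro nn_integral_eq_integral has_moments_integrable_power assms) auto
  then show ?thesis using assms by (auto simp: in_L2_def L2_norm_def Let_def)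
qed

context disjoint_cells
begin

text \<open>The kernel is itself an off-diagonal elementary function of the cells once the
  normalizations are moved into the coefficients, so a constant approximating sequence
  suffices.\<close>

lemma is_multiple_integral_homogeneous_sum:
  assumes diag: "vanishes_on_diagonals q N f" and F: "has_moments M (homogeneous_sum q N f X)"
    and X: "\<And>i. i \<ge> 1 \<Longrightarrow> AE \<omega> in M. X i \<omega> = \<eta> (A i) \<omega> / sqrt (lam i)"
  shows "is_multiple_integral M \<mu> \<eta> q (tensor_kernel q N f (\<lambda>i z. indicator (A i) z / sqrt (lam i)))
    (homogeneous_sum q N f X)"
proof -
  let ?g = "tensor_kernel q N f (\<lambda>i z. indicator (A i) z / sqrt (lam i))"
  let ?c = "\<lambda>i. f i * (\<Prod>k<q. 1 / sqrt (lam (i k)))"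
  have gL2: "in_L2 (power_measure q \<mu>) ?g"
  proof -
    have "?g \<in> borel_measurable (power_measure q \<mu>)"
      unfolding tensor_kernel_eq[abs_def]
      using has_bochner_integral_step[of q N "cell_kernel q N f", OF cell_kernel_zero]
      by (auto simp: has_bochner_integral_iff)
    moreover have "L2_norm (power_measure q \<mu>) ?g < \<infinity>"
      unfolding tensor_kernel_eq[abs_def]
      by (subst L2_norm_step[of q N "cell_kernel q N f", OF cell_kernel_zero]) auto
    ultimately show ?thesis by (simp add: in_L2_def)
  qed
  have eq: "tensor_kernel q N ?c (\<lambda>i. indicator (A i)) x = ?g x" for x
    unfolding tensor_kernel_def tensor_def
    by (intro sum.cong refl) (simp add: prod.distrib[symmetric] mult.assoc)
  have "AE \<omega> in M. \<forall>i\<in>{1..N}. X i \<omega> = \<eta> (A i) \<omega> / sqrt (lam i)"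
    using X by (intro AE_finite_allI) auto
  then have "AE \<omega> in M. homogeneous_sum q N ?c (\<lambda>i. \<eta> (A i)) \<omega> - homogeneous_sum q N f X \<omega> = 0"
  proof eventually_elim
    case (elim \<omega>)
    have "homogeneous_sum q N ?c (\<lambda>i. \<eta> (A i)) \<omega> = homogeneous_sum q N f X \<omega>"
      unfolding homogeneous_sum_def
    proof (intro sum.cong refl)
      fix i assume i: "i \<in> multi_index q N"
      have "(\<Prod>k<q. X (i k) \<omega>) = (\<Prod>k<q. 1 / sqrt (lam (i k)) * \<eta> (A (i k)) \<omega>)"
        using elim i by (intro prod.cong) (auto simp: multi_index_def PiE_iff)
      then show "?c i * (\<Prod>k<q. \<eta> (A (i k)) \<omega>) = f i * (\<Prod>k<q. X (i k) \<omega>)"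
        by (simp only: prod.distrib mult.assoc)
    qed
    then show ?case by simp
  qed
  then have z2: "L2_norm M (\<lambda>\<omega>. homogeneous_sum q N ?c (\<lambda>i. \<eta> (A i)) \<omega> - homogeneous_sum q N f X \<omega>) = 0"
    by (rule L2_norm_AE_zero)
  have z1: "L2_norm (power_measure q \<mu>) (\<lambda>x. tensor_kernel q N ?c (\<lambda>i. indicator (A i)) x - ?g x) = 0"
    unfolding eq by (rule L2_norm_AE_zero) simp
  have sets: "A i \<in> sets \<mu>" "emeasure \<mu> (A i) < \<infinity>" if "i \<in> {1..N}" for i
    using that A_sets A_measure by auto
  have disj: "disjoint_family_on A {1..N}" by (rule disjoint_family_on_mono[OF _ A_disjoint]) auto
  have van: "vanishes_on_diagonals q N ?c"
    using diag unfolding vanishes_on_diagonals_def by auto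
  show ?thesis
    unfolding is_multiple_integral_def
    by (intro conjI gL2 in_L2_has_moments F exI[of _ "\<lambda>_. N"] exI[of _ "\<lambda>_. A"] exI[of _ "\<lambda>_. ?c"])
      (use z1 z2 sets disj van in auto)
qed

text \<open>Both conditions are compared with \<open>D\<close>, a finite sum of levels. Each
  contraction with \<open>r = l\<close> is exactly one level up to a positive constant, the full
  condition includes these contractions, and everything else in it is bounded by
  \<open>D\<close>.\<close>

lemma contraction_conditions:
  fixes N :: "nat \<Rightarrow> nat" and f :: "nat \<Rightarrow> (nat \<Rightarrow> nat) \<Rightarrow> real"
  assumes \<alpha>: "\<alpha> > 0" "\<And>i. i \<ge> 1 \<Longrightarrow> \<alpha> \<le> lam i" and q: "q \<ge> 2"
    and f_sym: "\<And>n. n \<ge> 1 \<Longrightarrow> symmetric_on q (N n) (f n)"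
    and f_diag: "\<And>n. n \<ge> 1 \<Longrightarrow> vanishes_on_diagonals q (N n) (f n)"
  defines "g \<equiv> \<lambda>n. tensor_kernel q (N n) (f n) (\<lambda>i z. indicator (A i) z / sqrt (lam i))"
    and "D \<equiv> \<lambda>n. contr_sum {1..N n} q (set_coeff q (N n) (f n))"
  shows "(\<forall>r\<in>{1..q - 1}. (\<lambda>n. L2_norm (power_measure (2 * q - 2 * r) \<mu>)
        (star_contraction \<mu> q q r r (g n) (g n))) \<longlonglongrightarrow> 0) \<longleftrightarrow> D \<longlonglongrightarrow> 0" (is "?diag \<longleftrightarrow> _")
    and "((\<lambda>n. \<integral>x. (g n x) ^ 4 \<partial>power_measure q \<mu>) \<longlonglongrightarrow> 0 \<and>
      (\<forall>r\<in>{1..q}. \<forall>l\<in>{1..min r (q - 1)}.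
         (\<lambda>n. L2_norm (power_measure (2 * q - r - l) \<mu>)
                (star_contraction \<mu> q q r l (g n) (g n))) \<longlonglongrightarrow> 0)) \<longleftrightarrow> D \<longlonglongrightarrow> 0" (is "?full \<longleftrightarrow> _")
proof -
  let ?\<phi> = "\<lambda>n. set_coeff q (N n) (f n)"
  let ?lv = "\<lambda>d n. contr_level {1..N n} d (?\<phi> n)"
  have lv_le: "?lv d n \<le> D n" if "1 \<le> d" "d < q" for d n
    unfolding D_def using that by (intro level_le_contr_sum) auto
  have lv0: "?lv d \<longlonglongrightarrow> 0" if "D \<longlonglongrightarrow> 0" "1 \<le> d" "d < q" for d
    by (rule tendsto_sandwich[OF _ _ tendsto_const that(1)])
      (use lv_le that in \<open>auto simp: level_nonneg\<close>)
  have diag_norm: "(\<lambda>n. L2_norm (power_measure (2 * q - 2 * r) \<mu>) (star_contraction \<mu> q q r r (g n) (g n))) \<longlonglongrightarrow> 0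
      \<longleftrightarrow> ?lv (q - r) \<longlonglongrightarrow> 0" if r: "r \<in> {1..q - 1}" for r
  proof -
    define d where "d = q - r"
    define C where "C = (fact r * fact d :: real)\<^sup>2"
    have qd: "q = r + d" "2 * q - 2 * r = d + d" using r by (auto simp: d_def)
    have C: "C > 0" by (simp add: C_def)
    have "(\<lambda>n. L2_norm (power_measure (2 * q - 2 * r) \<mu>) (star_contraction \<mu> q q r r (g n) (g n))) \<longlonglongrightarrow> 0
        \<longleftrightarrow> (\<lambda>n. ennreal (sqrt (C * ?lv d n))) \<longlonglongrightarrow> 0"
    proof (rule tendsto_cong_ge1)
      fix n :: nat assume n: "n \<ge> 1"
      show "L2_norm (power_measure (2 * q - 2 * r) \<mu>) (star_contraction \<mu> q q r r (g n) (g n)) =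
          ennreal (sqrt (C * ?lv d n))"
        unfolding qd(2) unfolding g_def C_def qd(1)
        by (rule L2_norm_star_diag) (use f_sym[OF n] f_diag[OF n] qd(1) in simp_all)
    qed
    also have "\<dots> \<longleftrightarrow> (\<lambda>n. C * ?lv d n) \<longlonglongrightarrow> 0"
      using C by (intro ennreal_sqrt_tendsto_0_iff) (simp add: level_nonneg)
    also have "\<dots> \<longleftrightarrow> ?lv d \<longlonglongrightarrow> 0"
      using C tendsto_mult_left_iff[of C "?lv d" 0 sequentially] by simp
    finally show ?thesis by (simp add: d_def)
  qed
  have D_eq: "D n = (\<Sum>d\<in>{1..<q}. ?lv d n)" for n
    unfolding D_def by (rule contr_sum_eq_levels) simp
  show 1: "?diag \<longleftrightarrow> D \<longlonglongrightarrow> 0"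
  proof
    assume ?diag
    have "?lv d \<longlonglongrightarrow> 0" if "d \<in> {1..<q}" for d
    proof -
      have "q - d \<in> {1..q - 1}" "q - (q - d) = d" using that by auto
      then show ?thesis using \<open>?diag\<close> diag_norm[of "q - d"] by simp
    qed
    then have "(\<lambda>n. \<Sum>d\<in>{1..<q}. ?lv d n) \<longlonglongrightarrow> (\<Sum>d\<in>{1..<q}. 0)" by (intro tendsto_sum)
    then show "D \<longlonglongrightarrow> 0" unfolding D_eq[abs_def] by simp
  next
    assume D0: "D \<longlonglongrightarrow> 0"
    show ?diag
    proof
      fix r assume r: "r \<in> {1..q - 1}"
      then have "1 \<le> q - r" "q - r < q" using q by auto
      then show "(\<lambda>n. L2_norm (power_measure (2 * q - 2 * r) \<mu>) (star_contraction \<mu> q q r r (g n) (g n))) \<longlonglongrightarrow> 0"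
        using diag_norm[OF r] lv0[OF D0] by simp
    qed
  qed
  show "?full \<longleftrightarrow> D \<longlonglongrightarrow> 0"
  proof
    assume full: ?full
    have ?diag
    proof
      fix r assume r: "r \<in> {1..q - 1}"
      then have "r \<in> {1..q}" "r \<in> {1..min r (q - 1)}" and e: "2 * q - 2 * r = 2 * q - r - r" by auto
      then show "(\<lambda>n. L2_norm (power_measure (2 * q - 2 * r) \<mu>) (star_contraction \<mu> q q r r (g n) (g n))) \<longlonglongrightarrow> 0"
        unfolding e using full by blast
    qed
    then show "D \<longlonglongrightarrow> 0" using 1 by blast
  next
    assume D0: "D \<longlonglongrightarrow> 0"
    have int0: "(\<lambda>n. \<integral>x. (g n x) ^ 4 \<partial>power_measure q \<mu>) \<longlonglongrightarrow> 0"
    proof (rule tendsto_sandwich[OF _ _ tendsto_const])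
      show "\<forall>\<^sub>F n in sequentially. 0 \<le> (\<integral>x. (g n x) ^ 4 \<partial>power_measure q \<mu>)"
        by (intro always_eventually allI integral_nonneg_AE) auto
      show "(\<lambda>n. (1 / \<alpha>) ^ q * (fact q * D n)) \<longlonglongrightarrow> 0"
        by (intro tendsto_mult_right_zero D0)
      show "\<forall>\<^sub>F n in sequentially. (\<integral>x. (g n x) ^ 4 \<partial>power_measure q \<mu>) \<le> (1 / \<alpha>) ^ q * (fact q * D n)"
      proof (rule eventually_sequentiallyI[of 1])
        fix n :: nat assume n: "1 \<le> n"
        have "(\<integral>x. (g n x) ^ 4 \<partial>power_measure q \<mu>) \<le> (1 / \<alpha>) ^ q * (fact q * (\<Sum>S\<in>Pow {1..N n}. (?\<phi> n S) ^ 4))"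
          unfolding g_def by (rule integral_kernel_fourth(2)[OF \<alpha> f_sym[OF n] f_diag[OF n]])
        also have "\<dots> \<le> (1 / \<alpha>) ^ q * (fact q * D n)"
          unfolding D_def using \<alpha>(1) q
          by (intro mult_left_mono sum_fourth_powers_le) (auto simp: set_coeff_card)
        finally show "(\<integral>x. (g n x) ^ 4 \<partial>power_measure q \<mu>) \<le> (1 / \<alpha>) ^ q * (fact q * D n)" .
      qed
    qed
    have norm0: "(\<lambda>n. L2_norm (power_measure (2 * q - r - l) \<mu>) (star_contraction \<mu> q q r l (g n) (g n))) \<longlonglongrightarrow> 0"
      if r: "r \<in> {1..q}" and l: "l \<in> {1..min r (q - 1)}" for r l
    proof -
      define e where "e = r - l"
      define c where "c = q - r"
      define C where "C = (1 / \<alpha>) ^ e * (fact l * fact (e + c))\<^sup>2"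
      \<comment> \<open>Since \<open>1 \<le> l\<close> and \<open>l \<le> q - 1\<close>, the level
        \<open>e + c = q - l\<close> is one of those summed in \<open>D\<close>; this is what the
        bound on \<open>l\<close> in the full condition is for when \<open>r = q\<close>.\<close>
      have qr: "q = l + (e + c)" "r = l + e" "2 * q - r - l = e + c + c" "1 \<le> e + c" "e + c < q"
        using r l q by (auto simp: e_def c_def)
      have C: "C > 0" using \<alpha>(1) by (simp add: C_def)
      show ?thesis
      proof (rule tendsto_sandwich[OF _ _ tendsto_const])
        show "(\<lambda>n. ennreal (sqrt (C * ?lv (e + c) n))) \<longlonglongrightarrow> 0"
          using C lv0[OF D0 qr(4,5)]
          by (subst ennreal_sqrt_tendsto_0_iff) (auto simp: level_nonneg intro: tendsto_mult_right_zero)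
        show "\<forall>\<^sub>F n in sequentially. L2_norm (power_measure (2 * q - r - l) \<mu>)
            (star_contraction \<mu> q q r l (g n) (g n)) \<le> ennreal (sqrt (C * ?lv (e + c) n))"
        proof (rule eventually_sequentiallyI[of 1])
          fix n :: nat assume n: "1 \<le> n"
          have f: "symmetric_on (l + (e + c)) (N n) (f n)" "vanishes_on_diagonals (l + (e + c)) (N n) (f n)"
            using f_sym[OF n] f_diag[OF n] qr(1) by simp_all
          show "L2_norm (power_measure (2 * q - r - l) \<mu>)
            (star_contraction \<mu> q q r l (g n) (g n)) \<le> ennreal (sqrt (C * ?lv (e + c) n))"
            unfolding qr(3) unfolding qr(2) unfolding g_def C_def qr(1)
            by (rule L2_norm_star_le[OF f \<alpha>])
        qed
      qed simp
    qed
    show ?full using int0 norm0 by blast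
  qed
qed

end

theorem theorem3p2:
  fixes M :: "'w measure" and \<mu> :: "'z measure"
    and lam :: "nat \<Rightarrow> real" and \<alpha> \<sigma> :: real
    and P :: "nat \<Rightarrow> 'w \<Rightarrow> real" and A :: "nat \<Rightarrow> 'z set"
    and q :: nat and N :: "nat \<Rightarrow> nat" and f :: "nat \<Rightarrow> (nat \<Rightarrow> nat) \<Rightarrow> real"
  defines "gi \<equiv> (\<lambda>i z. indicator (A i) z / sqrt (lam i))"
  defines "F \<equiv> (\<lambda>n. homogeneous_sum q (N n) (f n) P)"
  defines "g \<equiv> (\<lambda>n. tensor_kernel q (N n) (f n) gi)"
  defines "normal \<equiv> density lborel (\<lambda>y. ennreal (normal_density 0 \<sigma> y))"
  assumes lam_pos: "\<And>i. i \<ge> 1 \<Longrightarrow> lam i > 0"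
    and lam_inf: "(INF i\<in>{1..}. lam i) = \<alpha>" and alpha_pos: "\<alpha> > 0"
    and M: "prob_space M"
    and P_indep: "prob_space.indep_vars M (\<lambda>_. borel) P {1..}"
    and P_law: "\<And>i. i \<ge> 1 \<Longrightarrow>
      distr M borel (P i) =
      distr (measure_pmf (poisson_pmf (lam i))) borel (\<lambda>k. (real k - lam i) / sqrt (lam i))"
    and mu: "borel_space \<mu>" "sigma_finite_measure \<mu>" "non_atomic \<mu>"
    and A_sets: "\<And>i. i \<ge> 1 \<Longrightarrow> A i \<in> sets \<mu>"
    and A_disjoint: "disjoint_family_on A {1..}"
    and A_measure: "\<And>i. i \<ge> 1 \<Longrightarrow> emeasure \<mu> (A i) = ennreal (lam i)"
    and q: "q \<ge> 1"
    and N_ge: "\<And>n. n \<ge> 1 \<Longrightarrow> N n \<ge> q"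
    and N_lim: "filterlim N at_top sequentially"
    and f_sym: "\<And>n. n \<ge> 1 \<Longrightarrow> symmetric_on q (N n) (f n)"
    and f_diag: "\<And>n. n \<ge> 1 \<Longrightarrow> vanishes_on_diagonals q (N n) (f n)"
    and sigma_pos: "\<sigma> > 0"
    and second_moment: "(\<lambda>n. prob_space.expectation M (\<lambda>\<omega>. (F n \<omega>)\<^sup>2)) \<longlonglongrightarrow> \<sigma>\<^sup>2"
  defines "cond1 \<equiv> weak_conv_m (\<lambda>n. distr M borel (F n)) normal"
    and "cond2 \<equiv> (\<lambda>n. prob_space.expectation M (\<lambda>\<omega>. (F n \<omega>) ^ 4)) \<longlonglongrightarrow> (\<integral>y. y ^ 4 \<partial>normal)"
    and "cond3a \<equiv> (\<lambda>n. \<Sum>i=1..N n. (f n (\<lambda>k\<in>{..<q}. i)) ^ 4 * (1 / lam i)) \<longlonglongrightarrow> 0"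
    and "cond3b \<equiv>
      (\<lambda>n. \<integral>x. (g n x) ^ 4 \<partial>power_measure q \<mu>) \<longlonglongrightarrow> 0 \<and>
      (\<forall>r\<in>{1..q}. \<forall>l\<in>{1..min r (q - 1)}.
         (\<lambda>n. L2_norm (power_measure (2 * q - r - l) \<mu>)
                (star_contraction \<mu> q q r l (g n) (g n))) \<longlonglongrightarrow> 0)"
    and "cond3b' \<equiv>
      (\<forall>r\<in>{1..q - 1}.
         (\<lambda>n. L2_norm (power_measure (2 * q - 2 * r) \<mu>)
                (star_contraction \<mu> q q r r (g n) (g n))) \<longlonglongrightarrow> 0)"
  shows
    "(\<forall>\<eta>. compensated_poisson_measure M \<mu> \<eta> \<and>
           (\<forall>i\<ge>1. AE \<omega> in M. P i \<omega> = \<eta> (A i) \<omega> / sqrt (lam i)) \<longrightarrow>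
         (\<forall>n\<ge>1. is_multiple_integral M \<mu> \<eta> q (g n) (F n)))
     \<and> (\<integral>y. y ^ 4 \<partial>normal) = 3 * \<sigma> ^ 4
     \<and> (cond1 \<longleftrightarrow> cond2)
     \<and> (q = 1 \<longrightarrow> (cond1 \<longleftrightarrow> cond3a) \<and> (cond2 \<longleftrightarrow> cond3a))
     \<and> (q \<ge> 2 \<longrightarrow>
          (cond1 \<longleftrightarrow> cond3b) \<and> (cond2 \<longleftrightarrow> cond3b) \<and>
          (cond1 \<longleftrightarrow> cond3b') \<and> (cond2 \<longleftrightarrow> cond3b') \<and>
          (cond3b \<longleftrightarrow> cond3b'))"
proof -
  have lam_ge: "\<alpha> \<le> lam i" if "i \<ge> 1" for i
  proof -
    have "bdd_below (lam ` {1..})"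
      using lam_pos by (intro bdd_belowI[of _ 0]) (auto intro: less_imp_le)
    then show ?thesis unfolding lam_inf[symmetric] using that by (intro cINF_lower) auto
  qed
  interpret prob_space M by (rule M)
  interpret np: normalized_poisson M P lam \<alpha>
    by unfold_locales (use P_indep P_law lam_ge alpha_pos in auto)
  interpret sigma_finite_measure \<mu> by (rule mu(2))
  interpret dc: disjoint_cells \<mu> A lam
    by unfold_locales (use lam_pos A_sets A_disjoint A_measure in auto)
  \<comment> \<open>\<open>homogeneous_sum\<close> runs over ordered tuples, hence the factor
    \<open>fact q\<close> relative to \<open>set_coeff\<close>. It reappears as
    \<open>fact q ^ 4\<close> in \<open>contr_sum\<close> and does not affect convergence to
    0.\<close>
  define a where "a = (\<lambda>n S. fact q * set_coeff q (N n) (f n) S)"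
  define I where "I = (\<lambda>n. {1..N n})"
  have I: "finite (I n)" "I n \<subseteq> {1..}" for n by (auto simp: I_def)
  have a: "a n S = 0" if "card S \<noteq> q" for n S using that by (simp add: a_def set_coeff_card)
  have F_eq: "F n = np.chaos (I n) (a n)" if "n \<ge> 1" for n
    using homogeneous_sum_eq_sets[OF f_sym[OF that] f_diag[OF that], of P]
    by (simp add: F_def np.chaos_def[abs_def] fun_eq_iff a_def I_def)
  have "(\<lambda>n. expectation (\<lambda>\<omega>. (F n \<omega>)\<^sup>2)) \<longlonglongrightarrow> \<sigma>\<^sup>2 \<longleftrightarrow>
      (\<lambda>n. \<Sum>S\<in>Pow (I n). (a n S)\<^sup>2) \<longlonglongrightarrow> \<sigma>\<^sup>2"
    by (rule tendsto_cong_ge1) (simp add: F_eq np.expectation_chaos_sq[OF I])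
  with second_moment have v: "(\<lambda>n. \<Sum>S\<in>Pow (I n). (a n S)\<^sup>2) \<longlonglongrightarrow> \<sigma>\<^sup>2" by simp
  have n4: "(\<integral>y. y ^ 4 \<partial>normal) = 3 * \<sigma> ^ 4"
    unfolding normal_def by (rule normal_fourth_moment(1)[OF sigma_pos])
  let ?m4 = "(\<lambda>n. expectation (\<lambda>\<omega>. np.chaos (I n) (a n) \<omega> ^ 4)) \<longlonglongrightarrow> 3 * \<sigma> ^ 4"
  have main: "weak_conv_m (\<lambda>n. distr M borel (np.chaos (I n) (a n))) normal \<longleftrightarrow> ?m4"
    "q \<ge> 2 \<Longrightarrow> ?m4 \<longleftrightarrow> (\<lambda>n. contr_sum (I n) q (a n)) \<longlonglongrightarrow> 0"
    "q = 1 \<Longrightarrow> ?m4 \<longleftrightarrow> (\<lambda>n. \<Sum>i\<in>I n. (np.\<kappa> i)\<^sup>2 * a n {i} ^ 4) \<longlonglongrightarrow> 0"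
    unfolding normal_def
    by (rule np.chaos_fourth_moment[OF I _ q sigma_pos v]; (rule a | assumption); assumption)+
  have c2: "cond2 \<longleftrightarrow> ?m4"
    unfolding cond2_def n4 by (rule tendsto_cong_ge1) (simp add: F_eq)
  have "cond1 \<longleftrightarrow> weak_conv_m (\<lambda>n. distr M borel (np.chaos (I n) (a n))) normal"
    unfolding cond1_def by (rule weak_conv_m_cong_ge1) (simp add: F_eq)
  then have c12: "cond1 \<longleftrightarrow> cond2" using main(1) c2 by simp
  have c23a: "cond2 \<longleftrightarrow> cond3a" if q1: "q = 1"
  proof -
    have "cond3a \<longleftrightarrow> (\<lambda>n. \<Sum>i\<in>I n. (np.\<kappa> i)\<^sup>2 * a n {i} ^ 4) \<longlonglongrightarrow> 0"
      unfolding cond3a_def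
    proof (rule tendsto_cong_ge1)
      fix n :: nat assume n: "n \<ge> 1"
      show "(\<Sum>i=1..N n. (f n (\<lambda>k\<in>{..<q}. i)) ^ 4 * (1 / lam i)) = (\<Sum>i\<in>I n. (np.\<kappa> i)\<^sup>2 * a n {i} ^ 4)"
        unfolding I_def
      proof (intro sum.cong refl)
        fix i assume i: "i \<in> {1..N n}"
        then have mi: "(\<lambda>k\<in>{..<q}. i) \<in> multi_index q (N n)" by (auto simp: multi_index_def)
        have im: "(\<lambda>k\<in>{..<q}. i) ` {..<q} = {i}" using q1 by auto
        have "f n (\<lambda>k\<in>{..<q}. i) = a n {i}"
          using kernel_eq_set_coeff[OF f_sym[OF n] f_diag[OF n] mi] q1 unfolding im a_def by simp
        moreover have "(np.\<kappa> i)\<^sup>2 = 1 / lam i" using i by (intro np.kappa_sq) auto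
        ultimately show "(f n (\<lambda>k\<in>{..<q}. i)) ^ 4 * (1 / lam i) = (np.\<kappa> i)\<^sup>2 * a n {i} ^ 4" by simp
      qed
    qed
    then show ?thesis using main(3)[OF q1] c2 by blast
  qed
  have c23: "cond2 \<longleftrightarrow> cond3b" "cond2 \<longleftrightarrow> cond3b'" if q2: "q \<ge> 2"
  proof -
    let ?D = "\<lambda>n. contr_sum {1..N n} q (set_coeff q (N n) (f n))"
    have "?m4 \<longleftrightarrow> (\<lambda>n. fact q ^ 4 * ?D n) \<longlonglongrightarrow> 0"
      using main(2)[OF q2] unfolding a_def contr_sum_scale I_def .
    also have "\<dots> \<longleftrightarrow> ?D \<longlonglongrightarrow> 0"
      using tendsto_mult_left_iff[of "fact q ^ 4 :: real" ?D 0 sequentially] by simp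
    finally have D: "cond2 \<longleftrightarrow> ?D \<longlonglongrightarrow> 0" using c2 by blast
    note cc = dc.contraction_conditions[of \<alpha> q N f, OF alpha_pos lam_ge q2 f_sym f_diag]
    show "cond2 \<longleftrightarrow> cond3b'" unfolding D cond3b'_def g_def gi_def using cc(1) by blast
    show "cond2 \<longleftrightarrow> cond3b" unfolding D cond3b_def g_def gi_def using cc(2) by blast
  qed
  have int: "is_multiple_integral M \<mu> \<eta> q (g n) (F n)"
    if \<eta>: "\<forall>i\<ge>1. AE \<omega> in M. P i \<omega> = \<eta> (A i) \<omega> / sqrt (lam i)" and n: "n \<ge> 1" for \<eta> n
    unfolding g_def gi_def F_def
  proof (rule dc.is_multiple_integral_homogeneous_sum[OF f_diag[OF n]])
    show "has_moments M (homogeneous_sum q (N n) (f n) P)"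
      using np.has_moments_chaos[OF I(2)] F_eq[OF n] by (simp add: F_def)
  qed (use \<eta> in auto)
  show ?thesis
    using int n4 c12 c23a c23 by blast
qed

end
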